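(* Let $\delta>0$ and $f\in L^2(\Omega)$ be fixed, and let $p=2$. Let $J:\mathcal{A}^\delta\times\mathcal{U}^\delta\to\mathbb{R}$ be an objective function such that $(\rho,u)\mapsto J(\rho,u)$ is sequentially lower semicontinuous with respect to (weak$^*$ topology of $L^\infty(\Omega_\delta)$) $\times$ (norm topology of $\mathcal{U}_0^\delta$). Then the optimal design problem $$\text{minimize } J(\rho,u)\quad\text{over }(\rho,u)\in\mathcal{A}^\delta\times\mathcal{U}_0^\delta\quad\text{subject to}\quad a_{\delta,\kappa}(u,v)=\ell(v)\ \ \forall v\in\mathcal{U}_0^\delta,\quad \kappa(x,x')=\rho^{p/2}(x)\rho^{p/2}(x'),$$ admits an optimal solution $(\rho^*,u^* )\in\mathcal{A}^\delta\times\mathcal{U}_0^\delta$.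
   Context: $\Omega\subset\mathbb{R}^n$, $n\ge2$, is open, bounded and connected. For $\delta>0$, $B(x,\delta)$ is the open ball, and $\Omega_\delta=\bigcup_{x\in\Omega}B(x,\delta)$. Kernel: for every $\delta>0$, $A_\delta:\mathbb{R}_+\to\mathbb{R}_+$ satisfies $\frac1n\int_{\mathbb{R}^n}A_\delta(|x|)\,dx=1$ and $\operatorname{supp}A_\delta(|\cdot|)\subset B(0,\delta)$, and there exist $s\in(0,1)$ and $c_\delta>0$ such that $A_\delta(|x|)\ge c_\delta|x|^{-(n+2s-2)}$ for all $x\in B(0,\delta/2)\setminus\{0\}$, $\delta>0$. Bilinear form: for symmetric $\kappa\in L^\infty(\Omega_\delta\times\Omega_\delta)$ bounded between two positive constants, $$a_{\delta,\kappa}(u,v)=\int_{\Omega_\delta}\int_{\Omega_\delta}\kappa(x,x')A_\delta(|x-x'|)\frac{u(x)-u(x')}{|x-x'|}\frac{v(x)-v(x')}{|x-x'|}\,dx\,dx'.$$ Linear functional: $\ell(v)=\int_\Omega f(x)v(x)\,dx$. Spaces: $\mathcal{U}^\delta=\{u\in L^2(\Omega_\delta): a_{\delta,1}(u,u)<\infty\}$; $\mathcal{U}_0^\delta$ is the closure of $C_c^\infty(\Omega)$ (functions extended by $0$ outside $\Omega$) in $\mathcal{U}^\delta$ with respect to the norm $(\|u\|_{L^2(\Omega_\delta)}^2+a_{\delta,1}(u,u))^{1/2}$; its elements vanish a.e. in $\Omega_\delta\setminus\Omega$. The form $a_{\delta,1}$ is an inner product making $\mathcal{U}_0^\delta$ a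 Hilbert space, and the norm of $\mathcal{U}_0^\delta$ is $\|u\|_{\mathcal{U}_0^\delta}=a_{\delta,1}(u,u)^{1/2}$. Admissible designs: given constants $0<\underline\rho<\overline\rho<\infty$ and $\gamma\in(\underline\rho,\overline\rho)$, $$\mathcal{A}^\delta=\Big\{\rho\in L^\infty(\Omega_\delta):\ \underline\rho\le\rho\le\overline\rho\ \text{a.e. in }\Omega_\delta,\ \int_\Omega\rho\,dx\le\gamma|\Omega|\Big\}.$$ An optimal solution is a feasible pair (i.e. one satisfying the constraint) whose objective value is no larger than that of any other feasible pair. *)

theory Defs
  imports "HOL-Analysis.Analysis"
begin

text \<open>
  Elements of Lebesgue spaces are represented by total functions that are Lebesgue measurable
  on the domain; only their values almost everywhere on that domain matter.
\<close>

definition L2_on :: "('a::euclidean_space) set \<Rightarrow> ('a \<Rightarrow> real) set" where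
  "L2_on S = {u. u \<in> borel_measurable (lebesgue_on S) \<and>
                 integrable (lebesgue_on S) (\<lambda>x. (u x)\<^sup>2)}"

definition Linf_on :: "('a::euclidean_space) set \<Rightarrow> ('a \<Rightarrow> real) set" where
  "Linf_on S = {r. r \<in> borel_measurable (lebesgue_on S) \<and>
                   (\<exists>C. AE x in lebesgue_on S. \<bar>r x\<bar> \<le> C)}"

definition weak_star_Linf_tendsto ::
  "('a::euclidean_space) set \<Rightarrow> (nat \<Rightarrow> 'a \<Rightarrow> real) \<Rightarrow> ('a \<Rightarrow> real) \<Rightarrow> bool" where
  "weak_star_Linf_tendsto S R r \<longleftrightarrow>
     (\<forall>g. integrable (lebesgue_on S) g \<longrightarrow>
        (\<lambda>j. LINT x|lebesgue_on S. R j x * g x) \<longlonglongrightarrow> (LINT x|lebesgue_on S. r x * g x))"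

primrec Ck :: "nat \<Rightarrow> (real^'n \<Rightarrow> real) \<Rightarrow> bool" where
  "Ck 0 f \<longleftrightarrow> continuous_on UNIV f"
| "Ck (Suc k) f \<longleftrightarrow>
     (\<exists>G :: real^'n \<Rightarrow> real^'n.
        (\<forall>x. (f has_derivative (\<lambda>h. G x \<bullet> h)) (at x)) \<and> (\<forall>i. Ck k (\<lambda>x. G x $ i)))"

definition test_functions :: "(real^'n) set \<Rightarrow> (real^'n \<Rightarrow> real) set" where
  "test_functions \<Omega> = {\<phi>. (\<forall>k. Ck k \<phi>) \<and>
     compact (closure {x. \<phi> x \<noteq> 0}) \<and> closure {x. \<phi> x \<noteq> 0} \<subseteq> \<Omega>}"

definition nbhd :: "(real^'n) set \<Rightarrow> real \<Rightarrow> (real^'n) set" where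
  "nbhd \<Omega> \<delta> = (\<Union>x\<in>\<Omega>. ball x \<delta>)"

definition nl_integrand ::
  "(real \<Rightarrow> real \<Rightarrow> real) \<Rightarrow> real \<Rightarrow> (real^'n \<Rightarrow> real^'n \<Rightarrow> real) \<Rightarrow>
   (real^'n \<Rightarrow> real) \<Rightarrow> (real^'n \<Rightarrow> real) \<Rightarrow> (real^'n) \<times> (real^'n) \<Rightarrow> real" where
  "nl_integrand A \<delta> \<kappa> u v = (\<lambda>(x, x').
     \<kappa> x x' * A \<delta> (norm (x - x')) *
     ((u x - u x') / norm (x - x')) * ((v x - v x') / norm (x - x')))"

text \<open>The double integral is the Lebesgue integral over the product domain. On the diagonal,
  a null set, the integrand is \<open>0\<close> by the convention for division by zero.\<close>

definition nl_form ::
  "(real^'n) set \<Rightarrow> (real \<Rightarrow> real \<Rightarrow> real) \<Rightarrow> real \<Rightarrow> (real^'n \<Rightarrow> real^'n \<Rightarrow> real) \<Rightarrow>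
   (real^'n \<Rightarrow> real) \<Rightarrow> (real^'n \<Rightarrow> real) \<Rightarrow> real" where
  "nl_form \<Omega> A \<delta> \<kappa> u v =
     (LINT z|lebesgue_on (nbhd \<Omega> \<delta> \<times> nbhd \<Omega> \<delta>). nl_integrand A \<delta> \<kappa> u v z)"

definition lin_fun :: "(real^'n) set \<Rightarrow> (real^'n \<Rightarrow> real) \<Rightarrow> (real^'n \<Rightarrow> real) \<Rightarrow> real" where
  "lin_fun \<Omega> f v = (LINT x|lebesgue_on \<Omega>. f x * v x)"

text \<open>The integrand of \<open>nl_form \<Omega> A \<delta> (\<lambda>_ _. 1) u u\<close> is nonnegative for a nonnegative kernel,
  so finiteness of the energy is integrability.\<close>

definition U_space ::
  "(real^'n) set \<Rightarrow> (real \<Rightarrow> real \<Rightarrow> real) \<Rightarrow> real \<Rightarrow> (real^'n \<Rightarrow> real) set" where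
  "U_space \<Omega> A \<delta> = {u \<in> L2_on (nbhd \<Omega> \<delta>).
     integrable (lebesgue_on (nbhd \<Omega> \<delta> \<times> nbhd \<Omega> \<delta>)) (nl_integrand A \<delta> (\<lambda>_ _. 1) u u)}"

definition U_norm ::
  "(real^'n) set \<Rightarrow> (real \<Rightarrow> real \<Rightarrow> real) \<Rightarrow> real \<Rightarrow> (real^'n \<Rightarrow> real) \<Rightarrow> real" where
  "U_norm \<Omega> A \<delta> u =
     sqrt ((LINT x|lebesgue_on (nbhd \<Omega> \<delta>). (u x)\<^sup>2) + nl_form \<Omega> A \<delta> (\<lambda>_ _. 1) u u)"

definition U0_space ::
  "(real^'n) set \<Rightarrow> (real \<Rightarrow> real \<Rightarrow> real) \<Rightarrow> real \<Rightarrow> (real^'n \<Rightarrow> real) set" where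
  "U0_space \<Omega> A \<delta> = {u \<in> U_space \<Omega> A \<delta>.
     \<forall>\<epsilon>>0. \<exists>\<phi> \<in> test_functions \<Omega> \<inter> U_space \<Omega> A \<delta>. U_norm \<Omega> A \<delta> (\<lambda>x. u x - \<phi> x) < \<epsilon>}"

definition U0_norm ::
  "(real^'n) set \<Rightarrow> (real \<Rightarrow> real \<Rightarrow> real) \<Rightarrow> real \<Rightarrow> (real^'n \<Rightarrow> real) \<Rightarrow> real" where
  "U0_norm \<Omega> A \<delta> u = sqrt (nl_form \<Omega> A \<delta> (\<lambda>_ _. 1) u u)"

definition designs ::
  "(real^'n) set \<Rightarrow> real \<Rightarrow> real \<Rightarrow> real \<Rightarrow> real \<Rightarrow> (real^'n \<Rightarrow> real) set" where
  "designs \<Omega> \<delta> \<rho>min \<rho>max \<gamma> = {\<rho> \<in> Linf_on (nbhd \<Omega> \<delta>).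
     (AE x in lebesgue_on (nbhd \<Omega> \<delta>). \<rho>min \<le> \<rho> x \<and> \<rho> x \<le> \<rho>max) \<and>
     (LINT x|lebesgue_on \<Omega>. \<rho> x) \<le> \<gamma> * measure lebesgue \<Omega>}"

text \<open>Applied to constant sequences whose limit agrees almost everywhere with the terms, the
  condition below makes \<open>J\<close>, on admissible pairs, independent of the representatives of the classes of \<open>\<rho>\<close> and \<open>u\<close>.\<close>

definition seq_lsc ::
  "(real^'n) set \<Rightarrow> (real \<Rightarrow> real \<Rightarrow> real) \<Rightarrow> real \<Rightarrow> real \<Rightarrow> real \<Rightarrow> real \<Rightarrow>
   ((real^'n \<Rightarrow> real) \<Rightarrow> (real^'n \<Rightarrow> real) \<Rightarrow> real) \<Rightarrow> bool" where
  "seq_lsc \<Omega> A \<delta> \<rho>min \<rho>max \<gamma> J \<longleftrightarrow>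
     (\<forall>R \<rho> V u.
        (\<forall>j. R j \<in> designs \<Omega> \<delta> \<rho>min \<rho>max \<gamma>) \<and> \<rho> \<in> designs \<Omega> \<delta> \<rho>min \<rho>max \<gamma> \<and>
        (\<forall>j. V j \<in> U0_space \<Omega> A \<delta>) \<and> u \<in> U0_space \<Omega> A \<delta> \<and>
        weak_star_Linf_tendsto (nbhd \<Omega> \<delta>) R \<rho> \<and>
        (\<lambda>j. U0_norm \<Omega> A \<delta> (\<lambda>x. V j x - u x)) \<longlonglongrightarrow> 0
        \<longrightarrow> ereal (J \<rho> u) \<le> liminf (\<lambda>j. ereal (J (R j) (V j))))"

definition feasible ::
  "(real^'n) set \<Rightarrow> (real \<Rightarrow> real \<Rightarrow> real) \<Rightarrow> real \<Rightarrow> real \<Rightarrow> real \<Rightarrow> real \<Rightarrow> real \<Rightarrow>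
   (real^'n \<Rightarrow> real) \<Rightarrow> (real^'n \<Rightarrow> real) \<Rightarrow> (real^'n \<Rightarrow> real) \<Rightarrow> bool" where
  "feasible \<Omega> A \<delta> \<rho>min \<rho>max \<gamma> p f \<rho> u \<longleftrightarrow>
     \<rho> \<in> designs \<Omega> \<delta> \<rho>min \<rho>max \<gamma> \<and> u \<in> U0_space \<Omega> A \<delta> \<and>
     (\<forall>v \<in> U0_space \<Omega> A \<delta>.
        nl_form \<Omega> A \<delta> (\<lambda>x x'. \<rho> x powr (p/2) * \<rho> x' powr (p/2)) u v = lin_fun \<Omega> f v)"

end

theory Submission
  imports Defs "HOL-Complex_Analysis.Great_Picard"
begin

text \<open>
  The proof is the direct method. Feasible pairs exist, since by coercivity the Riesz representation theorem
  gives a state for every design (\<open>ex_state\<close>), and every sequence of feasible pairs has a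
  subsequence whose designs converge weak-star and whose states converge in the energy norm to a
  feasible pair (\<open>feasible_pairs_compact\<close>). Applied to a minimizing sequence, lower semicontinuity
  of the objective makes the limit a minimizer. All the work is in the compactness.

  The bounds on the designs give a weak-star convergent subsequence (\<open>weak_star_compactness\<close>),
  and coercivity bounds the energies of the states. The singularity of the kernel then gives an almost
  everywhere convergent subsequence of states \<open>u\<^sub>n \<rightarrow> u\<close> (\<open>Rellich\<close>). Two facts allow passing to
  the limit in the form \<open>a\<^sub>n(u\<^sub>n, g)\<close> with coefficient \<open>\<rho>\<^sub>n(x) \<rho>\<^sub>n(x')\<close>, for any fixed \<open>g\<close> of finite
  energy. The tensor squares of the designs converge weak-star on the product domain, by Fubini
  (\<open>weak_star_tendsto_tensor_square\<close>). And the integrands converge in \<open>L\<^sup>1\<close>: a sequence that is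
  bounded in \<open>L\<^sup>2\<close> and tends to \<open>0\<close> almost everywhere, multiplied by a fixed function in \<open>L\<^sup>2\<close>, tends to
  \<open>0\<close> in \<open>L\<^sup>1\<close> (\<open>integral_abs_tendsto_0_of_square_le\<close>). A weakly convergent coefficient thus meets a
  strongly convergent integrand.

  So \<open>u\<close> solves the limit equation \<open>a(u, g) = L(g)\<close>. Testing it with \<open>u\<^sub>n\<close> and letting \<open>n\<close> tend to infinity
  gives \<open>a(u, u) = L(u)\<close>, even before \<open>u\<close> is known to be a limit of test functions. Hence
  \<open>a\<^sub>n(u\<^sub>n - u, u\<^sub>n - u) = L(u\<^sub>n) - 2 a\<^sub>n(u\<^sub>n, u) + a\<^sub>n(u, u)\<close> tends to \<open>L(u) - 2 a(u, u) + a(u, u) = 0\<close>, and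
  coercivity turns this into convergence in the energy norm; in particular \<open>u\<close> belongs to the closed
  space of states.

  The Poincare inequality and the Rellich theorem both rest on one estimate
  (\<open>local_oscillation_le_energy\<close>): near the diagonal the kernel divided by \<open>|x - x'|\<^sup>2\<close> is at least a
  multiple of \<open>|x - x'|\<close> to the power \<open>- (n + 2 s)\<close>, so the integral of \<open>(u(x) - u(x'))\<^sup>2\<close> over
  \<open>|x - x'| < r\<close> is at most a constant times \<open>r\<^sup>n\<^sup>+\<^sup>2\<^sup>s\<close> times the energy. For fixed \<open>r\<close>, iterated doubling of
  translations until the support has left itself gives the Poincare inequality. As \<open>r\<close> tends to \<open>0\<close> this
  is \<open>o(r\<^sup>n)\<close>, so that \<open>u\<close> is uniformly close to its averages over balls of radius \<open>r\<close>; averages of a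
  weakly convergent sequence converge pointwise, which gives compactness.
\<close>

section \<open>Limits under the integral sign\<close>

text \<open>
  Fatou's lemma for real-valued integrals, with integrability of the limit as part of the conclusion.
\<close>

lemma integral_limit_le:
  fixes f :: "nat \<Rightarrow> 'a \<Rightarrow> real"
  assumes int: "\<And>n. integrable M (f n)" and nonneg: "\<And>n. AE x in M. 0 \<le> f n x"
    and lim: "AE x in M. (\<lambda>n. f n x) \<longlonglongrightarrow> g x" and g: "g \<in> borel_measurable M"
    and bound: "\<And>n. n \<ge> N \<Longrightarrow> integral\<^sup>L M (f n) \<le> C"
  shows "integrable M g" "integral\<^sup>L M g \<le> C"
proof -
  have nn: "AE x in M. \<forall>n. 0 \<le> f n x" using nonneg by (simp add: AE_all_countable)
  have g0: "AE x in M. 0 \<le> g x"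
    using nn lim by eventually_elim (auto intro: LIMSEQ_le_const)
  have C0: "0 \<le> C"
    using integral_nonneg_AE[OF nonneg[of N]] bound[of N] by simp
  have "(\<integral>\<^sup>+x. ennreal (g x) \<partial>M) = (\<integral>\<^sup>+x. liminf (\<lambda>n. ennreal (f n x)) \<partial>M)"
    by (rule nn_integral_cong_AE, use lim in eventually_elim)
      (auto intro!: lim_imp_Liminf[symmetric] tendsto_ennrealI)
  also have "\<dots> \<le> liminf (\<lambda>n. \<integral>\<^sup>+x. ennreal (f n x) \<partial>M)"
    using int by (intro nn_integral_liminf) auto
  also have "\<dots> \<le> ennreal C"
  proof (rule Liminf_le)
    show "\<forall>\<^sub>F n in sequentially. (\<integral>\<^sup>+x. ennreal (f n x) \<partial>M) \<le> ennreal C"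
      using eventually_ge_at_top[of N]
    proof eventually_elim
      case (elim n)
      then show ?case
        using nn_integral_eq_integral[OF int nonneg, of n] bound[of n] by (simp add: ennreal_leI)
    qed
  qed simp
  finally have le: "(\<integral>\<^sup>+x. ennreal (g x) \<partial>M) \<le> ennreal C" .
  have "(\<integral>\<^sup>+x. ennreal (g x) \<partial>M) < \<infinity>"
    using le by (auto intro: le_less_trans)
  then show ig: "integrable M g"
    using g g0 by (intro integrableI_nonneg) auto
  show "integral\<^sup>L M g \<le> C"
    using le nn_integral_eq_integral[OF ig g0] C0 by simp
qed

text \<open>
  Young's inequality. Together with \<open>g\<^sup>2 \<le> q V\<close> it takes the place of the Cauchy-Schwarz inequality
  for integrals: it can be integrated directly, and \<open>\<eta>\<close> is chosen afterwards.
\<close>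

lemma abs_le_of_square_le_mult:
  fixes g q V \<eta> :: real
  assumes "g\<^sup>2 \<le> q * V" "0 \<le> q" "0 \<le> V" "0 < \<eta>"
  shows "\<bar>g\<bar> \<le> \<eta> * q + V / (4 * \<eta>)"
proof -
  have "g\<^sup>2 \<le> q * V" by fact
  also have "q * V \<le> (\<eta> * q + V / (4 * \<eta>))\<^sup>2"
  proof -
    have "(\<eta> * q + V / (4 * \<eta>))\<^sup>2 - q * V = (\<eta> * q - V / (4 * \<eta>))\<^sup>2"
      using assms(4) by (simp add: power2_eq_square field_simps)
    then show ?thesis by (smt (verit) zero_le_power2)
  qed
  finally show ?thesis
    using assms by (intro power2_le_imp_le[of "\<bar>g\<bar>"]) auto
qed

text \<open>
  The Riesz-Fischer argument. Along a subsequence with \<open>\<integral> d\<^sub>k\<^sup>2 \<le> 4\<^sup>-\<^sup>k\<close> for the increments \<open>d\<^sub>k\<close>, the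
  series of \<open>2\<^sup>k d\<^sub>k\<^sup>2\<close> has finite integral, so it converges almost everywhere; then so does the
  series of \<open>|d\<^sub>k| \<le> 2\<^sup>k d\<^sub>k\<^sup>2 + 2\<^sup>-\<^sup>k\<close>.
\<close>

lemma AE_convergent_subseq_of_L2_Cauchy:
  fixes u :: "nat \<Rightarrow> 'a \<Rightarrow> real"
  assumes meas: "\<And>n. u n \<in> borel_measurable M"
    and int: "\<And>i j. integrable M (\<lambda>x. (u i x - u j x)\<^sup>2)"
    and Cauchy: "\<And>\<epsilon>. \<epsilon> > 0 \<Longrightarrow> \<exists>N. \<forall>i\<ge>N. \<forall>j\<ge>N. (LINT x|M. (u i x - u j x)\<^sup>2) \<le> \<epsilon>"
  obtains r w where "strict_mono (r::nat\<Rightarrow>nat)" "w \<in> borel_measurable M"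
    "AE x in M. (\<lambda>k. u (r k) x) \<longlonglongrightarrow> w x"
proof -
  define P where "P k N \<longleftrightarrow> (\<forall>i\<ge>N. \<forall>j\<ge>N. (LINT x|M. (u i x - u j x)\<^sup>2) \<le> (1/4)^k)" for k N :: nat
  have ex: "\<exists>N. P k N" for k unfolding P_def by (rule Cauchy) simp
  have "\<exists>r. \<forall>k. P k (r k) \<and> r k < r (Suc k)"
  proof (rule dependent_nat_choice)
    show "\<exists>x. P 0 x" by (rule ex)
    fix x k assume "P k x"
    obtain N where "P (Suc k) N" using ex by blast
    then have "P (Suc k) (max N (Suc x))" by (auto simp: P_def)
    then show "\<exists>y. P (Suc k) y \<and> x < y" by (intro exI[of _ "max N (Suc x)"]) auto
  qed
  then obtain r where r: "\<And>k. P k (r k)" "\<And>k. r k < r (Suc k)" by blast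
  have mono: "strict_mono r" using r(2) by (simp add: strict_mono_Suc_iff)
  define d where "d k x = u (r (Suc k)) x - u (r k) x" for k x
  have d_int: "(LINT x|M. (d k x)\<^sup>2) \<le> (1/4)^k" for k
    using r(1)[of k] r(2)[of k] unfolding P_def d_def by auto
  have "(\<integral>\<^sup>+x. (\<Sum>k. ennreal (2^k * (d k x)\<^sup>2)) \<partial>M) = (\<Sum>k. \<integral>\<^sup>+x. ennreal (2^k * (d k x)\<^sup>2) \<partial>M)"
    using meas by (intro nn_integral_suminf) (auto simp: d_def)
  also have "\<dots> \<le> (\<Sum>k. ennreal ((1/2)^k))"
  proof (rule suminf_le)
    fix k
    have "(\<integral>\<^sup>+x. ennreal (2^k * (d k x)\<^sup>2) \<partial>M) = ennreal (LINT x|M. 2^k * (d k x)\<^sup>2)"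
      using int by (intro nn_integral_eq_integral) (auto simp: d_def)
    also have "\<dots> \<le> ennreal (2^k * (1/4)^k)"
      using d_int[of k] by (intro ennreal_leI) simp
    also have "(2::real)^k * (1/4)^k = (1/2)^k"
      using power_mult_distrib[of "2::real" "1/4" k] by simp
    finally show "(\<integral>\<^sup>+x. ennreal (2^k * (d k x)\<^sup>2) \<partial>M) \<le> ennreal ((1/2)^k)" .
  qed auto
  also have "(\<Sum>k. ennreal ((1/2)^k)) = ennreal (\<Sum>k. (1/2)^k)"
    by (rule suminf_ennreal2) (auto intro: summable_geometric)
  also have "\<dots> < \<infinity>" by (simp only: infinity_ennreal_def ennreal_less_top)
  finally have "(\<integral>\<^sup>+x. (\<Sum>k. ennreal (2^k * (d k x)\<^sup>2)) \<partial>M) \<noteq> \<infinity>" by (rule less_imp_neq)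
  then have "AE x in M. (\<Sum>k. ennreal (2^k * (d k x)\<^sup>2)) \<noteq> \<infinity>"
    using meas by (intro nn_integral_PInf_AE) (auto simp: d_def)
  then have conv: "AE x in M. convergent (\<lambda>k. u (r k) x)"
  proof eventually_elim
    case (elim x)
    have s: "summable (\<lambda>k. 2^k * (d k x)\<^sup>2)"
      using elim by (intro summable_suminf_not_top) auto
    have "summable (\<lambda>k. d k x)"
    proof (rule summable_comparison_test')
      show "summable (\<lambda>k. 2^k * (d k x)\<^sup>2 + (1/2)^k)"
        using s by (intro summable_add summable_geometric) auto
      fix k :: nat
      have inv: "(2::real)^k * (1/2)^k = 1"
        using power_mult_distrib[of "2::real" "1/2" k] by simp
      have "\<bar>d k x\<bar> \<le> 1/2 * (2^k * (d k x)\<^sup>2) + (1/2)^k / (4 * (1/2))"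
      proof (rule abs_le_of_square_le_mult)
        show "(d k x)\<^sup>2 \<le> 2^k * (d k x)\<^sup>2 * (1/2)^k"
          unfolding mult.assoc mult.left_commute[of "2^k"] inv by simp
      qed auto
      moreover have "0 \<le> 2^k * (d k x)\<^sup>2" "0 \<le> (1/2::real)^k" by auto
      ultimately have "\<bar>d k x\<bar> \<le> 2^k * (d k x)\<^sup>2 + (1/2)^k" by linarith
      then show "norm (d k x) \<le> 2^k * (d k x)\<^sup>2 + (1/2)^k" by simp
    qed
    then have "convergent (\<lambda>n. (\<Sum>k<n. d k x) + u (r 0) x)"
      by (intro convergent_add) (auto simp: summable_iff_convergent convergent_const)
    moreover have "(\<Sum>k<n. d k x) + u (r 0) x = u (r n) x" for n
      using sum_lessThan_telescope[of "\<lambda>k. u (r k) x" n] by (simp add: d_def)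
    ultimately show ?case by simp
  qed
  define w where "w x = lim (\<lambda>k. u (r k) x)" for x
  have w: "w \<in> borel_measurable M"
    unfolding w_def using meas by (rule borel_measurable_lim_metric)
  have "AE x in M. (\<lambda>k. u (r k) x) \<longlonglongrightarrow> w x"
    using conv by eventually_elim (simp add: w_def convergent_LIMSEQ_iff)
  then show thesis using that mono w by blast
qed

text \<open>
  Typically \<open>g n\<close> is the product of a factor whose square is \<open>q n\<close> and a fixed factor whose square is \<open>V\<close>.
  No dominating function for \<open>g n\<close> is available, but the excess of \<open>|g n|\<close> over \<open>\<eta> q n\<close> is dominated by
  \<open>V / (4 \<eta>)\<close> and tends to \<open>0\<close>, while \<open>\<eta> q n\<close> has integral at most \<open>\<eta> C\<close>.
\<close>

lemma integral_abs_tendsto_0_of_square_le: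
  fixes g q :: "nat \<Rightarrow> 'a \<Rightarrow> real" and V :: "'a \<Rightarrow> real"
  assumes g: "\<And>n. g n \<in> borel_measurable M"
    and q: "\<And>n. integrable M (q n)" "\<And>n. AE x in M. 0 \<le> q n x" "\<And>n. integral\<^sup>L M (q n) \<le> C"
    and V: "integrable M V" "AE x in M. 0 \<le> V x"
    and le: "\<And>n. AE x in M. (g n x)\<^sup>2 \<le> q n x * V x"
    and lim: "AE x in M. (\<lambda>n. q n x) \<longlonglongrightarrow> 0"
  shows "integrable M (g n)" "(\<lambda>n. LINT x|M. \<bar>g n x\<bar>) \<longlonglongrightarrow> 0"
proof -
  have bd: "AE x in M. \<bar>g n x\<bar> \<le> \<eta> * q n x + V x / (4 * \<eta>)" if "\<eta> > 0" for n \<eta>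
    using q(2)[of n] V(2) le[of n] by eventually_elim (use that in \<open>auto intro: abs_le_of_square_le_mult\<close>)
  show int: "integrable M (g n)" for n
  proof (rule Bochner_Integration.integrable_bound)
    show "integrable M (\<lambda>x. 1 * q n x + V x / (4 * 1))" using q(1) V by simp
    show "AE x in M. norm (g n x) \<le> norm (1 * q n x + V x / (4 * 1))"
      using bd[of 1 n] by auto
  qed (rule g)
  show "(\<lambda>n. LINT x|M. \<bar>g n x\<bar>) \<longlonglongrightarrow> 0"
  proof (rule LIMSEQ_I)
    fix \<epsilon> :: real assume \<epsilon>: "\<epsilon> > 0"
    define K where "K = max C 1"
    define \<eta> where "\<eta> = \<epsilon> / (2 * K)"
    have K: "K \<ge> 1" "C \<le> K" by (auto simp: K_def)
    have \<eta>: "\<eta> > 0" "\<eta> * K = \<epsilon> / 2" using \<epsilon> K by (auto simp: \<eta>_def)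
    \<comment> \<open>the excess, to which dominated convergence applies\<close>
    define h where "h n x = max 0 (\<bar>g n x\<bar> - \<eta> * q n x)" for n x
    have h_meas: "h n \<in> borel_measurable M" for n
      unfolding h_def using g q(1) by (auto intro!: borel_measurable_max borel_measurable_diff)
    have h_bd: "AE x in M. norm (h n x) \<le> V x / (4 * \<eta>)" for n
      using bd[OF \<eta>(1), of n] V(2) by eventually_elim (use \<eta> in \<open>auto simp: h_def\<close>)
    have h_lim: "AE x in M. (\<lambda>n. h n x) \<longlonglongrightarrow> 0"
    proof -
      have "AE x in M. \<forall>n. (g n x)\<^sup>2 \<le> q n x * V x \<and> 0 \<le> q n x"
        using le q(2) by (simp add: AE_all_countable)
      with lim V(2) show ?thesis
      proof eventually_elim
        case (elim x)
        have sq: "(\<lambda>n. sqrt (q n x * V x)) \<longlonglongrightarrow> 0"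
          using tendsto_real_sqrt[OF tendsto_mult_right[OF elim(1), of "V x"]] by simp
        have hb: "norm (h n x) \<le> sqrt (q n x * V x)" for n
        proof -
          have "\<bar>g n x\<bar> \<le> sqrt (q n x * V x)"
            using elim(3)[rule_format, of n] by (metis real_sqrt_abs real_sqrt_le_mono)
          moreover have "0 \<le> \<eta> * q n x" using elim(3)[rule_format, of n] \<eta> by simp
          moreover have "0 \<le> sqrt (q n x * V x)" using elim by simp
          ultimately show ?thesis by (auto simp: h_def)
        qed
        show ?case
          by (rule Lim_null_comparison[OF always_eventually sq]) (use hb in blast)
      qed
    qed
    have V4: "integrable M (\<lambda>x. V x / (4 * \<eta>))" using V by simp
    have h_int: "integrable M (h n)" for n
      using integrable_dominated_convergence2[OF borel_measurable_const[of 0] h_meas V4 h_lim h_bd] .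
    have "(\<lambda>n. LINT x|M. h n x) \<longlonglongrightarrow> (LINT x|M. 0)"
      using integral_dominated_convergence[OF borel_measurable_const[of 0] h_meas V4 h_lim h_bd] .
    then have "(\<lambda>n. LINT x|M. h n x) \<longlonglongrightarrow> 0" by simp
    from LIMSEQ_D[OF this, of "\<epsilon>/2"] \<epsilon> obtain N
      where N: "\<And>n. n \<ge> N \<Longrightarrow> \<bar>LINT x|M. h n x\<bar> < \<epsilon>/2" by auto
    have "norm ((LINT x|M. \<bar>g n x\<bar>) - 0) < \<epsilon>" if "n \<ge> N" for n
    proof -
      have "(LINT x|M. \<bar>g n x\<bar>) \<le> (LINT x|M. \<eta> * q n x + h n x)"
        using int h_int q(1) by (intro integral_mono) (auto simp: h_def)
      also have "\<dots> = \<eta> * (LINT x|M. q n x) + (LINT x|M. h n x)"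
        using h_int q(1) by simp
      also have "\<dots> < \<eta> * K + \<epsilon> / 2"
        using N[OF that] q(3)[of n] K \<eta> mult_left_mono[of "LINT x|M. q n x" K \<eta>] by linarith
      finally show ?thesis using \<eta> by simp
    qed
    then show "\<exists>no. \<forall>n\<ge>no. norm ((LINT x|M. \<bar>g n x\<bar>) - 0) < \<epsilon>" by blast
  qed
qed

section \<open>Weak convergence of bounded sequences\<close>

lemma convergent_if_uniformly_near_convergent:
  fixes X :: "nat \<Rightarrow> real"
  assumes "\<And>\<epsilon>. \<epsilon> > 0 \<Longrightarrow> \<exists>Y. convergent Y \<and> (\<forall>j. \<bar>X j - Y j\<bar> \<le> \<epsilon>)"
  shows "convergent X"
proof (rule Cauchy_convergent, rule metric_CauchyI)
  fix \<epsilon> :: real assume \<epsilon>: "\<epsilon> > 0"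
  then obtain Y where Y: "convergent Y" "\<And>j. \<bar>X j - Y j\<bar> \<le> \<epsilon>/4"
    using assms[of "\<epsilon>/4"] by auto
  obtain N where N: "\<And>m n. m \<ge> N \<Longrightarrow> n \<ge> N \<Longrightarrow> dist (Y m) (Y n) < \<epsilon>/4"
    using metric_CauchyD[OF convergent_Cauchy[OF Y(1)], of "\<epsilon>/4"] \<epsilon> by auto
  have "dist (X m) (X n) < \<epsilon>" if "m \<ge> N" "n \<ge> N" for m n
    using Y(2)[of m] Y(2)[of n] N[OF that] \<epsilon> unfolding dist_real_def by linarith
  then show "\<exists>M. \<forall>m\<ge>M. \<forall>n\<ge>M. dist (X m) (X n) < \<epsilon>" by blast
qed

text \<open>
  A diagonal argument needs countably many sets, and Dynkin's theorem needs them to be closed under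
  intersection; finite intersections of a countable basis are both. \<open>UNIV\<close> is the empty intersection.
\<close>

lemma ex_countable_Int_stable_generator:
  "\<exists>G::'a::second_countable_topology set set.
     countable G \<and> Int_stable G \<and> UNIV \<in> G \<and> sigma_sets UNIV G = sets borel"
proof -
  obtain B :: "'a set set" where B: "countable B" "topological_basis B"
    using ex_countable_basis by blast
  define G where "G = Inter ` {F. finite F \<and> F \<subseteq> B}"
  have G: "countable G" unfolding G_def
    using B(1) by (intro countable_image countable_Collect_finite_subset)
  have "UNIV \<in> G" unfolding G_def by (intro image_eqI[of _ _ "{}"]) auto
  moreover have "Int_stable G"
  proof (rule Int_stableI)
    fix a b assume "a \<in> G" "b \<in> G"
    then obtain F H where "a = \<Inter>F" "b = \<Inter>H" "finite F" "finite H" "F \<subseteq> B" "H \<subseteq> B"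
      by (auto simp: G_def)
    then show "a \<inter> b \<in> G" unfolding G_def by (intro image_eqI[of _ _ "F \<union> H"]) auto
  qed
  moreover have "sigma_sets UNIV G = sets borel"
  proof
    have "open g" if "g \<in> G" for g
      using that B(2) by (auto simp: G_def intro!: open_Inter dest: topological_basis_open)
    then have "G \<subseteq> sets borel" by auto
    then show "sigma_sets UNIV G \<subseteq> sets borel"
      using sets.sigma_sets_subset[of G borel] by simp
    have "B \<subseteq> G" unfolding G_def
    proof
      fix b assume "b \<in> B"
      then show "b \<in> Inter ` {F. finite F \<and> F \<subseteq> B}" by (intro image_eqI[of _ _ "{b}"]) auto
    qed
    then show "sets borel \<subseteq> sigma_sets UNIV G"
      unfolding borel_eq_countable_basis[OF B] using sigma_sets_mono'[of B G UNIV] by simp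
  qed
  ultimately show ?thesis using G by blast
qed

lemma absolutely_integrable_of_square:
  fixes f :: "'a \<Rightarrow> real"
  assumes "finite_measure M" "f \<in> borel_measurable M" "integrable M (\<lambda>x. (f x)\<^sup>2)"
  shows "integrable M f"
proof -
  interpret finite_measure M by fact
  show ?thesis
  proof (rule Bochner_Integration.integrable_bound)
    show "integrable M (\<lambda>x. (f x)\<^sup>2 + 1)" using assms by simp
    have "\<bar>t\<bar> \<le> t\<^sup>2 + 1" for t :: real
      using abs_le_of_square_le_mult[of t "t\<^sup>2" 1 1] by simp
    then show "AE x in M. norm (f x) \<le> norm ((f x)\<^sup>2 + 1)" by (auto simp: abs_of_pos add_nonneg_pos)
  qed fact
qed

lemma integrable_indicat_mult:
  fixes f :: "'a \<Rightarrow> real"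
  assumes "B \<in> sets M" "integrable M f"
  shows "integrable M (\<lambda>x. indicat_real B x * f x)"
  using integrable_real_mult_indicator[OF assms] by (simp only: mult.commute)

text \<open>
  Uniform absolute continuity of the integrals of functions in a bounded subset of \<open>L\<^sup>2\<close>: first choose
  \<open>\<eta>\<close> small, then the measure of \<open>B\<close>.
\<close>

lemma set_integral_abs_le_of_L2_bound:
  fixes f :: "'a \<Rightarrow> real"
  assumes "finite_measure M" "f \<in> borel_measurable M" "integrable M (\<lambda>x. (f x)\<^sup>2)"
    "(LINT x|M. (f x)\<^sup>2) \<le> C" "B \<in> sets M" "\<eta> > 0"
  shows "\<bar>LINT x|M. indicat_real B x * f x\<bar> \<le> \<eta> * C + measure M B / (4 * \<eta>)"
proof -
  interpret finite_measure M by fact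
  have f: "integrable M f" using assms(1-3) by (rule absolutely_integrable_of_square)
  have "\<bar>LINT x|M. indicat_real B x * f x\<bar> \<le> (LINT x|M. \<bar>indicat_real B x * f x\<bar>)"
    using integral_norm_bound[of M "\<lambda>x. indicat_real B x * f x"] by simp
  also have "\<dots> \<le> (LINT x|M. \<eta> * (f x)\<^sup>2 + indicat_real B x / (4 * \<eta>))"
  proof (rule integral_mono)
    show "integrable M (\<lambda>x. \<bar>indicat_real B x * f x\<bar>)"
      using f assms(5) by (intro integrable_abs integrable_indicat_mult)
    show "integrable M (\<lambda>x. \<eta> * (f x)\<^sup>2 + indicat_real B x / (4 * \<eta>))"
      using assms by (auto simp: emeasure_eq_measure)
    show "\<bar>indicat_real B x * f x\<bar> \<le> \<eta> * (f x)\<^sup>2 + indicat_real B x / (4 * \<eta>)" for x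
      using abs_le_of_square_le_mult[of "f x" "(f x)\<^sup>2" 1 \<eta>] assms(6) by (auto split: split_indicator)
  qed
  also have "\<dots> = \<eta> * (LINT x|M. (f x)\<^sup>2) + measure M B / (4 * \<eta>)"
    using assms by (subst Bochner_Integration.integral_add) (auto simp: emeasure_eq_measure)
  finally show ?thesis using assms(4,6) mult_left_mono[of _ C \<eta>] by (smt (verit))
qed

text \<open>
  A diagonal subsequence handles the sets of a countable generator. The sets on which the integrals
  converge form a Dynkin system: complements are clear, and for a countable disjoint union the
  tails are uniformly small by absolute continuity.
\<close>

lemma weakly_convergent_subseq_of_L2_bounded:
  fixes f :: "nat \<Rightarrow> 'a::euclidean_space \<Rightarrow> real"
  assumes D: "D \<in> lmeasurable"
    and meas: "\<And>n. f n \<in> borel_measurable (lebesgue_on D)"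
    and int: "\<And>n. integrable (lebesgue_on D) (\<lambda>x. (f n x)\<^sup>2)"
    and bound: "\<And>n. (LINT x|lebesgue_on D. (f n x)\<^sup>2) \<le> C"
  obtains r where "strict_mono (r::nat\<Rightarrow>nat)"
    "\<And>B. B \<in> sets borel \<Longrightarrow> convergent (\<lambda>n. LINT x|lebesgue_on D. indicat_real B x * f (r n) x)"
proof -
  let ?M = "lebesgue_on D"
  have fm: "finite_measure ?M" using D by (rule finite_measure_lebesgue_on)
  then interpret finite_measure ?M .
  define F where "F n B = (LINT x|?M. indicat_real B x * f n x)" for n B
  have C0: "0 \<le> C" by (rule order_trans[OF _ bound[of 0]]) simp
  have f_int: "integrable ?M (f n)" for n
    using fm meas int by (rule absolutely_integrable_of_square)
  have BD: "B \<inter> D \<in> sets ?M" if "B \<in> sets borel" for B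
    using that by (auto simp: sets_restrict_space)
  have fB_int: "integrable ?M (\<lambda>x. indicat_real B x * f n x)" if "B \<in> sets borel" for n B
  proof -
    have "integrable ?M (\<lambda>x. indicat_real (B \<inter> D) x * f n x)"
      by (rule integrable_indicat_mult[OF BD[OF that] f_int])
    then show ?thesis
      by (rule Bochner_Integration.integrable_cong[THEN iffD1, rotated -1]) (auto split: split_indicator)
  qed
  have F_bound: "\<bar>F n B\<bar> \<le> \<eta> * C + measure ?M (B \<inter> D) / (4 * \<eta>)"
    if "B \<in> sets borel" "\<eta> > 0" for n B \<eta>
  proof -
    have "F n B = (LINT x|?M. indicat_real (B \<inter> D) x * f n x)"
      unfolding F_def by (rule Bochner_Integration.integral_cong) (auto split: split_indicator)
    then show ?thesis
      using set_integral_abs_le_of_L2_bound[OF fm meas int bound BD[OF that(1)] that(2), of n] by simp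
  qed
  obtain G :: "'a set set" where G: "countable G" "Int_stable G" "UNIV \<in> G" "sigma_sets UNIV G = sets borel"
    using ex_countable_Int_stable_generator by blast
  have G_borel: "B \<in> sets borel" if "B \<in> G" for B using that G(4) by (metis sigma_sets.Basic)
  have "norm (F n B) \<le> C + measure ?M D" if "B \<in> G" for n B
  proof -
    have "\<bar>F n B\<bar> \<le> 1 * C + measure ?M (B \<inter> D) / (4 * 1)"
      using F_bound[of B 1 n] G_borel[OF that] by simp
    moreover have "measure ?M (B \<inter> D) \<le> measure ?M D"
      by (rule finite_measure_mono) auto
    moreover have "0 \<le> measure ?M D" by (rule measure_nonneg)
    ultimately show ?thesis unfolding real_norm_def by linarith
  qed
  from function_convergent_subsequence[where f = F, OF G(1) this]
  obtain r where r: "strict_mono r" "\<And>B. B \<in> G \<Longrightarrow> \<exists>l. (\<lambda>n. F (r n) B) \<longlonglongrightarrow> l" by blast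
  have Pow_G: "G \<subseteq> Pow UNIV" by simp
  have "convergent (\<lambda>n. F (r n) B)" if "B \<in> sigma_sets UNIV G" for B
    using G(2) Pow_G that
  proof (induction rule: sigma_sets_induct_disjoint)
    case (basic A) then show ?case using r(2) by (auto simp: convergent_def)
  next
    case empty show ?case by (simp add: F_def convergent_const)
  next
    case (compl A)
    have "F n (UNIV - A) = F n UNIV - F n A" for n
    proof -
      have "F n (UNIV - A) = (LINT x|?M. indicat_real UNIV x * f n x - indicat_real A x * f n x)"
        unfolding F_def by (rule Bochner_Integration.integral_cong) (auto split: split_indicator)
      also have "\<dots> = F n UNIV - F n A"
        unfolding F_def using fB_int[of UNIV n] fB_int[of A n] compl(1) G(4)
        by (intro Bochner_Integration.integral_diff) auto
      finally show ?thesis .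
    qed
    moreover have "convergent (\<lambda>n. F (r n) UNIV)" using r(2) G(3) by (auto simp: convergent_def)
    ultimately show ?case using convergent_diff[OF _ compl(2)] by simp
  next
    case (union A)
    have A: "A i \<in> sets borel" for i using union(2) G(4) by auto
    define T where "T m = (\<Union>i. A i) - (\<Union>i<m. A i)" for m
    have T: "T m \<in> sets borel" for m unfolding T_def using A by auto
    have split: "F n (\<Union>i. A i) = (\<Sum>i<m. F n (A i)) + F n (T m)" for n m
    proof -
      have "indicat_real (\<Union>i. A i) x = (\<Sum>i<m. indicat_real (A i) x) + indicat_real (T m) x" for x
      proof -
        have "(\<Sum>i<m. indicat_real (A i) x) = indicat_real (\<Union>i<m. A i) x"
          using union(1) by (subst indicator_UN_disjoint) (auto simp: disjoint_family_on_def)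
        then show ?thesis by (auto simp: T_def split: split_indicator)
      qed
      then have "F n (\<Union>i. A i) = (LINT x|?M. (\<Sum>i<m. indicat_real (A i) x * f n x) + indicat_real (T m) x * f n x)"
        unfolding F_def by (simp add: distrib_right sum_distrib_right)
      also have "\<dots> = (\<Sum>i<m. F n (A i)) + F n (T m)"
        unfolding F_def
        by (subst Bochner_Integration.integral_add, intro Bochner_Integration.integrable_sum fB_int A,
            rule fB_int[OF T], subst Bochner_Integration.integral_sum, rule fB_int[OF A], rule refl)
      finally show ?thesis .
    qed
    have "(\<lambda>m. measure ?M (T m \<inter> D)) \<longlonglongrightarrow> measure ?M (\<Inter>m. T m \<inter> D)"
    proof (rule finite_Lim_measure_decseq)
      show "range (\<lambda>m. T m \<inter> D) \<subseteq> sets ?M" using BD[OF T] by auto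
      show "decseq (\<lambda>m. T m \<inter> D)" by (auto simp: decseq_def T_def)
    qed
    moreover have "(\<Inter>m. T m \<inter> D) = {}" by (auto simp: T_def)
    ultimately have T_lim: "(\<lambda>m. measure ?M (T m \<inter> D)) \<longlonglongrightarrow> 0" by simp
    show ?case
    proof (rule convergent_if_uniformly_near_convergent)
      fix \<epsilon> :: real assume \<epsilon>: "\<epsilon> > 0"
      define \<eta> where "\<eta> = \<epsilon> / (2 * (C + 1))"
      have \<eta>: "\<eta> > 0" "\<eta> * C \<le> \<epsilon> / 2" using \<epsilon> C0 by (auto simp: \<eta>_def field_simps)
      obtain m where "\<bar>measure ?M (T m \<inter> D)\<bar> < 2 * \<eta> * \<epsilon>"
        using LIMSEQ_D[OF T_lim, of "2 * \<eta> * \<epsilon>"] \<eta> \<epsilon> by auto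
      then have "measure ?M (T m \<inter> D) / (4 * \<eta>) \<le> \<epsilon> / 2" using \<eta> by (simp add: field_simps)
      then have "\<bar>F (r n) (T m)\<bar> \<le> \<epsilon>" for n
        using F_bound[OF T \<eta>(1), of "r n" m] \<eta>(2) by linarith
      then have "\<forall>n. \<bar>F (r n) (\<Union>i. A i) - (\<Sum>i<m. F (r n) (A i))\<bar> \<le> \<epsilon>"
        using split[of _ m] by simp
      moreover have "convergent (\<lambda>n. \<Sum>i<m. F (r n) (A i))"
        using union(3) by (intro convergent_sum) auto
      ultimately show "\<exists>Y. convergent Y \<and> (\<forall>j. \<bar>F (r j) (\<Union>i. A i) - Y j\<bar> \<le> \<epsilon>)" by blast
    qed
  qed
  then show thesis using that[OF r(1)] G(4) by (simp add: F_def)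
qed

text \<open>
  It suffices to look at the set where \<open>h\<close> is negative.
\<close>

lemma AE_nonneg_if_set_integrals_nonneg:
  fixes h :: "'a \<Rightarrow> real"
  assumes h: "integrable M h" and "\<And>B. B \<in> sets M \<Longrightarrow> 0 \<le> (LINT x|M. indicat_real B x * h x)"
  shows "AE x in M. 0 \<le> h x"
proof -
  define B where "B = {x \<in> space M. h x < 0}"
  have B: "B \<in> sets M" unfolding B_def using h by simp
  let ?g = "\<lambda>x. - (indicat_real B x * h x)"
  have i: "integrable M ?g" by (intro integrable_minus integrable_indicat_mult[OF B h])
  have nn: "AE x in M. 0 \<le> ?g x" by (rule AE_I2) (auto simp: B_def split: split_indicator)
  have "integral\<^sup>L M ?g = 0"
    using assms(2)[OF B] integral_nonneg_AE[OF nn] by simp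
  then have "AE x in M. ?g x = 0" using integral_nonneg_eq_0_iff_AE[OF i nn] by simp
  then show ?thesis using AE_space[of M]
    by eventually_elim (auto simp: B_def split: split_indicator_asm if_splits)
qed

text \<open>
  The limits of the integrals over measurable sets form a measure \<open>N\<close> between \<open>a\<close> and \<open>b\<close> times Lebesgue
  measure, and the limit function is its Radon-Nikodym density. Convergence against an integrable
  function follows from convergence on sets by approximation in \<open>L\<^sup>1\<close>, as the sequence is bounded.
\<close>

lemma weak_star_compactness:
  fixes f :: "nat \<Rightarrow> 'a::euclidean_space \<Rightarrow> real"
  assumes D: "D \<in> lmeasurable"
    and meas: "\<And>n. f n \<in> borel_measurable (lebesgue_on D)"
    and range: "\<And>n. AE x in lebesgue_on D. a \<le> f n x \<and> f n x \<le> b" and a: "0 \<le> a"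
  obtains r w where "strict_mono (r::nat\<Rightarrow>nat)" "w \<in> borel_measurable (lebesgue_on D)"
    "AE x in lebesgue_on D. a \<le> w x \<and> w x \<le> b" "weak_star_Linf_tendsto D (\<lambda>n. f (r n)) w"
proof -
  let ?M = "lebesgue_on D"
  have fm: "finite_measure ?M" using D by (rule finite_measure_lebesgue_on)
  then interpret finite_measure ?M .
  have sq_bd: "AE x in ?M. norm ((f n x)\<^sup>2) \<le> b\<^sup>2" for n
    using range[of n] by eventually_elim (use a in \<open>auto intro: power_mono\<close>)
  have sq_int: "integrable ?M (\<lambda>x. (f n x)\<^sup>2)" for n
    using sq_bd[of n] meas[of n] by (intro integrable_const_bound[where B = "b\<^sup>2"]) auto
  have sq_le: "(LINT x|?M. (f n x)\<^sup>2) \<le> b\<^sup>2 * measure ?M D" for n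
  proof -
    have "(LINT x|?M. (f n x)\<^sup>2) \<le> (LINT x|?M. b\<^sup>2)"
      using sq_int sq_bd[of n] by (intro integral_mono_AE) auto
    then show ?thesis by (simp add: mult.commute)
  qed
  obtain r where r: "strict_mono (r::nat\<Rightarrow>nat)"
    "\<And>B. B \<in> sets borel \<Longrightarrow> convergent (\<lambda>n. LINT x|?M. indicat_real B x * f (r n) x)"
    by (rule weakly_convergent_subseq_of_L2_bounded[where f = f, OF D meas sq_int sq_le]) (rule that)
  define F where "F n B = (LINT x|?M. indicat_real B x * f (r n) x)" for n B
  have f_int: "integrable ?M (f n)" for n
    using fm meas sq_int by (rule absolutely_integrable_of_square)
  have fB_int: "integrable ?M (\<lambda>x. indicat_real B x * f n x)" if "B \<in> sets ?M" for n B
    by (rule integrable_indicat_mult[OF that f_int])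
  have F_conv: "convergent (\<lambda>n. F n B)" if B: "B \<in> sets ?M" for B
  proof -
    have "B \<in> sets (completion lborel)" "B \<subseteq> D" using B D by (auto simp: sets_restrict_space)
    then have "AE x in lborel. x \<in> main_part lborel B \<longleftrightarrow> x \<in> B" by (intro AE_in_main_part)
    then have "AE x in lebesgue. x \<in> main_part lborel B \<longleftrightarrow> x \<in> B" by (rule AE_completion)
    then have "AE x in ?M. x \<in> main_part lborel B \<longleftrightarrow> x \<in> B"
      using D by (subst AE_restrict_space_iff) auto
    then have ae: "AE x in ?M. x \<in> B \<longleftrightarrow> x \<in> main_part lborel B \<inter> D" using AE_space[of ?M]
      by eventually_elim auto
    have mp: "main_part lborel B \<in> sets borel"
      using main_part_sets[OF \<open>B \<in> sets (completion lborel)\<close>] by simp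
    then have mpD: "main_part lborel B \<inter> D \<in> sets ?M" by (auto simp: sets_restrict_space)
    have "F n B = F n (main_part lborel B)" for n
    proof -
      have "F n B = (LINT x|?M. indicat_real (main_part lborel B \<inter> D) x * f (r n) x)"
        unfolding F_def
      proof (rule integral_cong_AE)
        show "AE x in ?M. indicat_real B x * f (r n) x = indicat_real (main_part lborel B \<inter> D) x * f (r n) x"
          using ae by eventually_elim (auto split: split_indicator)
      qed (use fB_int B mpD in auto)
      also have "\<dots> = F n (main_part lborel B)"
        unfolding F_def by (rule Bochner_Integration.integral_cong) (auto split: split_indicator)
      finally show ?thesis .
    qed
    then show ?thesis using r(2)[OF mp] by (simp add: F_def)
  qed
  define l where "l B = lim (\<lambda>n. F n B)" for B
  have F_lim: "(\<lambda>n. F n B) \<longlonglongrightarrow> l B" if "B \<in> sets ?M" for B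
    using F_conv[OF that] by (simp add: l_def convergent_LIMSEQ_iff)
  have int_const: "(LINT x|?M. indicat_real B x * c) = c * measure ?M B" if "B \<in> sets ?M" for B c
  proof -
    have "B \<inter> D = B" using sets.sets_into_space[OF that] by auto
    then show ?thesis using that by simp
  qed
  have F_ge: "a * measure ?M B \<le> F n B" and F_le: "F n B \<le> b * measure ?M B" if B: "B \<in> sets ?M" for n B
  proof -
    note c = int_const[OF B]
    have "(LINT x|?M. indicat_real B x * a) \<le> F n B" unfolding F_def
      using B fB_int[OF B] range[of "r n"]
      by (intro integral_mono_AE) (auto simp: emeasure_eq_measure elim!: eventually_mono split: split_indicator)
    then show "a * measure ?M B \<le> F n B" by (simp only: c)
    have "AE x in ?M. indicat_real B x * f (r n) x \<le> indicat_real B x * b"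
      using range[of "r n"] by eventually_elim (auto split: split_indicator)
    then have "F n B \<le> (LINT x|?M. indicat_real B x * b)" unfolding F_def
      using B fB_int[OF B] by (intro integral_mono_AE) (auto simp: emeasure_eq_measure)
    then show "F n B \<le> b * measure ?M B" by (simp only: c)
  qed
  have l_ge: "a * measure ?M B \<le> l B" if "B \<in> sets ?M" for B
    using F_lim[OF that] F_ge[OF that] by (intro LIMSEQ_le_const) auto
  have l_le: "l B \<le> b * measure ?M B" if "B \<in> sets ?M" for B
    using F_lim[OF that] F_le[OF that] by (intro LIMSEQ_le_const2) auto
  have l_nonneg: "0 \<le> l B" if "B \<in> sets ?M" for B
    using l_ge[OF that] a by (meson measure_nonneg mult_nonneg_nonneg order_trans)
  have l_empty: "l {} = 0" by (simp add: l_def F_def)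
  have l_add: "l (A \<union> B) = l A + l B" if AB: "A \<in> sets ?M" "B \<in> sets ?M" "A \<inter> B = {}" for A B
  proof -
    have "F n (A \<union> B) = F n A + F n B" for n
    proof -
      have "F n (A \<union> B) = (LINT x|?M. indicat_real A x * f (r n) x + indicat_real B x * f (r n) x)"
        unfolding F_def using AB(3)
        by (intro Bochner_Integration.integral_cong) (auto split: split_indicator)
      then show ?thesis
        unfolding F_def using fB_int[OF AB(1)] fB_int[OF AB(2)] by simp
    qed
    then have "(\<lambda>n. F n (A \<union> B)) \<longlonglongrightarrow> l A + l B"
      using F_lim AB by (auto intro: tendsto_add)
    then show ?thesis using F_lim[of "A \<union> B"] AB by (intro LIMSEQ_unique) auto
  qed
  define N where "N = measure_of D (sets ?M) (\<lambda>B. ennreal (l B))"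
  have sets_N: "sets N = sets ?M" "space N = D"
    unfolding N_def using sets.space_closed[of ?M] sets.sigma_sets_eq[of ?M]
    by (auto simp: sets_measure_of space_measure_of)
  have em_N: "emeasure N B = ennreal (l B)" if "B \<in> sets ?M" for B
    unfolding N_def
  proof (rule emeasure_measure_of_sigma)
    show "sigma_algebra D (sets ?M)" using sets.sigma_algebra_axioms[of ?M] by simp
    show pos: "positive (sets ?M) (\<lambda>B. ennreal (l B))" by (simp add: positive_def l_empty)
    show "countably_additive (sets ?M) (\<lambda>B. ennreal (l B))"
    proof (rule sets.empty_continuous_imp_countably_additive[OF pos])
      show "additive (sets ?M) (\<lambda>B. ennreal (l B))"
        by (auto simp: additive_def l_add l_nonneg ennreal_plus)
      show "\<forall>A\<in>sets ?M. ennreal (l A) \<noteq> \<infinity>" by simp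
      fix A :: "nat \<Rightarrow> 'a set" assume A: "range A \<subseteq> sets ?M" "decseq A" "(\<Inter>i. A i) = {}"
      have "(\<lambda>i. b * measure ?M (A i)) \<longlonglongrightarrow> b * measure ?M (\<Inter>i. A i)"
        using A by (intro tendsto_mult_left finite_Lim_measure_decseq)
      then have "(\<lambda>i. b * measure ?M (A i)) \<longlonglongrightarrow> 0" using A(3) by simp
      then have "(\<lambda>i. l (A i)) \<longlonglongrightarrow> 0"
        by (rule tendsto_sandwich[OF always_eventually always_eventually tendsto_const, rotated 2])
          (use A l_nonneg l_le in auto)
      then show "(\<lambda>i. ennreal (l (A i))) \<longlonglongrightarrow> 0"
        using tendsto_ennrealI by fastforce
    qed
  qed fact
  have "absolutely_continuous ?M N"
    unfolding absolutely_continuous_def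
  proof
    fix B assume B: "B \<in> null_sets ?M"
    then have "measure ?M B = 0" by (simp add: measure_def null_setsD1)
    then have "l B = 0" using l_le[of B] l_nonneg[of B] B by auto
    then show "B \<in> null_sets N" using B em_N[of B] by (auto simp: null_sets_def sets_N)
  qed
  moreover have "finite_measure N"
    by (rule finite_measureI) (simp add: sets_N em_N)
  ultimately obtain w where w: "w \<in> borel_measurable ?M" "AE x in ?M. RN_deriv ?M N x = ennreal (w x)" "\<And>x. 0 \<le> w x"
    using real_RN_deriv sets_N(1) by metis
  have w_nn: "(\<integral>\<^sup>+x. ennreal (indicat_real B x * w x) \<partial>?M) = ennreal (l B)" if B: "B \<in> sets ?M" for B
  proof -
    have "ennreal (l B) = emeasure (density ?M (RN_deriv ?M N)) B"
      using density_RN_deriv[OF \<open>absolutely_continuous ?M N\<close> sets_N(1)] em_N[OF B] by simp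
    also have "\<dots> = (\<integral>\<^sup>+x. RN_deriv ?M N x * indicator B x \<partial>?M)"
      using B by (intro emeasure_density) auto
    also have "\<dots> = (\<integral>\<^sup>+x. ennreal (indicat_real B x * w x) \<partial>?M)"
      by (rule nn_integral_cong_AE, use w(2) in eventually_elim) (auto split: split_indicator)
    finally show ?thesis by simp
  qed
  have wB: "(LINT x|?M. indicat_real B x * w x) = l B" if B: "B \<in> sets ?M" for B
    using w_nn[OF B] w B l_nonneg[OF B] by (subst integral_eq_nn_integral) auto
  have w_int: "integrable ?M w"
  proof (rule integrableI_nonneg)
    have "(\<integral>\<^sup>+x. ennreal (w x) \<partial>?M) = (\<integral>\<^sup>+x. ennreal (indicat_real D x * w x) \<partial>?M)"
      by (rule nn_integral_cong) auto
    then show "(\<integral>\<^sup>+x. ennreal (w x) \<partial>?M) < \<infinity>" using w_nn[of D] by simp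
  qed (use w in auto)
  have wB_int: "integrable ?M (\<lambda>x. indicat_real B x * w x)" if "B \<in> sets ?M" for B
    by (rule integrable_indicat_mult[OF that w_int])
  have w_ge: "AE x in ?M. 0 \<le> w x - a"
  proof (rule AE_nonneg_if_set_integrals_nonneg)
    fix B assume B: "B \<in> sets ?M"
    have "(LINT x|?M. indicat_real B x * (w x - a)) = (LINT x|?M. indicat_real B x * w x) - (LINT x|?M. indicat_real B x * a)"
      unfolding right_diff_distrib using B wB_int[OF B]
      by (intro Bochner_Integration.integral_diff) (auto simp: emeasure_eq_measure)
    also have "\<dots> = l B - a * measure ?M B" by (simp only: wB[OF B] int_const[OF B])
    finally show "0 \<le> (LINT x|?M. indicat_real B x * (w x - a))" using l_ge[OF B] by simp
  qed (use w_int in simp)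
  have w_le: "AE x in ?M. 0 \<le> b - w x"
  proof (rule AE_nonneg_if_set_integrals_nonneg)
    fix B assume B: "B \<in> sets ?M"
    have "(LINT x|?M. indicat_real B x * (b - w x)) = (LINT x|?M. indicat_real B x * b) - (LINT x|?M. indicat_real B x * w x)"
      unfolding right_diff_distrib using B wB_int[OF B]
      by (intro Bochner_Integration.integral_diff) (auto simp: emeasure_eq_measure)
    also have "\<dots> = b * measure ?M B - l B" by (simp only: wB[OF B] int_const[OF B])
    finally show "0 \<le> (LINT x|?M. indicat_real B x * (b - w x))" using l_le[OF B] by simp
  qed (use w_int in simp)
  have w_range: "AE x in ?M. a \<le> w x \<and> w x \<le> b" using w_ge w_le by eventually_elim simp
  have bounded_mult: "integrable ?M (\<lambda>x. h x * g x)" "\<bar>LINT x|?M. h x * g x\<bar> \<le> b * (LINT x|?M. \<bar>g x\<bar>)"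
    if h: "h \<in> borel_measurable ?M" "AE x in ?M. a \<le> h x \<and> h x \<le> b" and g: "integrable ?M g" for h g
  proof -
    have ae: "AE x in ?M. norm (h x * g x) \<le> b * \<bar>g x\<bar>"
      using h(2) by eventually_elim (use a in \<open>auto simp: abs_mult intro!: mult_right_mono\<close>)
    have bg: "integrable ?M (\<lambda>x. b * \<bar>g x\<bar>)" using g by simp
    show hg: "integrable ?M (\<lambda>x. h x * g x)"
      by (rule Bochner_Integration.integrable_bound[OF bg])
        (use h g ae in \<open>auto elim!: eventually_mono\<close>)
    have "\<bar>LINT x|?M. h x * g x\<bar> \<le> (LINT x|?M. norm (h x * g x))"
      using integral_norm_bound[of ?M "\<lambda>x. h x * g x"] by simp
    also have "\<dots> \<le> (LINT x|?M. b * \<bar>g x\<bar>)"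
      using hg bg ae by (intro integral_mono_AE integrable_norm)
    finally have "\<bar>LINT x|?M. h x * g x\<bar> \<le> (LINT x|?M. b * \<bar>g x\<bar>)" .
    then show "\<bar>LINT x|?M. h x * g x\<bar> \<le> b * (LINT x|?M. \<bar>g x\<bar>)" by simp
  qed
  have "(\<lambda>n. LINT x|?M. f (r n) x * g x) \<longlonglongrightarrow> (LINT x|?M. w x * g x)" if "integrable ?M g" for g
    using that
  proof (induction rule: integrable_induct)
    case (base B c)
    have "(\<lambda>n. F n B * c) \<longlonglongrightarrow> l B * c" using F_lim[OF base(1)] by (rule tendsto_mult_right)
    then show ?case unfolding F_def wB[OF base(1), symmetric]
      using fB_int[OF base(1)] wB_int[OF base(1)]
      by (simp add: mult.commute mult.left_commute)
  next
    case (add g h)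
    then have "(\<lambda>n. (LINT x|?M. f (r n) x * g x) + (LINT x|?M. f (r n) x * h x)) \<longlonglongrightarrow>
      (LINT x|?M. w x * g x) + (LINT x|?M. w x * h x)" by (intro tendsto_add)
    then show ?case using bounded_mult(1)[OF meas range] bounded_mult(1)[OF w(1) w_range] add
      by (simp add: distrib_left)
  next
    case (lim g s)
    have s_lim: "(\<lambda>i. LINT x|?M. \<bar>s i x - g x\<bar>) \<longlonglongrightarrow> (LINT x|?M. 0)"
    proof (rule integral_dominated_convergence)
      show "integrable ?M (\<lambda>x. 3 * \<bar>g x\<bar>)" using lim by simp
      show "AE x in ?M. (\<lambda>i. \<bar>s i x - g x\<bar>) \<longlonglongrightarrow> 0"
        using lim.hyps(2) by (intro AE_I2) (auto intro!: tendsto_rabs_zero simp: LIM_zero_iff)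
      show "AE x in ?M. norm \<bar>s i x - g x\<bar> \<le> 3 * \<bar>g x\<bar>" for i
        using lim.hyps(3)[of _ i] by (intro AE_I2) fastforce
    qed (use lim in auto)
    have diff: "\<bar>(LINT x|?M. h x * g x) - (LINT x|?M. h x * s i x)\<bar> \<le> b * (LINT x|?M. \<bar>s i x - g x\<bar>)"
      if h: "h \<in> borel_measurable ?M" "AE x in ?M. a \<le> h x \<and> h x \<le> b" for h i
      using bounded_mult(1)[OF h lim.hyps(4)] bounded_mult(1)[OF h lim.hyps(1)[of i]]
        bounded_mult(2)[OF h, of "\<lambda>x. s i x - g x"] lim.hyps(1)[of i] lim.hyps(4)
      by (simp add: right_diff_distrib abs_minus_commute)
    show ?case
    proof (rule LIMSEQ_I)
      fix \<epsilon> :: real assume \<epsilon>: "\<epsilon> > 0"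
      have "(\<lambda>i. b * (LINT x|?M. \<bar>s i x - g x\<bar>)) \<longlonglongrightarrow> b * 0"
        using s_lim by (intro tendsto_mult_left) simp
      from LIMSEQ_D[OF this, of "\<epsilon>/3"] \<epsilon> obtain i where "\<bar>b * (LINT x|?M. \<bar>s i x - g x\<bar>)\<bar> < \<epsilon>/3"
        by auto
      then have i: "b * (LINT x|?M. \<bar>s i x - g x\<bar>) < \<epsilon>/3" by linarith
      from LIMSEQ_D[OF lim.IH[of i], of "\<epsilon>/3"] \<epsilon> obtain n0 where
        n0: "\<And>n. n \<ge> n0 \<Longrightarrow> \<bar>(LINT x|?M. f (r n) x * s i x) - (LINT x|?M. w x * s i x)\<bar> < \<epsilon>/3" by auto
      have "norm ((LINT x|?M. f (r n) x * g x) - (LINT x|?M. w x * g x)) < \<epsilon>" if "n \<ge> n0" for n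
        using n0[OF that] diff[OF meas range, of "r n" i] diff[OF w(1) w_range, of i] i
        unfolding real_norm_def by linarith
      then show "\<exists>no. \<forall>n\<ge>no. norm ((LINT x|?M. f (r n) x * g x) - (LINT x|?M. w x * g x)) < \<epsilon>" by blast
    qed
  qed
  then have "weak_star_Linf_tendsto D (\<lambda>n. f (r n)) w" by (simp add: weak_star_Linf_tendsto_def)
  then show thesis using that r(1) w(1) w_range by blast
qed

section \<open>Borel representatives and products\<close>

lemma Times_in_sets_borel:
  fixes D :: "'a::second_countable_topology set" and E :: "'b::second_countable_topology set"
  shows "D \<in> sets borel \<Longrightarrow> E \<in> sets borel \<Longrightarrow> D \<times> E \<in> sets borel"
  unfolding borel_prod[symmetric] by (rule pair_measureI)

text \<open>
  Lebesgue measure on a product is only the completion of the product measure, so Fubini's theorem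
  is applied to Borel measurable representatives. They are taken to vanish outside the domain so that
  integrals over the whole space can be used.
\<close>

lemma ex_borel_representative:
  fixes g :: "'a::euclidean_space \<Rightarrow> real"
  assumes S: "S \<in> sets borel" and g: "g \<in> borel_measurable (lebesgue_on S)"
  obtains h where "h \<in> borel_measurable borel" "AE x in lebesgue_on S. g x = h x" "\<And>x. x \<notin> S \<Longrightarrow> h x = 0"
proof -
  have Sl: "S \<in> sets lebesgue" using S by simp
  have "(\<lambda>x. if x \<in> S then g x else 0) \<in> borel_measurable lebesgue"
    using g Sl by (simp add: borel_measurable_if)
  then obtain h where h: "h \<in> borel_measurable lborel" "AE x in lborel. (if x \<in> S then g x else 0) = h x"
    using completion_ex_borel_measurable_real by blast
  have "AE x in lebesgue. (if x \<in> S then g x else 0) = h x" using h(2) by (rule AE_completion)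
  then have "AE x in lebesgue_on S. g x = indicat_real S x * h x"
    using Sl by (subst AE_restrict_space_iff) (auto elim!: eventually_mono)
  moreover have "(\<lambda>x. indicat_real S x * h x) \<in> borel_measurable borel"
    using h(1) S by simp
  ultimately show thesis using that by (metis indicator_simps(2) mult_zero_left)
qed

lemma borel_measurable_lebesgue_on_if_borel:
  "h \<in> borel_measurable borel \<Longrightarrow> h \<in> borel_measurable (lebesgue_on S)"
  by (intro measurable_restrict_space1 measurable_completion) simp

lemma
  fixes g h :: "'a::euclidean_space \<Rightarrow> real"
  assumes S: "S \<in> sets borel" and g: "g \<in> borel_measurable (lebesgue_on S)"
    and h: "h \<in> borel_measurable borel" and eq: "AE x in lebesgue_on S. g x = h x"
    and zero: "\<And>x. x \<notin> S \<Longrightarrow> h x = 0"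
  shows integral_eq_borel_representative: "integral\<^sup>L (lebesgue_on S) g = integral\<^sup>L lborel h"
    and integrable_iff_borel_representative: "integrable (lebesgue_on S) g \<longleftrightarrow> integrable lborel h"
proof -
  have Sl: "S \<inter> space lebesgue \<in> sets lebesgue" using S by simp
  have h': "h \<in> borel_measurable (lebesgue_on S)" using h by (rule borel_measurable_lebesgue_on_if_borel)
  have ind: "(\<lambda>x. indicat_real S x *\<^sub>R h x) = h" using zero by (auto split: split_indicator)
  have "integral\<^sup>L (lebesgue_on S) g = integral\<^sup>L (lebesgue_on S) h"
    using g h' eq by (rule integral_cong_AE)
  also have "\<dots> = integral\<^sup>L lborel h"
    unfolding integral_restrict_space[OF Sl] ind using h by (simp add: integral_completion)
  finally show "integral\<^sup>L (lebesgue_on S) g = integral\<^sup>L lborel h" .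
  have "integrable (lebesgue_on S) g \<longleftrightarrow> integrable (lebesgue_on S) h"
    using g h' eq by (rule integrable_cong_AE)
  also have "\<dots> \<longleftrightarrow> integrable lborel h"
    unfolding integrable_restrict_space[OF Sl] ind using h by (simp add: integrable_completion)
  finally show "integrable (lebesgue_on S) g \<longleftrightarrow> integrable lborel h" .
qed

lemma
  fixes D :: "'a::euclidean_space set" and E :: "'b::euclidean_space set"
  assumes D: "D \<in> sets borel" and E: "E \<in> sets borel"
  shows AE_lebesgue_on_Times_fst: "(AE x in lebesgue_on D. P x) \<Longrightarrow> (AE z in lebesgue_on (D \<times> E). P (fst z))"
    and AE_lebesgue_on_Times_snd: "(AE y in lebesgue_on E. Q y) \<Longrightarrow> (AE z in lebesgue_on (D \<times> E). Q (snd z))"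
proof -
  have DE: "D \<times> E \<in> sets lebesgue"
    using Times_in_sets_borel[OF D E] by simp
  show "AE z in lebesgue_on (D \<times> E). P (fst z)" if "AE x in lebesgue_on D. P x"
  proof -
    have "AE x in lebesgue. x \<in> D \<longrightarrow> P x" using that D by (subst (asm) AE_restrict_space_iff) auto
    then have "AE x in lborel. x \<in> D \<longrightarrow> P x" by (simp add: AE_completion_iff)
    then obtain N where N: "N \<in> null_sets lborel" and N': "{x \<in> space lborel. \<not> (x \<in> D \<longrightarrow> P x)} \<subseteq> N"
      unfolding eventually_ae_filter by blast
    have "N \<times> (UNIV::'b set) \<in> null_sets (lborel \<Otimes>\<^sub>M lborel)"
      using N by (intro lborel.times_in_null_sets1) auto
    then have "AE z in (lborel :: ('a \<times> 'b) measure). fst z \<in> D \<longrightarrow> P (fst z)"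
      unfolding lborel_prod using N' by (intro AE_I'[of "N \<times> UNIV"]) auto
    then have "AE z in (lebesgue :: ('a \<times> 'b) measure). fst z \<in> D \<longrightarrow> P (fst z)" by (rule AE_completion)
    then show ?thesis using DE by (subst AE_restrict_space_iff) (auto elim!: eventually_mono)
  qed
  show "AE z in lebesgue_on (D \<times> E). Q (snd z)" if "AE y in lebesgue_on E. Q y"
  proof -
    have "AE x in lebesgue. x \<in> E \<longrightarrow> Q x" using that E by (subst (asm) AE_restrict_space_iff) auto
    then have "AE x in lborel. x \<in> E \<longrightarrow> Q x" by (simp add: AE_completion_iff)
    then obtain N where N: "N \<in> null_sets lborel" and N': "{x \<in> space lborel. \<not> (x \<in> E \<longrightarrow> Q x)} \<subseteq> N"
      unfolding eventually_ae_filter by blast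
    have "(UNIV::'a set) \<times> N \<in> null_sets (lborel \<Otimes>\<^sub>M lborel)"
      using N by (intro lborel.times_in_null_sets2) auto
    then have "AE z in (lborel :: ('a \<times> 'b) measure). snd z \<in> E \<longrightarrow> Q (snd z)"
      unfolding lborel_prod using N' by (intro AE_I'[of "UNIV \<times> N"]) auto
    then have "AE z in (lebesgue :: ('a \<times> 'b) measure). snd z \<in> E \<longrightarrow> Q (snd z)" by (rule AE_completion)
    then show ?thesis using DE by (subst AE_restrict_space_iff) (auto elim!: eventually_mono)
  qed
qed

lemma borel_measurable_lebesgue_on_AE:
  fixes f g :: "'a::euclidean_space \<Rightarrow> real"
  assumes S: "S \<in> sets lebesgue" and g: "g \<in> borel_measurable (lebesgue_on S)"
    and eq: "AE x in lebesgue_on S. g x = f x"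
  shows "f \<in> borel_measurable (lebesgue_on S)"
proof -
  have "AE x in lebesgue. (if x \<in> S then g x else 0) = (if x \<in> S then f x else 0)"
    using eq S by (subst (asm) AE_restrict_space_iff) (auto elim!: eventually_mono)
  moreover have "(\<lambda>x. if x \<in> S then g x else 0) \<in> borel_measurable lebesgue"
    using g S by (simp only: borel_measurable_if)
  ultimately have "(\<lambda>x. if x \<in> S then f x else 0) \<in> borel_measurable lebesgue"
    by (rule borel_measurable_AE[rotated])
  then show ?thesis using S by (simp only: borel_measurable_if)
qed

lemma
  fixes D :: "'a::euclidean_space set" and u v :: "'a \<Rightarrow> real"
  assumes D: "D \<in> sets borel" and u: "u \<in> borel_measurable (lebesgue_on D)"
  shows borel_measurable_lebesgue_on_Times_fst: "(\<lambda>z. u (fst z)) \<in> borel_measurable (lebesgue_on (D \<times> D))"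
    and borel_measurable_lebesgue_on_Times_snd: "(\<lambda>z. u (snd z)) \<in> borel_measurable (lebesgue_on (D \<times> D))"
proof -
  obtain h where h: "h \<in> borel_measurable borel" "AE x in lebesgue_on D. u x = h x"
    using ex_borel_representative[OF D u] by metis
  have DD: "D \<times> D \<in> sets lebesgue"
    using Times_in_sets_borel[OF D D] by simp
  have "fst \<in> borel_measurable (borel :: ('a \<times> 'a) measure)" "snd \<in> borel_measurable (borel :: ('a \<times> 'a) measure)"
    by (auto simp: borel_prod[symmetric])
  then have "(\<lambda>z. h (fst z)) \<in> borel_measurable (borel :: ('a \<times> 'a) measure)"
    "(\<lambda>z. h (snd z)) \<in> borel_measurable (borel :: ('a \<times> 'a) measure)"
    using h(1) by (auto intro: measurable_compose)
  note h_prod = this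
  show "(\<lambda>z. u (fst z)) \<in> borel_measurable (lebesgue_on (D \<times> D))"
    using AE_lebesgue_on_Times_fst[OF D D h(2)]
    by (intro borel_measurable_lebesgue_on_AE[OF DD borel_measurable_lebesgue_on_if_borel[OF h_prod(1)]]) (auto elim!: eventually_mono)
  show "(\<lambda>z. u (snd z)) \<in> borel_measurable (lebesgue_on (D \<times> D))"
    using AE_lebesgue_on_Times_snd[OF D D h(2)]
    by (intro borel_measurable_lebesgue_on_AE[OF DD borel_measurable_lebesgue_on_if_borel[OF h_prod(2)]]) (auto elim!: eventually_mono)
qed

text \<open>
  With \<open>\<Phi> q x = \<integral> q(y) F(x, y) dy\<close>, the integral of \<open>q(x) q(y) F(x, y)\<close> is that of \<open>q \<Phi> q\<close>. Weak-star
  convergence makes \<open>\<Phi> (R j)\<close> converge pointwise, hence in \<open>L\<^sup>1\<close> by dominated convergence, and the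
  product of a weak-star and an \<open>L\<^sup>1\<close> convergent sequence has a convergent integral.
\<close>

lemma weak_star_tendsto_tensor_square:
  fixes D :: "'a::euclidean_space set" and F :: "'a \<times> 'a \<Rightarrow> real"
  assumes D: "D \<in> sets borel"
    and R: "\<And>j. R j \<in> borel_measurable (lebesgue_on D)" "\<And>j. AE x in lebesgue_on D. \<bar>R j x\<bar> \<le> b"
    and \<rho>: "\<rho> \<in> borel_measurable (lebesgue_on D)" "AE x in lebesgue_on D. \<bar>\<rho> x\<bar> \<le> b"
    and lim: "weak_star_Linf_tendsto D R \<rho>" and b: "0 \<le> b"
    and F: "integrable (lebesgue_on (D \<times> D)) F"
  shows "(\<lambda>j. LINT z|lebesgue_on (D \<times> D). R j (fst z) * R j (snd z) * F z) \<longlonglongrightarrow>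
    (LINT z|lebesgue_on (D \<times> D). \<rho> (fst z) * \<rho> (snd z) * F z)"
proof -
  have DD: "D \<times> D \<in> sets borel"
    using Times_in_sets_borel[OF D D] by simp
  have rep: "\<exists>h. h \<in> borel_measurable borel \<and> (AE x in lebesgue_on D. g x = h x) \<and>
      (\<forall>x. x \<notin> D \<longrightarrow> h x = 0) \<and> (\<forall>x. \<bar>h x\<bar> \<le> b)"
    if g: "g \<in> borel_measurable (lebesgue_on D)" "AE x in lebesgue_on D. \<bar>g x\<bar> \<le> b" for g
  proof -
    obtain h where h: "h \<in> borel_measurable borel" "AE x in lebesgue_on D. g x = h x" "\<And>x. x \<notin> D \<Longrightarrow> h x = 0"
      using ex_borel_representative[OF D g(1)] by metis
    have "AE x in lebesgue_on D. g x = max (- b) (min b (h x))"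
      using h(2) g(2) by eventually_elim auto
    \<comment> \<open>truncation makes the bound hold everywhere\<close>
    then show ?thesis using h b
      by (intro exI[of _ "\<lambda>x. max (- b) (min b (h x))"]) auto
  qed
  obtain R' where R': "\<And>j. R' j \<in> borel_measurable borel" "\<And>j. AE x in lebesgue_on D. R j x = R' j x"
    "\<And>j x. x \<notin> D \<Longrightarrow> R' j x = 0" "\<And>j x. \<bar>R' j x\<bar> \<le> b"
    using rep[OF R(1) R(2)] by metis
  obtain r where r: "r \<in> borel_measurable borel" "AE x in lebesgue_on D. \<rho> x = r x"
    "\<And>x. x \<notin> D \<Longrightarrow> r x = 0" "\<And>x. \<bar>r x\<bar> \<le> b"
    using rep[OF \<rho>] by metis
  have Fm: "F \<in> borel_measurable (lebesgue_on (D \<times> D))" using F by auto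
  obtain F' where F': "F' \<in> borel_measurable borel" "AE z in lebesgue_on (D \<times> D). F z = F' z"
    "\<And>z. z \<notin> D \<times> D \<Longrightarrow> F' z = 0"
    using ex_borel_representative[OF DD Fm] by metis
  have F'_int: "integrable (lborel \<Otimes>\<^sub>M lborel) F'"
    using F integrable_iff_borel_representative[OF DD Fm F'] by (simp add: lborel_prod)
  have F'_sec: "(\<lambda>y. F' (x, y)) \<in> borel_measurable borel" for x
    using F'(1) by (auto simp: borel_prod[symmetric] intro: measurable_compose)
  define \<Phi> where "\<Phi> q x = (LINT y|lborel. q y * F' (x, y))" for q x
  have mult_int: "integrable M (\<lambda>y. q y * g y)"
    if "q \<in> borel_measurable M" "\<And>y. \<bar>q y\<bar> \<le> b" "integrable M g" for q g and M :: "'c measure"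
  proof (rule Bochner_Integration.integrable_bound[of M "\<lambda>y. b * \<bar>g y\<bar>"])
    show "AE y in M. norm (q y * g y) \<le> norm (b * \<bar>g y\<bar>)"
      using that(2) b by (auto simp: abs_mult intro!: mult_right_mono)
  qed (use that in auto)
  have tensor: "(\<lambda>z. q (fst z) * (q (snd z) * F' z)) \<in> borel_measurable (lborel \<Otimes>\<^sub>M lborel)"
    "integrable (lborel \<Otimes>\<^sub>M lborel) (\<lambda>z. q (snd z) * F' z)"
    "integrable (lborel \<Otimes>\<^sub>M lborel) (\<lambda>z. q (fst z) * (q (snd z) * F' z))"
    if q: "q \<in> borel_measurable borel" "\<And>y. \<bar>q y\<bar> \<le> b" for q
  proof -
    have m: "(\<lambda>z. q (fst z)) \<in> borel_measurable (lborel \<Otimes>\<^sub>M lborel)"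
      "(\<lambda>z. q (snd z)) \<in> borel_measurable (lborel \<Otimes>\<^sub>M lborel)"
      using q(1) by (auto intro: measurable_compose)
    show i: "integrable (lborel \<Otimes>\<^sub>M lborel) (\<lambda>z. q (snd z) * F' z)"
      using m(2) q(2) F'_int by (rule mult_int)
    show i2: "integrable (lborel \<Otimes>\<^sub>M lborel) (\<lambda>z. q (fst z) * (q (snd z) * F' z))"
      using m(1) q(2) i by (rule mult_int)
    then show "(\<lambda>z. q (fst z) * (q (snd z) * F' z)) \<in> borel_measurable (lborel \<Otimes>\<^sub>M lborel)" by auto
  qed
  have \<Phi>_int: "integrable lborel (\<Phi> q)" if q: "q \<in> borel_measurable borel" "\<And>y. \<bar>q y\<bar> \<le> b" for q
    using lborel_pair.integrable_fst'[OF tensor(2)[OF q]] by (simp add: \<Phi>_def[abs_def])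
  have iterated: "(LINT z|lebesgue_on (D \<times> D). g (fst z) * g (snd z) * F z) = (LINT x|lborel. q x * \<Phi> q x)"
    if g: "g \<in> borel_measurable (lebesgue_on D)" and q: "q \<in> borel_measurable borel" "\<And>y. \<bar>q y\<bar> \<le> b"
      and eq: "AE x in lebesgue_on D. g x = q x" for g q
  proof -
    have "(LINT z|lebesgue_on (D \<times> D). g (fst z) * g (snd z) * F z) = (LINT z|lborel. q (fst z) * (q (snd z) * F' z))"
    proof (rule integral_eq_borel_representative[OF DD])
      show "(\<lambda>z. g (fst z) * g (snd z) * F z) \<in> borel_measurable (lebesgue_on (D \<times> D))"
        using borel_measurable_lebesgue_on_Times_fst[OF D g] borel_measurable_lebesgue_on_Times_snd[OF D g] Fm
        by (intro borel_measurable_times)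
      show "(\<lambda>z. q (fst z) * (q (snd z) * F' z)) \<in> borel_measurable borel"
        using tensor(1)[OF q] by (simp add: lborel_prod)
      show "AE z in lebesgue_on (D \<times> D). g (fst z) * g (snd z) * F z = q (fst z) * (q (snd z) * F' z)"
        using AE_lebesgue_on_Times_fst[OF D D eq] AE_lebesgue_on_Times_snd[OF D D eq] F'(2)
        by eventually_elim simp
      show "q (fst z) * (q (snd z) * F' z) = 0" if "z \<notin> D \<times> D" for z using F'(3)[OF that] by simp
    qed
    also have "\<dots> = (LINT x|lborel. LINT y|lborel. q x * (q y * F' (x, y)))"
      using lborel_pair.integral_fst'[OF tensor(3)[OF q]] by (simp add: lborel_prod)
    also have "\<dots> = (LINT x|lborel. q x * \<Phi> q x)" by (simp add: \<Phi>_def)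
    finally show ?thesis .
  qed
  have weak: "(\<lambda>j. LINT y|lborel. R' j y * g y) \<longlonglongrightarrow> (LINT y|lborel. r y * g y)"
    if g: "integrable lborel g" for g
  proof -
    have gm: "g \<in> borel_measurable (lebesgue_on D)"
      using g by (intro borel_measurable_lebesgue_on_if_borel) auto
    have "integrable (lebesgue_on D) g"
      using g D integrable_restrict_space[of D lebesgue g]
        integrable_completion[of "\<lambda>x. indicat_real D x *\<^sub>R g x" lborel]
        integrable_indicat_mult[of D lborel g] by simp
    then have lim': "(\<lambda>j. LINT x|lebesgue_on D. R j x * g x) \<longlonglongrightarrow> (LINT x|lebesgue_on D. \<rho> x * g x)"
      using lim by (simp add: weak_star_Linf_tendsto_def)
    have eq: "(LINT x|lebesgue_on D. h x * g x) = (LINT y|lborel. q y * g y)"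
      if h: "h \<in> borel_measurable (lebesgue_on D)" and q: "q \<in> borel_measurable borel"
        "AE x in lebesgue_on D. h x = q x" "\<And>x. x \<notin> D \<Longrightarrow> q x = 0" for h q
    proof (rule integral_eq_borel_representative[OF D])
      show "(\<lambda>x. h x * g x) \<in> borel_measurable (lebesgue_on D)" using h gm by simp
      show "(\<lambda>x. q x * g x) \<in> borel_measurable borel" using q g by simp
      show "AE x in lebesgue_on D. h x * g x = q x * g x" using q(2) by eventually_elim simp
    qed (use q in auto)
    have "(LINT x|lebesgue_on D. R j x * g x) = (LINT y|lborel. R' j y * g y)" for j
      using R(1) R'(1) R'(2) by (rule eq) (rule R'(3))
    moreover have "(LINT x|lebesgue_on D. \<rho> x * g x) = (LINT y|lborel. r y * g y)"
      using \<rho>(1) r(1) r(2) by (rule eq) (rule r(3))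
    ultimately show ?thesis using lim' by (simp only:)
  qed
  have AE_sec: "AE x in lborel. integrable lborel (\<lambda>y. F' (x, y))"
    using lborel_pair.AE_integrable_fst'[OF F'_int] .
  have abs_int: "integrable lborel (\<lambda>x. LINT y|lborel. \<bar>F' (x, y)\<bar>)"
    using lborel_pair.integrable_fst'[OF integrable_norm[OF F'_int]] by simp
  have \<Phi>_bound: "AE x in lborel. \<bar>\<Phi> q x\<bar> \<le> b * (LINT y|lborel. \<bar>F' (x, y)\<bar>)"
    if q: "q \<in> borel_measurable borel" "\<And>y. \<bar>q y\<bar> \<le> b" for q
    using AE_sec
  proof eventually_elim
    case (elim x)
    have "\<bar>\<Phi> q x\<bar> \<le> (LINT y|lborel. norm (q y * F' (x, y)))"
      unfolding \<Phi>_def using integral_norm_bound[of lborel "\<lambda>y. q y * F' (x, y)"] by simp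
    also have "\<dots> \<le> (LINT y|lborel. b * \<bar>F' (x, y)\<bar>)"
    proof (rule integral_mono)
      show "integrable lborel (\<lambda>y. norm (q y * F' (x, y)))"
        using mult_int[of q lborel, OF _ q(2) elim] q(1) by simp
      show "integrable lborel (\<lambda>y. b * \<bar>F' (x, y)\<bar>)" using elim by simp
      show "norm (q y * F' (x, y)) \<le> b * \<bar>F' (x, y)\<bar>" for y
        using q(2)[of y] by (simp add: abs_mult mult_right_mono)
    qed
    finally show ?case by simp
  qed
  have \<Phi>_lim: "AE x in lborel. (\<lambda>j. \<Phi> (R' j) x) \<longlonglongrightarrow> \<Phi> r x"
    using AE_sec by eventually_elim (simp add: \<Phi>_def weak)
  note \<Phi>R = \<Phi>_int[OF R'(1) R'(4)] and \<Phi>r = \<Phi>_int[OF r(1) r(4)]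
  have L1: "(\<lambda>j. LINT x|lborel. \<bar>\<Phi> (R' j) x - \<Phi> r x\<bar>) \<longlonglongrightarrow> (LINT x|(lborel::'a measure). 0)"
  proof (rule integral_dominated_convergence)
    show "integrable lborel (\<lambda>x. 2 * (b * (LINT y|lborel. \<bar>F' (x, y)\<bar>)))" using abs_int by simp
    show "AE x in lborel. (\<lambda>j. \<bar>\<Phi> (R' j) x - \<Phi> r x\<bar>) \<longlonglongrightarrow> 0"
      using \<Phi>_lim by eventually_elim (auto intro!: tendsto_rabs_zero simp: LIM_zero_iff)
    show "AE x in lborel. norm \<bar>\<Phi> (R' j) x - \<Phi> r x\<bar> \<le> 2 * (b * (LINT y|lborel. \<bar>F' (x, y)\<bar>))" for j
      using \<Phi>_bound[OF R'(1) R'(4), of j] \<Phi>_bound[OF r(1) r(4)] by eventually_elim auto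
  qed (use \<Phi>R \<Phi>r in auto)
  have "(\<lambda>j. LINT x|lborel. R' j x * (\<Phi> (R' j) x - \<Phi> r x)) \<longlonglongrightarrow> 0"
  proof (rule Lim_null_comparison)
    show "(\<lambda>j. b * (LINT x|lborel. \<bar>\<Phi> (R' j) x - \<Phi> r x\<bar>)) \<longlonglongrightarrow> 0"
      using tendsto_mult_right_zero[OF L1[simplified]] by simp
    show "\<forall>\<^sub>F j in sequentially. norm (LINT x|lborel. R' j x * (\<Phi> (R' j) x - \<Phi> r x)) \<le> b * (LINT x|lborel. \<bar>\<Phi> (R' j) x - \<Phi> r x\<bar>)"
    proof (rule always_eventually, rule allI)
      fix j
      have i: "integrable lborel (\<lambda>x. R' j x * (\<Phi> (R' j) x - \<Phi> r x))"
        using R'(1) R'(4) \<Phi>R \<Phi>r by (intro mult_int) auto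
      have "norm (LINT x|lborel. R' j x * (\<Phi> (R' j) x - \<Phi> r x)) \<le> (LINT x|lborel. norm (R' j x * (\<Phi> (R' j) x - \<Phi> r x)))"
        by (rule integral_norm_bound)
      also have "\<dots> \<le> (LINT x|lborel. b * \<bar>\<Phi> (R' j) x - \<Phi> r x\<bar>)"
      proof (rule integral_mono)
        show "integrable lborel (\<lambda>x. norm (R' j x * (\<Phi> (R' j) x - \<Phi> r x)))"
          using i by (rule integrable_norm)
        show "integrable lborel (\<lambda>x. b * \<bar>\<Phi> (R' j) x - \<Phi> r x\<bar>)" using \<Phi>R \<Phi>r by simp
        show "norm (R' j x * (\<Phi> (R' j) x - \<Phi> r x)) \<le> b * \<bar>\<Phi> (R' j) x - \<Phi> r x\<bar>" for x
          using R'(4)[of j x] by (simp add: abs_mult mult_right_mono)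
      qed
      finally show "norm (LINT x|lborel. R' j x * (\<Phi> (R' j) x - \<Phi> r x)) \<le> b * (LINT x|lborel. \<bar>\<Phi> (R' j) x - \<Phi> r x\<bar>)" by simp
    qed
  qed
  from tendsto_add[OF this weak[OF \<Phi>r]]
  have "(\<lambda>j. (LINT x|lborel. R' j x * (\<Phi> (R' j) x - \<Phi> r x)) + (LINT x|lborel. R' j x * \<Phi> r x)) \<longlonglongrightarrow> (LINT x|lborel. r x * \<Phi> r x)"
    by simp
  moreover have "(LINT x|lborel. R' j x * (\<Phi> (R' j) x - \<Phi> r x)) + (LINT x|lborel. R' j x * \<Phi> r x) = (LINT x|lborel. R' j x * \<Phi> (R' j) x)" for j
    using mult_int[of "R' j" lborel, OF _ R'(4) \<Phi>R] mult_int[of "R' j" lborel, OF _ R'(4) \<Phi>r] R'(1)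
    by (simp add: right_diff_distrib)
  ultimately show ?thesis
    using iterated[OF R(1) R'(1) R'(4) R'(2)] iterated[OF \<rho>(1) r(1) r(4) r(2)] by simp
qed

section \<open>Riesz representation\<close>

text \<open>
  The representing element minimizes \<open>b u u - 2 L u\<close>: by the parallelogram law a minimizing
  sequence is Cauchy, and minimality in each direction \<open>v\<close> is the equation. Completeness is
  assumed only in the weak form in which it is used, a subsequence whose pairings converge,
  so \<open>V\<close> may be a space of functions up to null sets.
\<close>

lemma Riesz_representation:
  fixes b :: "('a \<Rightarrow> real) \<Rightarrow> ('a \<Rightarrow> real) \<Rightarrow> real" and L :: "('a \<Rightarrow> real) \<Rightarrow> real"
  assumes ne: "V \<noteq> {}"
    and V: "\<And>u v t. u \<in> V \<Longrightarrow> v \<in> V \<Longrightarrow> (\<lambda>x. u x + t * v x) \<in> V"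
    and b_sym: "\<And>u v. u \<in> V \<Longrightarrow> v \<in> V \<Longrightarrow> b u v = b v u"
    and b_lin: "\<And>u v w t. u \<in> V \<Longrightarrow> v \<in> V \<Longrightarrow> w \<in> V \<Longrightarrow> b (\<lambda>x. u x + t * v x) w = b u w + t * b v w"
    and b_nonneg: "\<And>u. u \<in> V \<Longrightarrow> 0 \<le> b u u"
    and l_lin: "\<And>u v t. u \<in> V \<Longrightarrow> v \<in> V \<Longrightarrow> L (\<lambda>x. u x + t * v x) = L u + t * L v"
    and l_bound: "\<And>u. u \<in> V \<Longrightarrow> 2 * L u \<le> b u u + K"
    and complete: "\<And>u. (\<And>n. u n \<in> V) \<Longrightarrow>
      (\<And>\<epsilon>. \<epsilon> > 0 \<Longrightarrow> \<exists>N. \<forall>i\<ge>N. \<forall>j\<ge>N. b (\<lambda>x. u i x + (- 1) * u j x) (\<lambda>x. u i x + (- 1) * u j x) \<le> \<epsilon>) \<Longrightarrow>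
      \<exists>w\<in>V. \<exists>r::nat\<Rightarrow>nat. strict_mono r \<and> (\<forall>v\<in>V. (\<lambda>n. b (u (r n)) v) \<longlonglongrightarrow> b w v)"
  shows "\<exists>u\<in>V. \<forall>v\<in>V. b u v = L v"
proof -
  define E where "E u = b u u - 2 * L u" for u
  have bdd: "bdd_below (E ` V)"
    by (rule bdd_belowI2[of _ "- K"]) (use l_bound in \<open>force simp: E_def\<close>)
  define m where "m = Inf (E ` V)"
  have m_le: "m \<le> E u" if "u \<in> V" for u
    unfolding m_def using bdd that by (rule cINF_lower)
  have "\<exists>u\<in>V. E u < m + 1 / real (Suc n)" for n
    using cInf_lessD[of "E ` V" "m + 1 / real (Suc n)"] ne by (auto simp: m_def)
  then obtain u where u: "\<And>n. u n \<in> V" "\<And>n. E (u n) < m + 1 / real (Suc n)" by metis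
  have b_lin2: "b w (\<lambda>x. p x + t * q x) = b w p + t * b w q" if "w \<in> V" "p \<in> V" "q \<in> V" for w p q t
    using b_sym b_lin V that by simp
  have expand: "b (\<lambda>x. p x + t * q x) (\<lambda>x. p x + t * q x) = b p p + 2 * t * b p q + t\<^sup>2 * b q q"
    if "p \<in> V" "q \<in> V" for p q t
    using that V b_sym[of q p] by (simp add: b_lin b_lin2 power2_eq_square algebra_simps)
  have diff_bound: "b (\<lambda>x. p x + (- 1) * q x) (\<lambda>x. p x + (- 1) * q x) \<le> 2 * (E p - m) + 2 * (E q - m)"
    if pq: "p \<in> V" "q \<in> V" for p q
  proof -
    \<comment> \<open>the midpoint, where the functional is at least \<open>m\<close>\<close>
    define h where "h x = p x + (-1/2) * (p x + (-1) * q x)" for x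
    have d: "(\<lambda>x. p x + (-1) * q x) \<in> V" using pq by (rule V)
    have h: "h \<in> V" unfolding h_def using pq(1) d by (rule V)
    have "b h h = b p p + 2 * (-1/2) * b p (\<lambda>x. p x + (-1) * q x) + (-1/2)\<^sup>2 * b (\<lambda>x. p x + (-1) * q x) (\<lambda>x. p x + (-1) * q x)"
      unfolding h_def using pq(1) d by (rule expand)
    also have "\<dots> = (b p p + 2 * b p q + b q q) / 4"
      using expand[OF pq, of "-1"] b_lin2[OF pq(1) pq, of "-1"] by (simp add: power2_eq_square field_simps)
    finally have "4 * b h h = b p p + 2 * b p q + b q q" by simp
    moreover have "2 * L h = L p + L q"
      unfolding h_def using l_lin[OF pq(1) d, of "-1/2"] l_lin[OF pq, of "-1"] by (simp add: field_simps)
    moreover have "m \<le> E h" using h by (rule m_le)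
    ultimately show ?thesis using expand[OF pq, of "-1"] by (simp add: E_def)
  qed
  have "\<exists>N. \<forall>i\<ge>N. \<forall>j\<ge>N. b (\<lambda>x. u i x + (- 1) * u j x) (\<lambda>x. u i x + (- 1) * u j x) \<le> \<epsilon>" if \<epsilon>: "\<epsilon> > 0" for \<epsilon>
  proof -
    obtain N where N: "1 / real (Suc N) < \<epsilon> / 4" using nat_approx_posE[of "\<epsilon>/4"] \<epsilon> by auto
    have E_N: "E (u i) - m \<le> \<epsilon> / 4" if "i \<ge> N" for i
    proof -
      have "1 / real (Suc i) \<le> 1 / real (Suc N)" using that by (simp add: frac_le)
      then show ?thesis using u(2)[of i] N by linarith
    qed
    have "b (\<lambda>x. u i x + (- 1) * u j x) (\<lambda>x. u i x + (- 1) * u j x) \<le> \<epsilon>" if "i \<ge> N" "j \<ge> N" for i j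
    proof -
      have "2 * (E (u i) - m) + 2 * (E (u j) - m) \<le> \<epsilon>"
        using add_mono[OF E_N[OF that(1)] E_N[OF that(2)]] by (simp add: algebra_simps)
      with diff_bound[OF u(1) u(1)] show ?thesis by (rule order_trans)
    qed
    then show ?thesis by blast
  qed
  then obtain w r where w: "w \<in> V" "strict_mono r" "\<And>v. v \<in> V \<Longrightarrow> (\<lambda>n. b (u (r n)) v) \<longlonglongrightarrow> b w v"
    using complete[where u = u, OF u(1)] by blast
  have "b w v = L v" if v: "v \<in> V" for v
  proof -
    have quad: "0 \<le> 2 * t * (b w v - L v) + t\<^sup>2 * b v v" for t
    proof (rule LIMSEQ_le)
      show "(\<lambda>n. - (1 / real (Suc (r n)))) \<longlonglongrightarrow> 0"
        using LIMSEQ_subseq_LIMSEQ[OF LIMSEQ_inverse_real_of_nat w(2)] tendsto_minus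
        by (fastforce simp: o_def inverse_eq_divide)
      show "(\<lambda>n. 2 * t * (b (u (r n)) v - L v) + t\<^sup>2 * b v v) \<longlonglongrightarrow> 2 * t * (b w v - L v) + t\<^sup>2 * b v v"
        using w(3)[OF v] by (intro tendsto_intros)
      have "- (1 / real (Suc n)) \<le> 2 * t * (b (u n) v - L v) + t\<^sup>2 * b v v" for n
        using m_le[OF V[OF u(1) v], of n t] u(2)[of n] expand[OF u(1) v, of n t] l_lin[OF u(1) v, of n t]
        by (simp add: E_def algebra_simps)
      then show "\<exists>N. \<forall>n\<ge>N. - (1 / real (Suc (r n))) \<le> 2 * t * (b (u (r n)) v - L v) + t\<^sup>2 * b v v" by blast
    qed
    define g where "g = b w v - L v"
    \<comment> \<open>adding \<open>1\<close> makes the divisor positive also when \<open>v\<close> is a null vector of \<open>b\<close>\<close>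
    define B where "B = b v v + 1"
    have B: "B > 0" "b v v = B - 1" using b_nonneg[OF v] by (auto simp: B_def)
    have "0 \<le> 2 * (- g / B) * g + (- g / B)\<^sup>2 * b v v" using quad[of "- g / B"] by (simp add: g_def)
    also have "\<dots> \<le> 2 * (- g / B) * g + (- g / B)\<^sup>2 * B" using B by (intro add_left_mono mult_left_mono) auto
    also have "\<dots> = - (g\<^sup>2 / B)" using B by (simp add: power2_eq_square field_simps)
    finally have "g\<^sup>2 / B \<le> 0" by simp
    then have "g = 0" using B by (simp add: divide_le_0_iff)
    then show ?thesis by (simp add: g_def)
  qed
  then show ?thesis using w(1) by blast
qed

section \<open>Translation estimates\<close>

text \<open>
  The Gagliardo double integral with its singular kernel replaced by a cutoff. It takes extended
  nonnegative values so that Tonelli's theorem applies unconditionally.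
\<close>

definition local_oscillation :: "real \<Rightarrow> ('a::euclidean_space \<Rightarrow> real) \<Rightarrow> ennreal" where
  "local_oscillation r w =
     (\<integral>\<^sup>+x. \<integral>\<^sup>+y. ennreal ((w x - w y)\<^sup>2) * indicator (ball x r) y \<partial>lborel \<partial>lborel)"

lemma nn_integral_lborel_translate:
  fixes f :: "'a::euclidean_space \<Rightarrow> ennreal"
  assumes "f \<in> borel_measurable borel"
  shows "(\<integral>\<^sup>+x. f (t + x) \<partial>lborel) = (\<integral>\<^sup>+x. f x \<partial>lborel)"
proof -
  have "(\<integral>\<^sup>+x. f x \<partial>lborel) = (\<integral>\<^sup>+x. f x \<partial>distr lborel borel ((+) t))"
    by (simp only: lborel_distr_plus)
  also have "\<dots> = (\<integral>\<^sup>+x. f (t + x) \<partial>lborel)"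
    using assms by (subst nn_integral_distr) auto
  finally show ?thesis by simp
qed

lemma local_oscillation_eq_translations:
  fixes w :: "'a::euclidean_space \<Rightarrow> real"
  assumes [measurable]: "w \<in> borel_measurable borel"
  shows "local_oscillation r w =
    (\<integral>\<^sup>+t. (\<integral>\<^sup>+x. ennreal ((w (x + t) - w x)\<^sup>2) \<partial>lborel) * indicator (ball 0 r) t \<partial>lborel)"
proof -
  let ?G = "\<lambda>x t. ennreal ((w (x + t) - w x)\<^sup>2) * indicator (ball 0 r) t :: ennreal"
  have [measurable]: "ball (0::'a) r \<in> sets borel" by simp
  have meas: "(\<lambda>(x, t). ?G x t) \<in> borel_measurable (lborel \<Otimes>\<^sub>M lborel)"
    by measurable
  have "(\<integral>\<^sup>+y. ennreal ((w x - w y)\<^sup>2) * indicator (ball x r) y \<partial>lborel) = (\<integral>\<^sup>+t. ?G x t \<partial>lborel)" for x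
    using nn_integral_lborel_translate[of "\<lambda>y. ennreal ((w x - w y)\<^sup>2) * indicator (ball x r) y" x]
    by (simp add: indicator_def dist_norm power2_commute)
  then have "local_oscillation r w = (\<integral>\<^sup>+x. \<integral>\<^sup>+t. ?G x t \<partial>lborel \<partial>lborel)"
    by (simp add: local_oscillation_def)
  also have "\<dots> = (\<integral>\<^sup>+t. \<integral>\<^sup>+x. ?G x t \<partial>lborel \<partial>lborel)"
    using lborel_pair.Fubini'[OF meas] by simp
  also have "\<dots> = (\<integral>\<^sup>+t. (\<integral>\<^sup>+x. ennreal ((w (x + t) - w x)\<^sup>2) \<partial>lborel) * indicator (ball 0 r) t \<partial>lborel)"
    by (intro nn_integral_cong nn_integral_multc) measurable
  finally show ?thesis .
qed

lemma square_sum_le: "(a + b)\<^sup>2 \<le> 2 * a\<^sup>2 + 2 * (b::real)\<^sup>2"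
  using sum_squares_ge_zero[of "a - b" 0] by (simp add: power2_eq_square algebra_simps)

text \<open>
  Going through the intermediate point \<open>x + t\<close> and translating one of the two terms.
\<close>

lemma translation_doubling:
  fixes w :: "'a::euclidean_space \<Rightarrow> real"
  assumes [measurable]: "w \<in> borel_measurable borel"
  shows "(\<integral>\<^sup>+x. ennreal ((w (x + 2 *\<^sub>R t) - w x)\<^sup>2) \<partial>lborel) \<le> 4 * (\<integral>\<^sup>+x. ennreal ((w (x + t) - w x)\<^sup>2) \<partial>lborel)"
proof -
  let ?f = "\<lambda>x. ennreal ((w (x + t) - w x)\<^sup>2)"
  have "ennreal ((w (x + 2 *\<^sub>R t) - w x)\<^sup>2) \<le> 2 * ?f (t + x) + 2 * ?f x" for x
  proof -
    have "(w (x + 2 *\<^sub>R t) - w x)\<^sup>2 \<le> 2 * (w (t + x + t) - w (t + x))\<^sup>2 + 2 * (w (x + t) - w x)\<^sup>2"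
      using square_sum_le[of "w (t + x + t) - w (t + x)" "w (x + t) - w x"]
      by (simp add: scaleR_2 add_ac)
    then have "ennreal ((w (x + 2 *\<^sub>R t) - w x)\<^sup>2) \<le> ennreal (2 * (w (t + x + t) - w (t + x))\<^sup>2 + 2 * (w (x + t) - w x)\<^sup>2)"
      by (rule ennreal_leI)
    then show ?thesis by (simp add: ennreal_plus ennreal_mult)
  qed
  then have "(\<integral>\<^sup>+x. ennreal ((w (x + 2 *\<^sub>R t) - w x)\<^sup>2) \<partial>lborel) \<le> (\<integral>\<^sup>+x. 2 * ?f (t + x) + 2 * ?f x \<partial>lborel)"
    by (rule nn_integral_mono)
  also have "\<dots> = 2 * (\<integral>\<^sup>+x. ?f (t + x) \<partial>lborel) + 2 * (\<integral>\<^sup>+x. ?f x \<partial>lborel)"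
    by (subst nn_integral_add) (auto simp: nn_integral_cmult)
  also have "(\<integral>\<^sup>+x. ?f (t + x) \<partial>lborel) = (\<integral>\<^sup>+x. ?f x \<partial>lborel)"
    by (rule nn_integral_lborel_translate) measurable
  also have "2 * (\<integral>\<^sup>+x. ?f x \<partial>lborel) + 2 * (\<integral>\<^sup>+x. ?f x \<partial>lborel) = 4 * (\<integral>\<^sup>+x. ?f x \<partial>lborel)"
    by (simp add: distrib_right[symmetric])
  finally show ?thesis .
qed

text \<open>
  After \<open>k\<close> doublings the translated support is disjoint from the original one, so at every point at
  most one of the two values \<open>w x\<close> and \<open>w (x + 2\<^sup>k t)\<close> is nonzero.
\<close>

lemma L2_norm_le_translation:
  fixes w :: "'a::euclidean_space \<Rightarrow> real"
  assumes w: "w \<in> borel_measurable borel" and zero: "\<And>x. x \<notin> ball 0 R \<Longrightarrow> w x = 0"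
    and large: "2 * R \<le> 2 ^ k * norm t"
  shows "(\<integral>\<^sup>+x. ennreal ((w x)\<^sup>2) \<partial>lborel) \<le> 4 ^ k * (\<integral>\<^sup>+x. ennreal ((w (x + t) - w x)\<^sup>2) \<partial>lborel)"
proof -
  have iter: "(\<integral>\<^sup>+x. ennreal ((w (x + (2 ^ k) *\<^sub>R t) - w x)\<^sup>2) \<partial>lborel) \<le> 4 ^ k * (\<integral>\<^sup>+x. ennreal ((w (x + t) - w x)\<^sup>2) \<partial>lborel)" for k
  proof (induction k)
    case (Suc k)
    have "(\<integral>\<^sup>+x. ennreal ((w (x + (2 ^ Suc k) *\<^sub>R t) - w x)\<^sup>2) \<partial>lborel)
      \<le> 4 * (\<integral>\<^sup>+x. ennreal ((w (x + (2 ^ k) *\<^sub>R t) - w x)\<^sup>2) \<partial>lborel)"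
      using translation_doubling[OF w, of "(2 ^ k) *\<^sub>R t"] by simp
    also have "\<dots> \<le> 4 * (4 ^ k * (\<integral>\<^sup>+x. ennreal ((w (x + t) - w x)\<^sup>2) \<partial>lborel))"
      using Suc by (rule mult_left_mono) simp
    finally show ?case by (simp add: mult.assoc)
  qed simp
  have "(\<integral>\<^sup>+x. ennreal ((w x)\<^sup>2) \<partial>lborel) \<le> (\<integral>\<^sup>+x. ennreal ((w (x + (2 ^ k) *\<^sub>R t) - w x)\<^sup>2) \<partial>lborel)"
  proof (rule nn_integral_mono)
    fix x
    show "ennreal ((w x)\<^sup>2) \<le> ennreal ((w (x + (2 ^ k) *\<^sub>R t) - w x)\<^sup>2)"
    proof (cases "x \<in> ball 0 R")
      case True
      have "norm ((2 ^ k) *\<^sub>R t) \<le> norm (x + (2 ^ k) *\<^sub>R t) + norm x"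
        using norm_triangle_ineq4[of "x + (2 ^ k) *\<^sub>R t" x] by simp
      then have "x + (2 ^ k) *\<^sub>R t \<notin> ball 0 R" using True large by simp
      then show ?thesis using zero by simp
    qed (simp add: zero)
  qed
  then show ?thesis using iter[of k] by (rule order_trans)
qed

text \<open>
  The translation estimate is averaged over the shell \<open>r/2 < |t| < r\<close>, on which one number \<open>k\<close> of
  doublings is enough for all \<open>t\<close>.
\<close>

lemma Poincare_local_oscillation:
  fixes R r :: real
  assumes r: "r > 0"
  obtains C where "C > 0" "\<And>w::'a::euclidean_space \<Rightarrow> real. w \<in> borel_measurable borel \<Longrightarrow>
    (\<And>x. x \<notin> ball 0 R \<Longrightarrow> w x = 0) \<Longrightarrow>
    (\<integral>\<^sup>+x. ennreal ((w x)\<^sup>2) \<partial>lborel) \<le> ennreal C * local_oscillation r w"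
proof -
  define S where "S = {t::'a. r/2 < norm t \<and> norm t < r}"
  have S: "open S" unfolding S_def by (intro open_Collect_conj open_Collect_less continuous_intros)
  have "S \<noteq> {}"
  proof -
    obtain b :: 'a where "b \<in> Basis" using nonempty_Basis by blast
    then have "(3/4 * r) *\<^sub>R b \<in> S" using r by (simp add: S_def)
    then show ?thesis by blast
  qed
  have S_ball: "S \<subseteq> ball 0 r" by (auto simp: S_def)
  have fin: "emeasure lborel S < \<infinity>"
    using emeasure_mono[OF S_ball, of lborel] emeasure_lborel_ball_finite[of "0::'a" r] by (simp add: le_less_trans)
  define \<beta> where "\<beta> = measure lborel S"
  have \<beta>: "emeasure lborel S = ennreal \<beta>"
    using fin by (simp add: \<beta>_def emeasure_eq_ennreal_measure)
  have "emeasure lborel S \<noteq> 0"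
    using open_not_negligible[OF S \<open>S \<noteq> {}\<close>] S
    by (auto simp: negligible_iff_null_sets null_sets_def)
  then have \<beta>_pos: "\<beta> > 0" using \<beta> by (cases "\<beta> > 0") (auto simp: \<beta>_def ennreal_neg zero_less_measure_iff)
  obtain k where k: "2 * R / (r / 2) < 2 ^ k" using real_arch_pow[of 2] by auto
  have large: "2 * R \<le> 2 ^ k * norm t" if "t \<in> S" for t :: 'a
  proof -
    have "2 * R \<le> 2 ^ k * (r / 2)" using k r by (simp add: field_simps)
    also have "\<dots> \<le> 2 ^ k * norm t" using that by (intro mult_left_mono) (auto simp: S_def)
    finally show ?thesis .
  qed
  show thesis
  proof (rule that[of "4 ^ k / \<beta>"])
    show "4 ^ k / \<beta> > 0" using \<beta>_pos by simp
    fix w :: "'a \<Rightarrow> real"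
    assume w: "w \<in> borel_measurable borel" and zero: "\<And>x. x \<notin> ball 0 R \<Longrightarrow> w x = 0"
    let ?I = "\<integral>\<^sup>+x. ennreal ((w x)\<^sup>2) \<partial>lborel"
    let ?g = "\<lambda>t. \<integral>\<^sup>+x. ennreal ((w (x + t) - w x)\<^sup>2) \<partial>lborel"
    have "ennreal \<beta> * ?I = (\<integral>\<^sup>+t. ?I * indicator S t \<partial>lborel)"
      using nn_integral_cmult_indicator[of S lborel ?I] S \<beta> by (simp add: mult.commute)
    also have "\<dots> \<le> (\<integral>\<^sup>+t. 4 ^ k * (?g t * indicator (ball 0 r) t) \<partial>lborel)"
    proof (rule nn_integral_mono)
      fix t
      show "?I * indicator S t \<le> 4 ^ k * (?g t * indicator (ball 0 r) t)"
        using L2_norm_le_translation[OF w zero large, of t] S_ball by (auto split: split_indicator)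
    qed
    also have "\<dots> = 4 ^ k * local_oscillation r w"
    proof -
      note w[measurable]
      have [measurable]: "ball (0::'a) r \<in> sets borel" by simp
      show ?thesis
        unfolding local_oscillation_eq_translations[OF w] by (intro nn_integral_cmult) measurable
    qed
    finally have le: "ennreal \<beta> * ?I \<le> 4 ^ k * local_oscillation r w" .
    have "?I = ennreal (1 / \<beta>) * (ennreal \<beta> * ?I)"
      using \<beta>_pos by (simp add: mult.assoc[symmetric] ennreal_mult[symmetric])
    also have "\<dots> \<le> ennreal (1 / \<beta>) * (4 ^ k * local_oscillation r w)"
      using le by (rule mult_left_mono) simp
    also have "\<dots> = ennreal (4 ^ k / \<beta>) * local_oscillation r w"
    proof -
      have "(4::ennreal) ^ k = ennreal (4 ^ k)" by (simp add: ennreal_power[symmetric])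
      then show ?thesis using \<beta>_pos by (simp add: mult.assoc[symmetric] ennreal_mult[symmetric])
    qed
    finally show "?I \<le> ennreal (4 ^ k / \<beta>) * local_oscillation r w" .
  qed
qed

lemma ennreal_integral_le_nn_integral:
  assumes "integrable M f"
  shows "ennreal (integral\<^sup>L M f) \<le> (\<integral>\<^sup>+x. ennreal (f x) \<partial>M)"
proof -
  have "(\<integral>\<^sup>+x. ennreal (f x) \<partial>M) < \<infinity>"
    using assms by (simp add: real_integrable_def less_top[symmetric])
  moreover have "integral\<^sup>L M f \<le> enn2real (\<integral>\<^sup>+x. ennreal (f x) \<partial>M)"
    using assms by (simp add: real_lebesgue_integral_def)
  ultimately show ?thesis by (metis ennreal_enn2real ennreal_leI infinity_ennreal_def)
qed

lemma borel_measurable_integral_over_ball: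
  fixes w :: "'a::euclidean_space \<Rightarrow> real"
  assumes [measurable]: "w \<in> borel_measurable borel"
  shows "(\<lambda>x. LINT y|lborel. indicat_real (ball x r) y * w y) \<in> borel_measurable borel"
proof -
  have "(\<lambda>(x, y). indicat_real (ball x r) y * w y) = (\<lambda>z. indicat_real {z. dist (fst z) (snd z) < r} z * w (snd z))"
    by (auto simp: fun_eq_iff indicator_def)
  then have "(\<lambda>(x, y). indicat_real (ball x r) y * w y) \<in> borel_measurable (borel \<Otimes>\<^sub>M lborel)"
    by simp
  then show ?thesis by (rule lborel.borel_measurable_lebesgue_integral)
qed

lemma ennreal_add_le: "0 \<le> b \<Longrightarrow> ennreal (a + b) \<le> ennreal a + ennreal b"
proof (cases "0 \<le> a")
  case False
  then have "ennreal (a + b) \<le> ennreal b" by (intro ennreal_leI) simp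
  then show ?thesis using False by (simp add: ennreal_neg)
qed simp

text \<open>
  A function is controlled by its local averages, up to its oscillation: integrate
  \<open>(w x)\<^sup>2 - 2 w x w y \<le> (w x - w y)\<^sup>2\<close> over \<open>y\<close> in the ball around \<open>x\<close>, and complete the square in \<open>w x\<close>.
\<close>

lemma L2_norm_le_oscillation_plus_averages:
  fixes w :: "'a::euclidean_space \<Rightarrow> real"
  assumes \<Omega>[measurable]: "\<Omega> \<in> sets borel" and w[measurable]: "w \<in> borel_measurable borel" and zero: "\<And>x. x \<notin> \<Omega> \<Longrightarrow> w x = 0"
    and int: "integrable lborel w" and r: "r > 0"
  defines "\<beta> \<equiv> measure lborel (ball (0::'a) r)"
    and "\<phi> \<equiv> \<lambda>x. LINT y|lborel. indicat_real (ball x r) y * w y"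
  shows "ennreal (\<beta> / 2) * (\<integral>\<^sup>+x. ennreal ((w x)\<^sup>2) \<partial>lborel) \<le>
    local_oscillation r w + ennreal (2 / \<beta>) * (\<integral>\<^sup>+x. ennreal ((\<phi> x)\<^sup>2) * indicator \<Omega> x \<partial>lborel)"
proof -
  have \<beta>_ball: "measure lborel (ball x r) = \<beta>" for x :: 'a
    unfolding \<beta>_def using content_ball_conv_unit_ball[of r x] content_ball_conv_unit_ball[of r "0::'a"] r
    by (simp add: measure_completion)
  have \<beta>_pos: "\<beta> > 0"
    unfolding \<beta>_def using r content_ball_pos[of r "0::'a"] by simp
  have [measurable]: "\<phi> \<in> borel_measurable borel"
    unfolding \<phi>_def using w by (rule borel_measurable_integral_over_ball)
  have pointwise: "ennreal (\<beta> / 2 * (w x)\<^sup>2) \<le>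
    (\<integral>\<^sup>+y. ennreal ((w x - w y)\<^sup>2) * indicator (ball x r) y \<partial>lborel) + ennreal (2 / \<beta>) * (ennreal ((\<phi> x)\<^sup>2) * indicator \<Omega> x)" for x
  proof (cases "x \<in> \<Omega>")
    case True
    have fin: "emeasure lborel (ball x r) < \<infinity>" by (rule emeasure_lborel_ball_finite)
    let ?g = "\<lambda>y. (w x)\<^sup>2 * indicat_real (ball x r) y - 2 * w x * (indicat_real (ball x r) y * w y)"
    have i1: "integrable lborel (\<lambda>y. indicat_real (ball x r) y * w y)"
      using int by (intro integrable_indicat_mult) auto
    have i2: "integrable lborel (indicat_real (ball x r))" using fin by simp
    have g: "integrable lborel ?g" using i1 i2 by simp
    have "integral\<^sup>L lborel ?g = (w x)\<^sup>2 * \<beta> - 2 * w x * \<phi> x"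
      using i1 i2 by (simp add: \<phi>_def \<beta>_ball)
    moreover have "\<beta> / 2 * (w x)\<^sup>2 \<le> (w x)\<^sup>2 * \<beta> - 2 * w x * \<phi> x + 2 / \<beta> * (\<phi> x)\<^sup>2"
    proof -
      have "0 \<le> (\<beta> * w x - 2 * \<phi> x)\<^sup>2 / (2 * \<beta>)" using \<beta>_pos by simp
      also have "\<dots> = (w x)\<^sup>2 * \<beta> - 2 * w x * \<phi> x + 2 / \<beta> * (\<phi> x)\<^sup>2 - \<beta> / 2 * (w x)\<^sup>2"
        using \<beta>_pos by (simp add: power2_eq_square field_simps)
      finally show ?thesis by simp
    qed
    ultimately have "ennreal (\<beta> / 2 * (w x)\<^sup>2) \<le> ennreal (integral\<^sup>L lborel ?g + 2 / \<beta> * (\<phi> x)\<^sup>2)"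
      by (intro ennreal_leI) simp
    also have "\<dots> \<le> ennreal (integral\<^sup>L lborel ?g) + ennreal (2 / \<beta> * (\<phi> x)\<^sup>2)"
      using \<beta>_pos by (intro ennreal_add_le) simp
    also have "ennreal (integral\<^sup>L lborel ?g) \<le> (\<integral>\<^sup>+y. ennreal (?g y) \<partial>lborel)"
      using g by (rule ennreal_integral_le_nn_integral)
    also have "(\<integral>\<^sup>+y. ennreal (?g y) \<partial>lborel) \<le> (\<integral>\<^sup>+y. ennreal ((w x - w y)\<^sup>2) * indicator (ball x r) y \<partial>lborel)"
    proof (rule nn_integral_mono)
      fix y
      have "(w x)\<^sup>2 - 2 * w x * w y \<le> (w x - w y)\<^sup>2" by (simp add: power2_eq_square algebra_simps)
      then show "ennreal (?g y) \<le> ennreal ((w x - w y)\<^sup>2) * indicator (ball x r) y"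
        by (auto split: split_indicator intro: ennreal_leI)
    qed
    also have "ennreal (2 / \<beta> * (\<phi> x)\<^sup>2) = ennreal (2 / \<beta>) * (ennreal ((\<phi> x)\<^sup>2) * indicator \<Omega> x)"
      using ennreal_mult[of "2 / \<beta>" "(\<phi> x)\<^sup>2"] True \<beta>_pos by simp
    finally show ?thesis by (simp add: add_right_mono)
  qed (simp add: zero)
  have "ennreal (\<beta> / 2) * (\<integral>\<^sup>+x. ennreal ((w x)\<^sup>2) \<partial>lborel) = (\<integral>\<^sup>+x. ennreal (\<beta> / 2 * (w x)\<^sup>2) \<partial>lborel)"
    using \<beta>_pos ennreal_mult[of "\<beta> / 2" "(w _)\<^sup>2"]
    by (subst nn_integral_cmult[symmetric]) (auto intro!: nn_integral_cong simp del: times_divide_eq_left)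
  also have "\<dots> \<le> (\<integral>\<^sup>+x. (\<integral>\<^sup>+y. ennreal ((w x - w y)\<^sup>2) * indicator (ball x r) y \<partial>lborel) + ennreal (2 / \<beta>) * (ennreal ((\<phi> x)\<^sup>2) * indicator \<Omega> x) \<partial>lborel)"
    by (rule nn_integral_mono) (rule pointwise)
  also have "\<dots> = local_oscillation r w + (\<integral>\<^sup>+x. ennreal (2 / \<beta>) * (ennreal ((\<phi> x)\<^sup>2) * indicator \<Omega> x) \<partial>lborel)"
    unfolding local_oscillation_def
  proof (rule nn_integral_add)
    have "(\<lambda>(x, y). ennreal ((w x - w y)\<^sup>2) * indicator (ball x r) y) \<in> borel_measurable (lborel \<Otimes>\<^sub>M lborel)"
    proof -
      have "(\<lambda>(x, y). ennreal ((w x - w y)\<^sup>2) * indicator (ball x r) y) =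
        (\<lambda>z. ennreal ((w (fst z) - w (snd z))\<^sup>2) * indicator {z. dist (fst z) (snd z) < r} z)"
        by (auto simp: fun_eq_iff indicator_def)
      then show ?thesis by simp
    qed
    then show "(\<lambda>x. \<integral>\<^sup>+y. ennreal ((w x - w y)\<^sup>2) * indicator (ball x r) y \<partial>lborel) \<in> borel_measurable lborel"
      by (rule lborel.borel_measurable_nn_integral)
  qed (use \<Omega> in measurable)
  also have "(\<integral>\<^sup>+x. ennreal (2 / \<beta>) * (ennreal ((\<phi> x)\<^sup>2) * indicator \<Omega> x) \<partial>lborel) = ennreal (2 / \<beta>) * (\<integral>\<^sup>+x. ennreal ((\<phi> x)\<^sup>2) * indicator \<Omega> x \<partial>lborel)"
    using \<Omega> by (intro nn_integral_cmult) measurable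
  finally show ?thesis .
qed

text \<open>
  A Kolmogorov-Riesz criterion. Along a subsequence that converges weakly, the integrals \<open>\<phi> j x\<close> over the
  balls of radius \<open>s\<close> converge for every \<open>x\<close>; they are bounded, so they converge in \<open>L\<^sup>2\<close> of the bounded
  domain. The oscillation hypothesis says that, for small \<open>s\<close>, the averages determine the functions
  up to a small error.
\<close>

lemma L2_Cauchy_subseq_of_small_oscillation:
  fixes h :: "nat \<Rightarrow> 'a::euclidean_space \<Rightarrow> real"
  assumes \<Omega>: "open \<Omega>" "bounded \<Omega>"
    and h: "\<And>j. h j \<in> borel_measurable borel" and zero: "\<And>j x. x \<notin> \<Omega> \<Longrightarrow> h j x = 0"
    and int: "\<And>j. integrable lborel (\<lambda>x. (h j x)\<^sup>2)" and bound: "\<And>j. (LINT x|lborel. (h j x)\<^sup>2) \<le> C"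
    and osc: "\<And>\<epsilon>. \<epsilon> > 0 \<Longrightarrow> \<exists>r>0. \<forall>i j. local_oscillation r (\<lambda>x. h i x - h j x) \<le> ennreal (\<epsilon> * measure lborel (ball (0::'a) r))"
  obtains r where "strict_mono (r::nat\<Rightarrow>nat)"
    "\<And>\<epsilon>. \<epsilon> > 0 \<Longrightarrow> \<exists>N. \<forall>i\<ge>N. \<forall>j\<ge>N. (LINT x|lborel. (h (r i) x - h (r j) x)\<^sup>2) \<le> \<epsilon>"
proof -
  let ?M = "lebesgue_on \<Omega>"
  have \<Omega>m: "\<Omega> \<in> lmeasurable" using \<Omega> by (simp add: bounded_set_imp_lmeasurable)
  have \<Omega>b: "\<Omega> \<in> sets borel" using \<Omega> by simp
  have fm: "finite_measure ?M" using \<Omega>m by (rule finite_measure_lebesgue_on)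
  then interpret finite_measure ?M .
  have hM: "h j \<in> borel_measurable ?M" for j using h by (rule borel_measurable_lebesgue_on_if_borel)
  have rep: "integral\<^sup>L ?M g = integral\<^sup>L lborel g" "integrable ?M g \<longleftrightarrow> integrable lborel g"
    if "g \<in> borel_measurable borel" "\<And>x. x \<notin> \<Omega> \<Longrightarrow> g x = 0" for g :: "'a \<Rightarrow> real"
  proof -
    have "g \<in> borel_measurable ?M" using that(1) by (rule borel_measurable_lebesgue_on_if_borel)
    then show "integral\<^sup>L ?M g = integral\<^sup>L lborel g" "integrable ?M g \<longleftrightarrow> integrable lborel g"
      using integral_eq_borel_representative[OF \<Omega>b _ that(1) _ that(2)]
        integrable_iff_borel_representative[OF \<Omega>b _ that(1) _ that(2)] by auto
  qed
  have sq: "integrable ?M (\<lambda>x. (h j x)\<^sup>2)" "(LINT x|?M. (h j x)\<^sup>2) \<le> C" for j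
    using rep[of "\<lambda>x. (h j x)\<^sup>2"] int[of j] bound[of j] h[of j] zero by auto
  have hM_int: "integrable ?M (h j)" for j
    using fm hM sq(1) by (rule absolutely_integrable_of_square)
  have h_int: "integrable lborel (h j)" for j
    using hM_int rep(2)[of "h j"] h zero by blast
  obtain r where r: "strict_mono (r::nat\<Rightarrow>nat)"
    "\<And>B. B \<in> sets borel \<Longrightarrow> convergent (\<lambda>n. LINT x|?M. indicat_real B x * h (r n) x)"
    by (rule weakly_convergent_subseq_of_L2_bounded[where f = h, OF \<Omega>m hM sq]) (rule that)
  have "\<exists>N. \<forall>i\<ge>N. \<forall>j\<ge>N. (LINT x|lborel. (h (r i) x - h (r j) x)\<^sup>2) \<le> \<epsilon>" if \<epsilon>: "\<epsilon> > 0" for \<epsilon>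
  proof -
    obtain s where s: "s > 0"
      "\<And>i j. local_oscillation s (\<lambda>x. h i x - h j x) \<le> ennreal (\<epsilon> / 4 * measure lborel (ball (0::'a) s))"
      using osc[of "\<epsilon> / 4"] \<epsilon> by auto
    define \<beta> where "\<beta> = measure lborel (ball (0::'a) s)"
    have \<beta>: "\<beta> > 0" using s(1) content_ball_pos[of s "0::'a"] by (simp add: \<beta>_def)
    define \<phi> where "\<phi> j x = (LINT y|lborel. indicat_real (ball x s) y * h (r j) y)" for j x
    have \<phi>_M: "\<phi> j x = (LINT y|?M. indicat_real (ball x s) y * h (r j) y)" for j x
      unfolding \<phi>_def using h zero
      by (intro rep(1)[symmetric] borel_measurable_times borel_measurable_indicator) auto
    have \<phi>_meas: "\<phi> j \<in> borel_measurable borel" for j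
      unfolding \<phi>_def using h by (rule borel_measurable_integral_over_ball)
    then have \<phi>_measM: "\<phi> j \<in> borel_measurable ?M" for j
      by (rule borel_measurable_lebesgue_on_if_borel)
    define K where "K = C + measure ?M \<Omega>"
    have \<phi>_bound: "\<bar>\<phi> j x\<bar> \<le> K" for j x
    proof -
      have "ball x s \<inter> \<Omega> \<in> sets ?M" by (auto simp: sets_restrict_space)
      then have "\<bar>LINT y|?M. indicat_real (ball x s \<inter> \<Omega>) y * h (r j) y\<bar> \<le> 1 * C + measure ?M (ball x s \<inter> \<Omega>) / (4 * 1)"
        by (rule set_integral_abs_le_of_L2_bound[OF fm hM sq]) simp
      moreover have "(LINT y|?M. indicat_real (ball x s \<inter> \<Omega>) y * h (r j) y) = \<phi> j x"
        unfolding \<phi>_M by (rule Bochner_Integration.integral_cong) (auto split: split_indicator)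
      moreover have "measure ?M (ball x s \<inter> \<Omega>) \<le> measure ?M \<Omega>" by (rule finite_measure_mono) auto
      moreover have "0 \<le> measure ?M \<Omega>" by (rule measure_nonneg)
      ultimately show ?thesis unfolding K_def by linarith
    qed
    define \<psi> where "\<psi> x = lim (\<lambda>j. \<phi> j x)" for x
    have \<phi>_lim: "(\<lambda>j. \<phi> j x) \<longlonglongrightarrow> \<psi> x" for x
      using r(2)[of "ball x s"] by (simp add: \<psi>_def \<phi>_M[abs_def] convergent_LIMSEQ_iff)
    have \<psi>_bound: "\<bar>\<psi> x\<bar> \<le> K" for x
      using \<phi>_lim[of x] \<phi>_bound by (intro LIMSEQ_le_const2[OF tendsto_rabs]) auto
    have \<psi>_meas: "\<psi> \<in> borel_measurable ?M"
      unfolding \<psi>_def using \<phi>_measM by (rule borel_measurable_lim_metric)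
    define a where "a j = (LINT x|?M. (\<phi> j x - \<psi> x)\<^sup>2)" for j
    have le_K: "(\<phi> j x - \<psi> x)\<^sup>2 \<le> (2 * K)\<^sup>2" for j x
      using \<phi>_bound[of j x] \<psi>_bound[of x] by (intro abs_le_square_iff[THEN iffD1]) linarith
    have a_lim: "a \<longlonglongrightarrow> 0"
    proof -
      have "(\<lambda>j. LINT x|?M. (\<phi> j x - \<psi> x)\<^sup>2) \<longlonglongrightarrow> (LINT x|?M. 0)"
      proof (rule integral_dominated_convergence)
        show "integrable ?M (\<lambda>x. (2 * K)\<^sup>2)" by simp
        show "AE x in ?M. (\<lambda>j. (\<phi> j x - \<psi> x)\<^sup>2) \<longlonglongrightarrow> 0"
          using \<phi>_lim by (intro AE_I2 tendsto_null_power) (auto simp: LIM_zero_iff)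
        show "AE x in ?M. norm ((\<phi> j x - \<psi> x)\<^sup>2) \<le> (2 * K)\<^sup>2" for j using le_K by simp
      qed (use \<phi>_measM \<psi>_meas in auto)
      then show ?thesis by (simp add: a_def[abs_def])
    qed
    have a_int: "integrable ?M (\<lambda>x. (\<phi> j x - \<psi> x)\<^sup>2)" for j
      using le_K \<phi>_measM \<psi>_meas by (intro integrable_const_bound[where B = "(2 * K)\<^sup>2"]) auto
    obtain N where N: "\<And>j. j \<ge> N \<Longrightarrow> \<bar>a j\<bar> < \<epsilon> * \<beta>\<^sup>2 / 32"
      using LIMSEQ_D[OF a_lim, of "\<epsilon> * \<beta>\<^sup>2 / 32"] \<epsilon> \<beta> by auto
    have "(LINT x|lborel. (h (r i) x - h (r j) x)\<^sup>2) \<le> \<epsilon>" if "i \<ge> N" "j \<ge> N" for i j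
    proof -
      define w where "w x = h (r i) x - h (r j) x" for x
      have w: "w \<in> borel_measurable borel" "integrable lborel w" "\<And>x. x \<notin> \<Omega> \<Longrightarrow> w x = 0"
        using h h_int zero by (auto simp: w_def[abs_def])
      have w2: "integrable lborel (\<lambda>x. (w x)\<^sup>2)"
      proof (rule Bochner_Integration.integrable_bound)
        show "integrable lborel (\<lambda>x. 2 * (h (r i) x)\<^sup>2 + 2 * (h (r j) x)\<^sup>2)" using int by simp
        show "AE x in lborel. norm ((w x)\<^sup>2) \<le> norm (2 * (h (r i) x)\<^sup>2 + 2 * (h (r j) x)\<^sup>2)"
          using square_sum_le[of "h (r i) _" "- h (r j) _"] by (auto simp: w_def)
      qed (use w in auto)
      have avg: "(LINT y|lborel. indicat_real (ball x s) y * w y) = \<phi> i x - \<phi> j x" for x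
        unfolding \<phi>_def w_def right_diff_distrib using h_int
        by (intro Bochner_Integration.integral_diff integrable_indicat_mult) auto
      have sum_int: "integrable ?M (\<lambda>x. 2 * (\<phi> i x - \<psi> x)\<^sup>2 + 2 * (\<phi> j x - \<psi> x)\<^sup>2)"
        using a_int by simp
      have "(\<integral>\<^sup>+x. ennreal ((\<phi> i x - \<phi> j x)\<^sup>2) * indicator \<Omega> x \<partial>lborel) = (\<integral>\<^sup>+x. ennreal ((\<phi> i x - \<phi> j x)\<^sup>2) \<partial>?M)"
        using \<Omega>b by (simp add: nn_integral_restrict_space nn_integral_completion)
      also have "\<dots> \<le> (\<integral>\<^sup>+x. ennreal (2 * (\<phi> i x - \<psi> x)\<^sup>2 + 2 * (\<phi> j x - \<psi> x)\<^sup>2) \<partial>?M)"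
      proof (intro nn_integral_mono ennreal_leI)
        fix x
        show "(\<phi> i x - \<phi> j x)\<^sup>2 \<le> 2 * (\<phi> i x - \<psi> x)\<^sup>2 + 2 * (\<phi> j x - \<psi> x)\<^sup>2"
          using square_sum_le[of "\<phi> i x - \<psi> x" "\<psi> x - \<phi> j x"] by (simp add: power2_commute)
      qed
      also have "\<dots> = ennreal (2 * a i + 2 * a j)"
        using a_int sum_int by (subst nn_integral_eq_integral) (auto simp: a_def)
      finally have avg_le: "(\<integral>\<^sup>+x. ennreal ((\<phi> i x - \<phi> j x)\<^sup>2) * indicator \<Omega> x \<partial>lborel) \<le> ennreal (2 * a i + 2 * a j)" .
      have a0: "0 \<le> a k" for k unfolding a_def by simp
      define X where "X = (LINT x|lborel. (w x)\<^sup>2)"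
      have X: "(\<integral>\<^sup>+x. ennreal ((w x)\<^sup>2) \<partial>lborel) = ennreal X" "0 \<le> X"
        unfolding X_def using w2 by (auto intro: nn_integral_eq_integral)
      have "ennreal (\<beta> / 2 * X) = ennreal (\<beta> / 2) * (\<integral>\<^sup>+x. ennreal ((w x)\<^sup>2) \<partial>lborel)"
        unfolding X(1) using X(2) \<beta> by (intro ennreal_mult) auto
      also have "\<dots> \<le> local_oscillation s w + ennreal (2 / \<beta>) * (\<integral>\<^sup>+x. ennreal ((\<phi> i x - \<phi> j x)\<^sup>2) * indicator \<Omega> x \<partial>lborel)"
        unfolding avg[symmetric] \<beta>_def
        by (rule L2_norm_le_oscillation_plus_averages[OF \<Omega>b w(1) _ w(2) s(1)]) (rule w(3))
      also have "\<dots> \<le> ennreal (\<epsilon> / 4 * \<beta>) + ennreal (2 / \<beta>) * ennreal (2 * a i + 2 * a j)"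
        using s(2)[of "r i" "r j"] avg_le by (intro add_mono mult_left_mono) (auto simp: w_def[abs_def] \<beta>_def)
      also have "\<dots> = ennreal (\<epsilon> / 4 * \<beta> + 2 / \<beta> * (2 * a i + 2 * a j))"
        using a0[of i] a0[of j] \<beta> \<epsilon>
        by (subst ennreal_mult[symmetric]) (auto intro!: ennreal_plus[symmetric] simp del: ennreal_plus)
      finally have le: "\<beta> / 2 * X \<le> \<epsilon> / 4 * \<beta> + 2 / \<beta> * (2 * a i + 2 * a j)"
        using a0[of i] a0[of j] \<beta> \<epsilon> by (subst (asm) ennreal_le_iff) auto
      have "2 * a i + 2 * a j \<le> \<epsilon> * \<beta>\<^sup>2 / 8" using N[OF that(1)] N[OF that(2)] by (simp add: abs_less_iff)
      then have "2 / \<beta> * (2 * a i + 2 * a j) \<le> 2 / \<beta> * (\<epsilon> * \<beta>\<^sup>2 / 8)"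
        using \<beta> by (intro mult_left_mono) auto
      also have "\<dots> = \<epsilon> / 4 * \<beta>" using \<beta> by (simp add: power2_eq_square field_simps)
      finally have "\<beta> / 2 * X \<le> \<epsilon> / 4 * \<beta> + \<epsilon> / 4 * \<beta>"
        using le by (meson add_left_mono order_trans)
      then have "\<beta> * X \<le> \<beta> * \<epsilon>" by (simp add: field_simps)
      then show ?thesis using \<beta> by (simp add: X_def w_def)
    qed
    then show ?thesis by blast
  qed
  then show thesis using that r(1) by blast
qed

section \<open>The energy spaces\<close>

lemma Ck_linear_combination:
  "Ck k f \<Longrightarrow> Ck k g \<Longrightarrow> Ck k (\<lambda>x. f x + t * g x)"
proof (induction k arbitrary: f g)
  case 0
  then show ?case
    by (simp, intro continuous_on_add continuous_on_mult continuous_on_const)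
next
  case (Suc k)
  obtain F G where F: "\<And>x. (f has_derivative (\<lambda>h. F x \<bullet> h)) (at x)" "\<And>i. Ck k (\<lambda>x. F x $ i)"
    and G: "\<And>x. (g has_derivative (\<lambda>h. G x \<bullet> h)) (at x)" "\<And>i. Ck k (\<lambda>x. G x $ i)"
    using Suc.prems by auto
  have "((\<lambda>x. f x + t * g x) has_derivative (\<lambda>h. (F x + t *\<^sub>R G x) \<bullet> h)) (at x)" for x
    using has_derivative_add[OF F(1) has_derivative_mult_right[OF G(1), of t]]
    by (simp add: inner_add_left)
  moreover have "Ck k (\<lambda>x. (F x + t *\<^sub>R G x) $ i)" for i
    using Suc.IH[OF F(2) G(2)] by simp
  ultimately show ?case
    unfolding Ck.simps by (intro exI[of _ "\<lambda>x. F x + t *\<^sub>R G x"] conjI allI)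
qed

lemma test_functions_linear_combination:
  assumes "\<phi> \<in> test_functions \<Omega>" "\<psi> \<in> test_functions \<Omega>"
  shows "(\<lambda>x. \<phi> x + t * \<psi> x) \<in> test_functions \<Omega>"
proof -
  let ?S = "closure {x. \<phi> x \<noteq> 0} \<union> closure {x. \<psi> x \<noteq> 0}"
  have cpt: "compact ?S" "?S \<subseteq> \<Omega>" using assms by (auto simp: test_functions_def)
  have sub: "closure {x. \<phi> x + t * \<psi> x \<noteq> 0} \<subseteq> ?S"
    unfolding closure_Un[symmetric] by (rule closure_mono) auto
  have "compact (?S \<inter> closure {x. \<phi> x + t * \<psi> x \<noteq> 0})"
    using cpt(1) by (rule compact_Int_closed) simp
  then have "compact (closure {x. \<phi> x + t * \<psi> x \<noteq> 0})"
    using sub by (simp only: inf.absorb2)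
  moreover have "closure {x. \<phi> x + t * \<psi> x \<noteq> 0} \<subseteq> \<Omega>" using sub cpt(2) by (rule order_trans)
  moreover have "Ck k (\<lambda>x. \<phi> x + t * \<psi> x)" for k
    using assms by (intro Ck_linear_combination) (simp_all add: test_functions_def)
  ultimately show ?thesis by (simp add: test_functions_def)
qed

lemma Ck_zero: "Ck k (\<lambda>x. 0)"
proof (induction k)
  case (Suc k)
  then show ?case by (auto intro!: exI[of _ "\<lambda>x. 0"])
qed simp

lemma zero_in_test_functions: "(\<lambda>x. 0) \<in> test_functions \<Omega>"
  by (simp add: test_functions_def Ck_zero)

lemma L2_on_linear_combination:
  assumes "u \<in> L2_on S" "v \<in> L2_on S"
  shows "(\<lambda>x. u x + t * v x) \<in> L2_on S"
proof -
  have "integrable (lebesgue_on S) (\<lambda>x. (u x + t * v x)\<^sup>2)"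
  proof (rule Bochner_Integration.integrable_bound)
    show "integrable (lebesgue_on S) (\<lambda>x. 2 * (u x)\<^sup>2 + 2 * (t\<^sup>2 * (v x)\<^sup>2))"
      using assms by (simp add: L2_on_def)
    show "AE x in lebesgue_on S. norm ((u x + t * v x)\<^sup>2) \<le> norm (2 * (u x)\<^sup>2 + 2 * (t\<^sup>2 * (v x)\<^sup>2))"
    proof (rule AE_I2)
      fix x
      show "norm ((u x + t * v x)\<^sup>2) \<le> norm (2 * (u x)\<^sup>2 + 2 * (t\<^sup>2 * (v x)\<^sup>2))"
        using square_sum_le[of "u x" "t * v x"] by (simp add: power_mult_distrib)
    qed
  qed (use assms in \<open>auto simp: L2_on_def\<close>)
  moreover have "(\<lambda>x. u x + t * v x) \<in> borel_measurable (lebesgue_on S)"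
    using assms unfolding L2_on_def
    by (intro borel_measurable_add borel_measurable_times borel_measurable_const) auto
  ultimately show ?thesis by (simp add: L2_on_def)
qed

locale nonlocal_energy =
  fixes \<Omega> :: "(real^'n) set" and A :: "real \<Rightarrow> real \<Rightarrow> real" and \<delta> s c\<^sub>0 :: real
  assumes open_dom: "open \<Omega>" and bounded_dom: "bounded \<Omega>"
    and \<delta>_pos: "0 < \<delta>" and s_pos: "0 < s" and c0_pos: "0 < c\<^sub>0"
    and kernel_nonneg: "\<And>r. 0 \<le> r \<Longrightarrow> 0 \<le> A \<delta> r"
    and kernel_lower: "\<And>x::real^'n. x \<in> ball 0 (\<delta> / 2) - {0} \<Longrightarrow>
      c\<^sub>0 * norm x powr (- (real CARD('n) + 2 * s - 2)) \<le> A \<delta> (norm x)"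
begin

abbreviation D where "D \<equiv> nbhd \<Omega> \<delta>"
abbreviation MD where "MD \<equiv> lebesgue_on D"
abbreviation MDD where "MDD \<equiv> lebesgue_on (D \<times> D)"
abbreviation U where "U \<equiv> U_space \<Omega> A \<delta>"
abbreviation U\<^sub>0 where "U\<^sub>0 \<equiv> U0_space \<Omega> A \<delta>"
abbreviation dens where "dens \<equiv> nl_integrand A \<delta> (\<lambda>_ _. 1)"
definition energy where "energy u = nl_form \<Omega> A \<delta> (\<lambda>_ _. 1) u u"

lemma energy_eq: "energy u = (LINT z|MDD. dens u u z)"
  by (simp add: energy_def nl_form_def)

lemma open_D: "open D" by (auto simp: nbhd_def)

lemma borel_D: "D \<in> sets borel" using open_D by simp

lemma subset_D: "\<Omega> \<subseteq> D"
proof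
  fix x assume "x \<in> \<Omega>"
  moreover have "x \<in> ball x \<delta>" using \<delta>_pos by simp
  ultimately show "x \<in> D" unfolding nbhd_def by blast
qed

lemma lmeasurable_D: "D \<in> lmeasurable"
proof -
  obtain R where R: "\<Omega> \<subseteq> ball 0 R" using bounded_dom bounded_subset_ballD by blast
  have "D \<subseteq> ball 0 (R + \<delta>)"
  proof
    fix y assume "y \<in> D"
    then obtain x where "x \<in> \<Omega>" "dist x y < \<delta>" by (auto simp: nbhd_def)
    then show "y \<in> ball 0 (R + \<delta>)" using R dist_triangle[of 0 y x] by fastforce
  qed
  then have "bounded D" using bounded_ball bounded_subset by blast
  then show ?thesis using borel_D by (intro bounded_set_imp_lmeasurable) auto
qed

lemma lebesgue_D: "D \<in> sets lebesgue" using lmeasurable_D by auto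

lemma dens_eq:
  "dens u v (x, y) = A \<delta> (norm (x - y)) * ((u x - u y) / norm (x - y)) * ((v x - v y) / norm (x - y))"
  by (simp only: nl_integrand_def prod.case mult_1)

lemma dens_nonneg: "0 \<le> dens u u z"
proof (cases z)
  case (Pair x y)
  have "0 \<le> A \<delta> (norm (x - y)) * ((u x - u y) / norm (x - y))\<^sup>2"
    by (intro mult_nonneg_nonneg kernel_nonneg norm_ge_zero zero_le_power2)
  then show ?thesis
    by (simp only: Pair dens_eq power2_eq_square mult.assoc)
qed

lemma dens_sym: "dens u v z = dens v u z"
  by (cases z) (simp only: dens_eq mult_ac)

lemma dens_linear: "dens (\<lambda>x. u x + t * v x) w z = dens u w z + t * dens v w z"
proof (cases z)
  case (Pair x y)
  have "(u x + t * v x - (u y + t * v y)) / norm (x - y) = (u x - u y) / norm (x - y) + t * ((v x - v y) / norm (x - y))"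
    by (simp add: add_divide_distrib[symmetric] diff_divide_distrib[symmetric] algebra_simps)
  moreover have "a * (X + t * Y) * Z = a * X * Z + t * (a * Y * Z)" for a X Y Z :: real
    by (simp add: algebra_simps)
  ultimately show ?thesis by (simp only: Pair dens_eq)
qed

lemma dens_square: "(dens u v z)\<^sup>2 = dens u u z * dens v v z"
  by (cases z) (simp only: dens_eq power2_eq_square mult_ac)

lemma dens_expand:
  "dens (\<lambda>x. u x + t * v x) (\<lambda>x. u x + t * v x) z = dens u u z + 2 * t * dens u v z + t\<^sup>2 * dens v v z"
  using dens_sym[of v u z] dens_sym[of _ "\<lambda>x. u x + t * v x" z]
  by (simp add: dens_linear power2_eq_square algebra_simps)

lemma dens_bound: "\<bar>dens u v z\<bar> \<le> dens u u z + dens v v z"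
  using abs_le_of_square_le_mult[of "dens u v z" "dens u u z" "dens v v z" 1] dens_square[of u v z]
    dens_nonneg[of u z] dens_nonneg[of v z] by simp

lemma U_measurable: "u \<in> U \<Longrightarrow> u \<in> borel_measurable MD"
  by (simp add: U_space_def L2_on_def)

lemma U_L2: "u \<in> U \<Longrightarrow> integrable MD (\<lambda>x. (u x)\<^sup>2)"
  by (simp add: U_space_def L2_on_def)

lemma U_energy: "u \<in> U \<Longrightarrow> integrable MDD (dens u u)"
  by (simp add: U_space_def)

text \<open>
  The integrand of \<open>u\<close> is measurable because \<open>u\<close> has finite energy, and it contains the kernel: replacing
  one increment of \<open>u\<close> by one of \<open>v\<close> gives the mixed integrand, and where the increment of \<open>u\<close> is zero,
  division by zero produces the correct value \<open>0\<close>.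
\<close>

lemma dens_measurable:
  assumes u: "u \<in> U" and v: "v \<in> borel_measurable MD"
  shows "dens u v \<in> borel_measurable MDD"
proof -
  let ?f = "\<lambda>z. dens u u z * ((v (fst z) - v (snd z)) / (u (fst z) - u (snd z)))"
  have "dens u v z = ?f z" for z by (cases z) (simp add: nl_integrand_def)
  then have "dens u v = ?f" by (rule ext)
  moreover have "?f \<in> borel_measurable MDD"
    using U_energy[OF u] borel_measurable_lebesgue_on_Times_fst[OF borel_D v]
      borel_measurable_lebesgue_on_Times_snd[OF borel_D v]
      borel_measurable_lebesgue_on_Times_fst[OF borel_D U_measurable[OF u]]
      borel_measurable_lebesgue_on_Times_snd[OF borel_D U_measurable[OF u]]
    by (intro borel_measurable_times borel_measurable_divide borel_measurable_diff) auto
  ultimately show ?thesis by simp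
qed

lemma dens_integrable:
  assumes "u \<in> U" "v \<in> U"
  shows "integrable MDD (dens u v)"
proof (rule Bochner_Integration.integrable_bound)
  show "integrable MDD (\<lambda>z. dens u u z + dens v v z)" using assms by (simp add: U_energy)
  show "dens u v \<in> borel_measurable MDD" using assms by (simp add: dens_measurable U_measurable)
  show "AE z in MDD. norm (dens u v z) \<le> norm (dens u u z + dens v v z)"
    unfolding real_norm_def using dens_bound[of u v] by (intro AE_I2 order_trans[OF _ abs_ge_self])
qed

lemma U_linear_combination:
  assumes "u \<in> U" "v \<in> U"
  shows "(\<lambda>x. u x + t * v x) \<in> U"
proof -
  have "integrable MDD (\<lambda>z. dens u u z + 2 * t * dens u v z + t\<^sup>2 * dens v v z)"
    using assms by (simp add: U_energy dens_integrable)
  then have "integrable MDD (dens (\<lambda>x. u x + t * v x) (\<lambda>x. u x + t * v x))"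
    by (simp add: dens_expand[abs_def])
  then show ?thesis using assms L2_on_linear_combination[of u D v t] by (simp add: U_space_def)
qed

lemma U_diff: "u \<in> U \<Longrightarrow> v \<in> U \<Longrightarrow> (\<lambda>x. u x - v x) \<in> U"
  using U_linear_combination[of u v "- 1"] by simp

lemma energy_expand:
  assumes "u \<in> U" "v \<in> U"
  shows "energy (\<lambda>x. u x + t * v x) = energy u + 2 * t * (LINT z|MDD. dens u v z) + t\<^sup>2 * energy v"
  unfolding energy_eq dens_expand using assms by (simp add: U_energy dens_integrable)

lemma energy_nonneg: "0 \<le> energy u"
  unfolding energy_eq by (simp add: dens_nonneg)

definition sq_norm where "sq_norm u = (LINT x|MD. (u x)\<^sup>2) + energy u"

lemma U_norm_eq: "U_norm \<Omega> A \<delta> u = sqrt (sq_norm u)"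
  by (simp add: U_norm_def sq_norm_def energy_def)

lemma sq_norm_nonneg: "0 \<le> sq_norm u"
  by (simp add: sq_norm_def energy_nonneg)

lemma energy_sum_le:
  assumes "u \<in> U" "v \<in> U"
  shows "energy (\<lambda>x. u x + t * v x) \<le> 2 * energy u + 2 * t\<^sup>2 * energy v"
proof -
  define I where "I = 2 * t * (LINT z|MDD. dens u v z)"
  define J where "J = t\<^sup>2 * energy v"
  have "0 \<le> energy (\<lambda>x. u x + (- t) * v x)" by (rule energy_nonneg)
  also have "\<dots> = energy u - I + J"
    using energy_expand[OF assms, of "- t"] by (simp add: I_def J_def)
  finally have "energy u + I + J \<le> 2 * energy u + 2 * J" by linarith
  then show ?thesis
    using energy_expand[OF assms, of t] by (simp add: I_def J_def mult.assoc)
qed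

lemma sq_norm_sum_le:
  assumes "u \<in> U" "v \<in> U"
  shows "sq_norm (\<lambda>x. u x + t * v x) \<le> 2 * sq_norm u + 2 * t\<^sup>2 * sq_norm v"
proof -
  have "(LINT x|MD. (u x + t * v x)\<^sup>2) \<le> (LINT x|MD. 2 * (u x)\<^sup>2 + 2 * t\<^sup>2 * (v x)\<^sup>2)"
  proof (rule integral_mono)
    show "integrable MD (\<lambda>x. (u x + t * v x)\<^sup>2)" using U_L2[OF U_linear_combination[OF assms]] .
    show "integrable MD (\<lambda>x. 2 * (u x)\<^sup>2 + 2 * t\<^sup>2 * (v x)\<^sup>2)" using assms by (simp add: U_L2)
    show "(u x + t * v x)\<^sup>2 \<le> 2 * (u x)\<^sup>2 + 2 * t\<^sup>2 * (v x)\<^sup>2" for x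
      using square_sum_le[of "u x" "t * v x"] by (simp add: power_mult_distrib)
  qed
  also have "\<dots> = 2 * (LINT x|MD. (u x)\<^sup>2) + 2 * t\<^sup>2 * (LINT x|MD. (v x)\<^sup>2)"
    using assms by (simp add: U_L2)
  finally show ?thesis using energy_sum_le[OF assms, of t] by (simp add: sq_norm_def algebra_simps)
qed

lemma U0_subset_U: "u \<in> U\<^sub>0 \<Longrightarrow> u \<in> U" by (simp add: U0_space_def)

lemma U0_iff:
  "u \<in> U\<^sub>0 \<longleftrightarrow> u \<in> U \<and> (\<forall>\<epsilon>>0. \<exists>\<phi>. \<phi> \<in> test_functions \<Omega> \<and> \<phi> \<in> U \<and> sq_norm (\<lambda>x. u x - \<phi> x) < \<epsilon>)"
proof -
  have "(\<forall>\<epsilon>>0. \<exists>\<phi>\<in>test_functions \<Omega> \<inter> U. sqrt (sq_norm (\<lambda>x. u x - \<phi> x)) < \<epsilon>) \<longleftrightarrow>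
    (\<forall>\<epsilon>>0. \<exists>\<phi>. \<phi> \<in> test_functions \<Omega> \<and> \<phi> \<in> U \<and> sq_norm (\<lambda>x. u x - \<phi> x) < \<epsilon>)" (is "?l \<longleftrightarrow> ?r")
  proof
    assume ?l
    show ?r
    proof (intro allI impI)
      fix \<epsilon> :: real assume "\<epsilon> > 0"
      then obtain \<phi> where "\<phi> \<in> test_functions \<Omega> \<inter> U" "sqrt (sq_norm (\<lambda>x. u x - \<phi> x)) < sqrt \<epsilon>"
        using \<open>?l\<close> by (metis real_sqrt_gt_zero)
      then show "\<exists>\<phi>. \<phi> \<in> test_functions \<Omega> \<and> \<phi> \<in> U \<and> sq_norm (\<lambda>x. u x - \<phi> x) < \<epsilon>" by auto
    qed
  next
    assume ?r
    show ?l
    proof (intro allI impI)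
      fix \<epsilon> :: real assume \<epsilon>: "\<epsilon> > 0"
      then obtain \<phi> where \<phi>: "\<phi> \<in> test_functions \<Omega>" "\<phi> \<in> U" "sq_norm (\<lambda>x. u x - \<phi> x) < \<epsilon>\<^sup>2"
        using \<open>?r\<close> by (metis zero_less_power)
      then have "sqrt (sq_norm (\<lambda>x. u x - \<phi> x)) < \<epsilon>" using \<epsilon> by (intro real_less_lsqrt) (auto simp: sq_norm_nonneg)
      then show "\<exists>\<phi>\<in>test_functions \<Omega> \<inter> U. sqrt (sq_norm (\<lambda>x. u x - \<phi> x)) < \<epsilon>" using \<phi> by auto
    qed
  qed
  then show ?thesis by (simp add: U0_space_def U_norm_eq)
qed

lemma zero_in_U0: "(\<lambda>x. 0) \<in> U\<^sub>0"
proof -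
  have 0: "dens (\<lambda>x::real^'n. 0) (\<lambda>x. 0) = (\<lambda>z. 0)" by (auto simp: nl_integrand_def)
  then have "(\<lambda>x. 0) \<in> U" by (simp add: U_space_def L2_on_def)
  moreover have "sq_norm (\<lambda>x. 0) = 0" by (simp add: sq_norm_def energy_eq 0)
  ultimately show ?thesis using zero_in_test_functions[of \<Omega>]
    unfolding U0_iff by (intro conjI allI impI exI[of _ "\<lambda>x. 0"]) simp_all
qed

lemma U0_linear_combination:
  assumes u: "u \<in> U\<^sub>0" and v: "v \<in> U\<^sub>0"
  shows "(\<lambda>x. u x + t * v x) \<in> U\<^sub>0"
  unfolding U0_iff
proof (intro conjI allI impI)
  show "(\<lambda>x. u x + t * v x) \<in> U" using u v by (simp add: U0_subset_U U_linear_combination)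
  fix \<epsilon> :: real assume \<epsilon>: "\<epsilon> > 0"
  obtain \<phi> where \<phi>: "\<phi> \<in> test_functions \<Omega>" "\<phi> \<in> U" "sq_norm (\<lambda>x. u x - \<phi> x) < \<epsilon> / 4"
    using u \<epsilon> unfolding U0_iff by (meson divide_pos_pos zero_less_numeral)
  define \<eta> where "\<eta> = \<epsilon> / 4 / (t\<^sup>2 + 1)"
  have t1: "t\<^sup>2 + 1 > 0" by (simp add: add_nonneg_pos)
  then have "\<eta> > 0" using \<epsilon> by (simp add: \<eta>_def)
  then obtain \<psi> where \<psi>: "\<psi> \<in> test_functions \<Omega>" "\<psi> \<in> U" "sq_norm (\<lambda>x. v x - \<psi> x) < \<eta>"
    using v unfolding U0_iff by meson
  have "sq_norm (\<lambda>x. v x - \<psi> x) * t\<^sup>2 \<le> \<eta> * (t\<^sup>2 + 1)"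
    using \<psi>(3) sq_norm_nonneg \<open>\<eta> > 0\<close> by (intro mult_mono) auto
  also have "\<dots> = \<epsilon> / 4" by (rule nonzero_eq_divide_eq[THEN iffD1, OF _ \<eta>_def]) (use t1 in simp)
  finally have "t\<^sup>2 * sq_norm (\<lambda>x. v x - \<psi> x) \<le> \<epsilon> / 4" by (simp only: mult.commute)
  then have "2 * sq_norm (\<lambda>x. u x - \<phi> x) + 2 * t\<^sup>2 * sq_norm (\<lambda>x. v x - \<psi> x) < \<epsilon>"
    using \<phi>(3) \<epsilon> unfolding mult.assoc by linarith
  moreover have "sq_norm (\<lambda>x. (u x - \<phi> x) + t * (v x - \<psi> x)) \<le> 2 * sq_norm (\<lambda>x. u x - \<phi> x) + 2 * t\<^sup>2 * sq_norm (\<lambda>x. v x - \<psi> x)"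
    using \<phi>(2) \<psi>(2) u v by (intro sq_norm_sum_le U_diff) (simp_all add: U0_subset_U)
  moreover have "(\<lambda>x. (u x - \<phi> x) + t * (v x - \<psi> x)) = (\<lambda>x. (u x + t * v x) - (\<phi> x + t * \<psi> x))"
    by (auto simp: algebra_simps)
  ultimately have "sq_norm (\<lambda>x. (u x + t * v x) - (\<phi> x + t * \<psi> x)) < \<epsilon>" by simp
  then show "\<exists>\<phi>. \<phi> \<in> test_functions \<Omega> \<and> \<phi> \<in> U \<and> sq_norm (\<lambda>x. u x + t * v x - \<phi> x) < \<epsilon>"
    using test_functions_linear_combination[OF \<phi>(1) \<psi>(1)] U_linear_combination[OF \<phi>(2) \<psi>(2)]
    by (intro exI[of _ "\<lambda>x. \<phi> x + t * \<psi> x"] conjI)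
qed

lemma U0_diff: "u \<in> U\<^sub>0 \<Longrightarrow> v \<in> U\<^sub>0 \<Longrightarrow> (\<lambda>x. u x - v x) \<in> U\<^sub>0"
  using U0_linear_combination[of u v "- 1"] by simp

lemma U0_closed:
  assumes u: "u \<in> U" and approx: "\<And>\<epsilon>. \<epsilon> > 0 \<Longrightarrow> \<exists>v\<in>U\<^sub>0. sq_norm (\<lambda>x. u x - v x) < \<epsilon>"
  shows "u \<in> U\<^sub>0"
  unfolding U0_iff
proof (intro conjI allI impI)
  fix \<epsilon> :: real assume \<epsilon>: "\<epsilon> > 0"
  then obtain v where v: "v \<in> U\<^sub>0" "sq_norm (\<lambda>x. u x - v x) < \<epsilon> / 4"
    using approx[of "\<epsilon> / 4"] by auto
  then obtain \<phi> where \<phi>: "\<phi> \<in> test_functions \<Omega>" "\<phi> \<in> U" "sq_norm (\<lambda>x. v x - \<phi> x) < \<epsilon> / 4"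
    using \<epsilon> unfolding U0_iff by (meson divide_pos_pos zero_less_numeral)
  have "sq_norm (\<lambda>x. (u x - v x) + 1 * (v x - \<phi> x)) \<le> 2 * sq_norm (\<lambda>x. u x - v x) + 2 * 1\<^sup>2 * sq_norm (\<lambda>x. v x - \<phi> x)"
    using u v(1) \<phi>(2) by (intro sq_norm_sum_le U_diff) (simp_all add: U0_subset_U)
  then have "sq_norm (\<lambda>x. u x - \<phi> x) < \<epsilon>" using v(2) \<phi>(3) by simp
  then show "\<exists>\<phi>. \<phi> \<in> test_functions \<Omega> \<and> \<phi> \<in> U \<and> sq_norm (\<lambda>x. u x - \<phi> x) < \<epsilon>"
    using \<phi>(1,2) by (intro exI[of _ \<phi>] conjI)
qed (rule u)

text \<open>
  Test functions vanish outside \<open>\<Omega>\<close>, and this passes to limits in \<open>L\<^sup>2\<close>.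
\<close>

lemma U0_vanishes_outside:
  assumes u: "u \<in> U\<^sub>0"
  shows "AE x in MD. x \<notin> \<Omega> \<longrightarrow> u x = 0"
proof -
  let ?g = "\<lambda>x. indicat_real (D - \<Omega>) x * (u x)\<^sup>2"
  have DO: "D - \<Omega> \<in> sets MD"
    using lebesgue_D open_dom by (auto simp: sets_restrict_space)
  have g_int: "integrable MD ?g" using DO U_L2[OF U0_subset_U[OF u]] by (rule integrable_indicat_mult)
  have "integral\<^sup>L MD ?g \<le> \<epsilon>" if \<epsilon>: "\<epsilon> > 0" for \<epsilon>
  proof -
    obtain \<phi> where \<phi>: "\<phi> \<in> test_functions \<Omega>" "\<phi> \<in> U" "sq_norm (\<lambda>x. u x - \<phi> x) < \<epsilon>"
      using u \<epsilon> unfolding U0_iff by meson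
    have zero: "\<phi> x = 0" if "x \<notin> \<Omega>" for x
      using \<phi>(1) that closure_subset[of "{x. \<phi> x \<noteq> 0}"] by (auto simp: test_functions_def)
    have "integral\<^sup>L MD ?g \<le> (LINT x|MD. (u x - \<phi> x)\<^sup>2)"
    proof (rule integral_mono[OF g_int])
      show "integrable MD (\<lambda>x. (u x - \<phi> x)\<^sup>2)" using U_L2[OF U_diff[OF U0_subset_U[OF u] \<phi>(2)]] .
      show "?g x \<le> (u x - \<phi> x)\<^sup>2" for x using zero[of x] by (auto split: split_indicator)
    qed
    also have "\<dots> \<le> \<epsilon>" using \<phi>(3) energy_nonneg[of "\<lambda>x. u x - \<phi> x"] by (simp add: sq_norm_def)
    finally show ?thesis .
  qed
  then have "integral\<^sup>L MD ?g \<le> 0" by (rule field_le_epsilon[of _ 0, simplified])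
  moreover have "0 \<le> integral\<^sup>L MD ?g" by simp
  ultimately have "AE x in MD. ?g x = 0"
    using integral_nonneg_eq_0_iff_AE[OF g_int] by simp
  then show ?thesis using AE_space[of MD] by eventually_elim (auto split: split_indicator_asm)
qed

lemma U0_borel_representative:
  assumes u: "u \<in> U\<^sub>0"
  obtains h where "h \<in> borel_measurable borel" "AE x in MD. u x = h x" "\<And>x. x \<notin> \<Omega> \<Longrightarrow> h x = 0"
proof -
  obtain g where g: "g \<in> borel_measurable borel" "AE x in MD. u x = g x"
    using ex_borel_representative[OF borel_D U_measurable[OF U0_subset_U[OF u]]] by metis
  show thesis
  proof (rule that)
    show "(\<lambda>x. indicat_real \<Omega> x * g x) \<in> borel_measurable borel" using g(1) open_dom by simp
    show "AE x in MD. u x = indicat_real \<Omega> x * g x"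
      using g(2) U0_vanishes_outside[OF u] by eventually_elim (auto split: split_indicator)
  qed simp
qed

section \<open>Poincare inequality, completeness and compactness\<close>

text \<open>
  The exponent in the lower bound of the kernel combines with \<open>|x - y|\<^sup>2\<close> to \<open>- (n + 2 s)\<close>, and
  \<open>|x - y| < r\<close>. Pairs outside \<open>D \<times> D\<close> contribute nothing: if one of two points at distance less than
  \<open>\<delta>\<close> is in \<open>\<Omega>\<close>, then both are in \<open>D\<close>.
\<close>

lemma local_oscillation_le_energy:
  assumes u: "u \<in> U" and h: "h \<in> borel_measurable borel" "AE x in MD. u x = h x" "\<And>x. x \<notin> \<Omega> \<Longrightarrow> h x = 0"
    and r: "0 < r" "r \<le> \<delta> / 2"
  shows "local_oscillation r h \<le> ennreal (r powr (real CARD('n) + 2 * s) / c\<^sub>0 * energy u)"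
proof -
  define q where "q = real CARD('n) + 2 * s"
  have q: "q \<ge> 0" using s_pos by (simp add: q_def)
  let ?f = "\<lambda>z. ennreal ((h (fst z) - h (snd z))\<^sup>2) * indicator {z. dist (fst z) (snd z) < r} z"
  note h(1)[measurable]
  have f_meas: "?f \<in> borel_measurable (lborel \<Otimes>\<^sub>M lborel)" by simp
  have "local_oscillation r h = (\<integral>\<^sup>+x. \<integral>\<^sup>+y. ?f (x, y) \<partial>lborel \<partial>lborel)"
    unfolding local_oscillation_def by (intro nn_integral_cong) (auto simp: indicator_def)
  also have "\<dots> = (\<integral>\<^sup>+z. ?f z \<partial>(lborel \<Otimes>\<^sub>M lborel))"
    using f_meas by (rule lborel.nn_integral_fst)
  also have "\<dots> = (\<integral>\<^sup>+z. ?f z \<partial>lebesgue)"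
    by (simp add: nn_integral_completion lborel_prod)
  also have "\<dots> = (\<integral>\<^sup>+z. ?f z * indicator (D \<times> D) z \<partial>lebesgue)"
  proof (rule nn_integral_cong)
    fix z :: "(real^'n) \<times> (real^'n)"
    obtain x y where z: "z = (x, y)" by (cases z)
    have "h x = 0 \<and> h y = 0" if "dist x y < r" "\<not> (x \<in> D \<and> y \<in> D)"
    proof -
      have "x \<in> D \<and> y \<in> D" if "x \<in> \<Omega> \<or> y \<in> \<Omega>"
        using that \<open>dist x y < r\<close> r \<delta>_pos by (auto simp: nbhd_def dist_commute intro: bexI[of _ x] bexI[of _ y])
      then show ?thesis using that(2) h(3) by blast
    qed
    then show "?f z = ?f z * indicator (D \<times> D) z" by (auto simp: z split: split_indicator)
  qed
  also have "\<dots> = (\<integral>\<^sup>+z. ?f z \<partial>MDD)"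
    using Times_in_sets_borel[OF borel_D borel_D] by (subst nn_integral_restrict_space) auto
  also have "\<dots> \<le> (\<integral>\<^sup>+z. ennreal (r powr q / c\<^sub>0 * dens u u z) \<partial>MDD)"
  proof (rule nn_integral_mono_AE)
    show "AE z in MDD. ?f z \<le> ennreal (r powr q / c\<^sub>0 * dens u u z)"
      using AE_lebesgue_on_Times_fst[OF borel_D borel_D h(2)] AE_lebesgue_on_Times_snd[OF borel_D borel_D h(2)]
    proof eventually_elim
      case (elim z)
      obtain x y where z: "z = (x, y)" by (cases z)
      have "(u x - u y)\<^sup>2 \<le> r powr q / c\<^sub>0 * dens u u z" if d: "dist x y < r"
      proof (cases "x = y")
        case True
        then show ?thesis using dens_nonneg[of u z] c0_pos by simp
      next
        case False
        define d where "d = norm (x - y)"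
        have d0: "0 < d" "d < r" using False d by (auto simp: d_def dist_norm)
        have "c\<^sub>0 * d powr (- (q - 2)) \<le> A \<delta> d"
        proof -
          have "x - y \<in> ball 0 (\<delta> / 2) - {0}"
            using False \<open>dist x y < r\<close> r by (simp add: dist_norm norm_minus_commute)
          then show ?thesis using kernel_lower by (simp add: d_def q_def)
        qed
        then have "c\<^sub>0 * d powr (- (q - 2)) / d\<^sup>2 \<le> A \<delta> d / d\<^sup>2" by (simp add: divide_right_mono)
        moreover have "d powr (- (q - 2)) / d\<^sup>2 = d powr (- q)"
        proof -
          have "d powr (- (q - 2)) = d powr (- q) * d powr 2" by (simp add: powr_add[symmetric])
          moreover have "d powr 2 = d\<^sup>2" using d0 by simp
          ultimately show ?thesis using d0 by simp
        qed
        ultimately have A_d: "c\<^sub>0 * d powr (- q) \<le> A \<delta> d / d\<^sup>2"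
          by (metis times_divide_eq_right)
        have "1 \<le> r powr q * d powr (- q)"
        proof -
          have "d powr q \<le> r powr q" using d0 q by (intro powr_mono2) auto
          then show ?thesis using d0 by (simp add: powr_minus field_simps)
        qed
        then have "c\<^sub>0 * 1 \<le> c\<^sub>0 * (r powr q * d powr (- q))" using c0_pos by (intro mult_left_mono) auto
        also have "\<dots> \<le> r powr q * (A \<delta> d / d\<^sup>2)"
          using mult_left_mono[OF A_d, of "r powr q"] by (simp only: mult.left_commute) simp
        finally have "1 \<le> r powr q * (A \<delta> d / d\<^sup>2) / c\<^sub>0"
          unfolding le_divide_eq_1_pos[OF c0_pos] mult_1_right .
        then have "1 \<le> r powr q / c\<^sub>0 * (A \<delta> d / d\<^sup>2)" by (simp only: times_divide_eq_left)
        from mult_right_mono[OF this, of "(u x - u y)\<^sup>2"]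
        have "(u x - u y)\<^sup>2 \<le> r powr q / c\<^sub>0 * (A \<delta> d / d\<^sup>2) * (u x - u y)\<^sup>2" by simp
        also have "\<dots> = r powr q / c\<^sub>0 * dens u u z"
          by (simp add: z nl_integrand_def d_def power2_eq_square)
        finally show ?thesis .
      qed
      then have le: "dist x y < r \<Longrightarrow> ennreal ((u x - u y)\<^sup>2) \<le> ennreal (r powr q / c\<^sub>0 * dens u u z)"
        by (rule ennreal_leI)
      show ?case using le elim by (auto simp: z split: split_indicator)
    qed
  qed
  also have "\<dots> = ennreal (LINT z|MDD. r powr q / c\<^sub>0 * dens u u z)"
    using U_energy[OF u] dens_nonneg[of u] c0_pos by (intro nn_integral_eq_integral) auto
  also have "(LINT z|MDD. r powr q / c\<^sub>0 * dens u u z) = r powr q / c\<^sub>0 * energy u"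
    by (simp add: energy_eq)
  finally show ?thesis by (simp add: q_def)
qed

lemma integral_MD_eq_borel_representative:
  fixes g h :: "real^'n \<Rightarrow> real"
  assumes "g \<in> borel_measurable MD" "h \<in> borel_measurable borel" "AE x in MD. g x = h x" "\<And>x. x \<notin> \<Omega> \<Longrightarrow> h x = 0"
  shows "integral\<^sup>L MD g = integral\<^sup>L lborel h" "integrable MD g \<longleftrightarrow> integrable lborel h"
  using integral_eq_borel_representative[OF borel_D assms(1-3)]
    integrable_iff_borel_representative[OF borel_D assms(1-3)] assms(4) subset_D by blast+

lemma Poincare:
  obtains C where "C > 0" "\<And>u. u \<in> U\<^sub>0 \<Longrightarrow> (LINT x|MD. (u x)\<^sup>2) \<le> C * energy u"
proof -
  obtain R where R: "\<Omega> \<subseteq> ball 0 R" using bounded_dom bounded_subset_ballD by blast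
  obtain P where P: "P > 0" "\<And>w::real^'n \<Rightarrow> real. w \<in> borel_measurable borel \<Longrightarrow>
    (\<And>x. x \<notin> ball 0 R \<Longrightarrow> w x = 0) \<Longrightarrow>
    (\<integral>\<^sup>+x. ennreal ((w x)\<^sup>2) \<partial>lborel) \<le> ennreal P * local_oscillation (\<delta> / 2) w"
    using Poincare_local_oscillation[of "\<delta> / 2" R] \<delta>_pos by (metis half_gt_zero)
  define C where "C = P * ((\<delta> / 2) powr (real CARD('n) + 2 * s) / c\<^sub>0)"
  have "C > 0" unfolding C_def using P(1) c0_pos \<delta>_pos by simp
  moreover have "(LINT x|MD. (u x)\<^sup>2) \<le> C * energy u" if u: "u \<in> U\<^sub>0" for u
  proof -
    obtain h where h: "h \<in> borel_measurable borel" "AE x in MD. u x = h x" "\<And>x. x \<notin> \<Omega> \<Longrightarrow> h x = 0"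
      using U0_borel_representative[OF u] by metis
    have uU: "u \<in> U" using u by (rule U0_subset_U)
    have h2: "(\<lambda>x. (h x)\<^sup>2) \<in> borel_measurable borel" "AE x in MD. (u x)\<^sup>2 = (h x)\<^sup>2"
      using h(1,2) by (auto elim!: eventually_mono)
    have rep: "(LINT x|MD. (u x)\<^sup>2) = (LINT x|lborel. (h x)\<^sup>2)" "integrable lborel (\<lambda>x. (h x)\<^sup>2)"
      using integral_MD_eq_borel_representative[OF _ h2] U_L2[OF uU] h(3) by auto
    have "ennreal (LINT x|lborel. (h x)\<^sup>2) = (\<integral>\<^sup>+x. ennreal ((h x)\<^sup>2) \<partial>lborel)"
      using rep(2) by (intro nn_integral_eq_integral[symmetric]) auto
    also have "\<dots> \<le> ennreal P * local_oscillation (\<delta> / 2) h"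
      using R h(3) by (intro P(2) h(1)) blast
    also have "\<dots> \<le> ennreal P * ennreal ((\<delta> / 2) powr (real CARD('n) + 2 * s) / c\<^sub>0 * energy u)"
      using \<delta>_pos local_oscillation_le_energy[OF uU h(1,2), of "\<delta> / 2"] h(3) by (intro mult_left_mono) auto
    also have "\<dots> = ennreal (C * energy u)"
      using P(1) c0_pos energy_nonneg[of u] by (simp add: C_def ennreal_mult[symmetric] mult.assoc)
    finally show ?thesis
      using rep(1) \<open>C > 0\<close> energy_nonneg[of u] by (subst (asm) ennreal_le_iff) auto
  qed
  ultimately show thesis by (rule that)
qed

text \<open>
  Lower semicontinuity of both parts of the norm under almost everywhere convergence, by Fatou's lemma.
\<close>

lemma AE_limit_energy_bounded:
  assumes v: "\<And>n. v n \<in> U" and w: "w \<in> borel_measurable MD" and lim: "AE x in MD. (\<lambda>n. v n x) \<longlonglongrightarrow> w x"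
    and L2: "\<And>n. n \<ge> N \<Longrightarrow> (LINT x|MD. (v n x)\<^sup>2) \<le> K1" and en: "\<And>n. n \<ge> N \<Longrightarrow> energy (v n) \<le> K2"
  shows "w \<in> U" "(LINT x|MD. (w x)\<^sup>2) \<le> K1" "energy w \<le> K2"
proof -
  have sq: "AE x in MD. (\<lambda>n. (v n x)\<^sup>2) \<longlonglongrightarrow> (w x)\<^sup>2"
    using lim by eventually_elim (rule tendsto_power)
  have w2: "(\<lambda>x. (w x)\<^sup>2) \<in> borel_measurable MD" using w by simp
  have dens_lim: "AE z in MDD. (\<lambda>n. dens (v n) (v n) z) \<longlonglongrightarrow> dens w w z"
    using AE_lebesgue_on_Times_fst[OF borel_D borel_D lim] AE_lebesgue_on_Times_snd[OF borel_D borel_D lim]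
  proof eventually_elim
    case (elim z)
    then show ?case
      by (cases z) (auto simp: nl_integrand_def divide_inverse intro!: tendsto_intros)
  qed
  have dens_w: "dens w w \<in> borel_measurable MDD"
  proof (rule borel_measurable_lebesgue_on_AE)
    show "(\<lambda>z. lim (\<lambda>n. dens (v n) (v n) z)) \<in> borel_measurable MDD"
      using U_energy[OF v] by (intro borel_measurable_lim_metric) auto
    show "AE z in MDD. lim (\<lambda>n. dens (v n) (v n) z) = dens w w z"
      using dens_lim by eventually_elim (rule limI)
    show "D \<times> D \<in> sets lebesgue" using Times_in_sets_borel[OF borel_D borel_D] by simp
  qed
  have w_int: "integrable MD (\<lambda>x. (w x)\<^sup>2)" "(LINT x|MD. (w x)\<^sup>2) \<le> K1"
    by (rule integral_limit_le[OF U_L2[OF v] _ sq w2 L2], simp, assumption)+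
  have e_int: "integrable MDD (dens w w)" "(LINT z|MDD. dens w w z) \<le> K2"
    by (rule integral_limit_le[OF U_energy[OF v] _ dens_lim dens_w en[unfolded energy_eq]],
        simp add: dens_nonneg, assumption)+
  show "w \<in> U" using w w_int(1) e_int(1) by (simp add: U_space_def L2_on_def)
  show "(LINT x|MD. (w x)\<^sup>2) \<le> K1" "energy w \<le> K2"
    using w_int(2) e_int(2) by (auto simp: energy_eq)
qed

lemma energy_diff_commute: "energy (\<lambda>x. u x - v x) = energy (\<lambda>x. v x - u x)"
proof -
  have "dens (\<lambda>x. u x - v x) (\<lambda>x. u x - v x) z = dens (\<lambda>x. v x - u x) (\<lambda>x. v x - u x) z" for z
  proof (cases z)
    case (Pair x y)
    have "u x - v x - (u y - v y) = - (v x - u x - (v y - u y))" by simp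
    then show ?thesis
      by (simp only: Pair dens_eq minus_divide_left[symmetric] mult_minus_left mult_minus_right minus_minus)
  qed
  then show ?thesis by (simp only: energy_eq)
qed

lemma dens_diff_AE_tendsto_0:
  assumes "AE x in MD. (\<lambda>n. v n x) \<longlonglongrightarrow> w x"
  shows "AE z in MDD. (\<lambda>n. dens (\<lambda>x. v n x - w x) (\<lambda>x. v n x - w x) z) \<longlonglongrightarrow> 0"
  using AE_lebesgue_on_Times_fst[OF borel_D borel_D assms] AE_lebesgue_on_Times_snd[OF borel_D borel_D assms]
proof eventually_elim
  case (elim z)
  obtain x y where z: "z = (x, y)" by (cases z)
  have "(\<lambda>n. v n x - w x) \<longlonglongrightarrow> 0" "(\<lambda>n. v n y - w y) \<longlonglongrightarrow> 0"
    using elim by (auto simp: z LIM_zero)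
  then have "(\<lambda>n. (v n x - w x - (v n y - w y)) / norm (x - y)) \<longlonglongrightarrow> (0 - 0) / norm (x - y)"
    unfolding divide_inverse by (intro tendsto_intros)
  then have "(\<lambda>n. (v n x - w x - (v n y - w y)) / norm (x - y)) \<longlonglongrightarrow> 0" by simp
  from tendsto_mult[OF tendsto_mult[OF tendsto_const[of "A \<delta> (norm (x - y))"] this] this]
  show ?case by (simp only: z dens_eq mult_zero_right)
qed

text \<open>
  The step that compensates for the merely weak convergence of the coefficients: the integrands
  converge in \<open>L\<^sup>1\<close>, although the energies of \<open>v n - w\<close> are only bounded.
\<close>

lemma dens_product_limit:
  assumes v: "\<And>n. v n \<in> U" and w: "w \<in> U" and g: "g \<in> U"
    and lim: "AE x in MD. (\<lambda>n. v n x) \<longlonglongrightarrow> w x"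
    and bound: "\<And>n. energy (\<lambda>x. v n x - w x) \<le> K"
  shows "(\<lambda>n. LINT z|MDD. \<bar>dens (v n) g z - dens w g z\<bar>) \<longlonglongrightarrow> 0"
proof -
  have d: "(\<lambda>x. v n x - w x) \<in> U" for n using v w by (rule U_diff)
  have "(\<lambda>n. LINT z|MDD. \<bar>dens (\<lambda>x. v n x - w x) g z\<bar>) \<longlonglongrightarrow> 0"
  proof (rule integral_abs_tendsto_0_of_square_le(2))
    show "dens (\<lambda>x. v n x - w x) g \<in> borel_measurable MDD" for n
      using d U_measurable[OF g] by (rule dens_measurable)
    show "integrable MDD (dens (\<lambda>x. v n x - w x) (\<lambda>x. v n x - w x))" for n
      using d by (rule U_energy)
    show "integral\<^sup>L MDD (dens (\<lambda>x. v n x - w x) (\<lambda>x. v n x - w x)) \<le> K" for n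
      using bound by (simp only: energy_eq)
    show "integrable MDD (dens g g)" using g by (rule U_energy)
    show "AE z in MDD. (\<lambda>n. dens (\<lambda>x. v n x - w x) (\<lambda>x. v n x - w x) z) \<longlonglongrightarrow> 0"
      using lim by (rule dens_diff_AE_tendsto_0)
    show "AE z in MDD. (dens (\<lambda>x. v n x - w x) g z)\<^sup>2 \<le> dens (\<lambda>x. v n x - w x) (\<lambda>x. v n x - w x) z * dens g g z" for n
      by (intro AE_I2) (simp only: dens_square order_refl)
  qed (simp_all only: dens_nonneg AE_I2)
  moreover have "dens (\<lambda>x. v n x - w x) g z = dens (v n) g z - dens w g z" for n z
    using dens_linear[of "v n" "- 1" w g z] by simp
  ultimately show ?thesis by simp
qed

text \<open>
  Completeness of the space of states for the energy. By the Poincare inequality the sequence is Cauchy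
  in \<open>L\<^sup>2\<close>, and Fatou's lemma identifies the almost everywhere limit as the limit in norm.
  The last conclusion is the energy bound under which \<open>dens_product_limit\<close> applies.
\<close>

lemma energy_Cauchy_has_limit:
  assumes v: "\<And>n. v n \<in> U\<^sub>0"
    and Cauchy: "\<And>\<epsilon>. \<epsilon> > 0 \<Longrightarrow> \<exists>N. \<forall>i\<ge>N. \<forall>j\<ge>N. energy (\<lambda>x. v i x - v j x) \<le> \<epsilon>"
  obtains w r where "w \<in> U\<^sub>0" "strict_mono (r::nat\<Rightarrow>nat)" "AE x in MD. (\<lambda>n. v (r n) x) \<longlonglongrightarrow> w x"
    "\<And>n. energy (\<lambda>x. v (r n) x - w x) \<le> 1"
proof -
  obtain C where C: "C > 0" "\<And>u. u \<in> U\<^sub>0 \<Longrightarrow> (LINT x|MD. (u x)\<^sup>2) \<le> C * energy u"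
    using Poincare by blast
  have vU: "v n \<in> U" for n using v by (rule U0_subset_U)
  have diffU: "(\<lambda>x. v i x - v j x) \<in> U" for i j using vU vU by (rule U_diff)
  have L2: "\<exists>N. \<forall>i\<ge>N. \<forall>j\<ge>N. (LINT x|MD. (v i x - v j x)\<^sup>2) \<le> \<epsilon>" if \<epsilon>: "\<epsilon> > 0" for \<epsilon>
  proof -
    obtain N where N: "\<And>i j. i \<ge> N \<Longrightarrow> j \<ge> N \<Longrightarrow> energy (\<lambda>x. v i x - v j x) \<le> \<epsilon> / C"
      using Cauchy[of "\<epsilon> / C"] \<epsilon> C(1) by auto
    have "(LINT x|MD. (v i x - v j x)\<^sup>2) \<le> \<epsilon>" if "i \<ge> N" "j \<ge> N" for i j
    proof -
      have "(LINT x|MD. (v i x - v j x)\<^sup>2) \<le> C * energy (\<lambda>x. v i x - v j x)"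
        using v by (intro C(2) U0_diff)
      also have "\<dots> \<le> C * (\<epsilon> / C)" using N[OF that] C(1) by (intro mult_left_mono) auto
      finally show ?thesis using C(1) by simp
    qed
    then show ?thesis by blast
  qed
  obtain r w where r: "strict_mono (r::nat\<Rightarrow>nat)" and w: "w \<in> borel_measurable MD"
    and lim: "AE x in MD. (\<lambda>n. v (r n) x) \<longlonglongrightarrow> w x"
    by (rule AE_convergent_subseq_of_L2_Cauchy[where u = v and M = MD])
      (use U_measurable[OF vU] U_L2[OF diffU] L2 in blast)+
  have r_ge: "n \<le> r n" for n using r by (rule seq_suble)
  have near: "(\<lambda>x. w x - v j x) \<in> U \<and> sq_norm (\<lambda>x. w x - v j x) \<le> \<epsilon> \<and> energy (\<lambda>x. w x - v j x) \<le> \<epsilon>"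
    if N: "\<forall>i\<ge>N. \<forall>j\<ge>N. energy (\<lambda>x. v i x - v j x) \<le> \<epsilon> / (C + 1)" and j: "j \<ge> N" and \<epsilon>: "\<epsilon> > 0"
    for N j \<epsilon>
  proof -
    have *: "(LINT x|MD. (v (r n) x - v j x)\<^sup>2) \<le> C * (\<epsilon> / (C + 1))" "energy (\<lambda>x. v (r n) x - v j x) \<le> \<epsilon> / (C + 1)"
      if "n \<ge> N" for n
    proof -
      show e: "energy (\<lambda>x. v (r n) x - v j x) \<le> \<epsilon> / (C + 1)"
        using j that r_ge[of n] N by (meson order_trans)
      have "(LINT x|MD. (v (r n) x - v j x)\<^sup>2) \<le> C * energy (\<lambda>x. v (r n) x - v j x)"
        using v by (intro C(2) U0_diff)
      then show "(LINT x|MD. (v (r n) x - v j x)\<^sup>2) \<le> C * (\<epsilon> / (C + 1))"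
        using mult_left_mono[OF e, of C] C(1) by linarith
    qed
    have m: "(\<lambda>x. w x - v j x) \<in> borel_measurable MD" using w U_measurable[OF vU] by (rule borel_measurable_diff)
    have l: "AE x in MD. (\<lambda>n. v (r n) x - v j x) \<longlonglongrightarrow> w x - v j x"
      using lim by eventually_elim (intro tendsto_diff tendsto_const)
    note lims = AE_limit_energy_bounded[where v = "\<lambda>n x. v (r n) x - v j x", OF diffU m l *]
    have "(\<lambda>x. w x - v j x) \<in> U" by (rule lims(1)[of N]) auto
    moreover have "(LINT x|MD. (w x - v j x)\<^sup>2) \<le> C * (\<epsilon> / (C + 1))" by (rule lims(2)[of N]) auto
    moreover have e: "energy (\<lambda>x. w x - v j x) \<le> \<epsilon> / (C + 1)" by (rule lims(3)[of N]) auto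
    moreover have "C * (\<epsilon> / (C + 1)) + \<epsilon> / (C + 1) = \<epsilon>"
    proof -
      have "C * (\<epsilon> / (C + 1)) + \<epsilon> / (C + 1) = (C + 1) * (\<epsilon> / (C + 1))"
        by (simp only: distrib_right mult_1)
      then show ?thesis using C(1) by simp
    qed
    moreover have "0 \<le> C * (\<epsilon> / (C + 1))" using C(1) \<epsilon> by simp
    ultimately show ?thesis unfolding sq_norm_def by (intro conjI) linarith+
  qed
  have CauchyC: "\<exists>N. \<forall>i\<ge>N. \<forall>j\<ge>N. energy (\<lambda>x. v i x - v j x) \<le> \<epsilon> / (C + 1)" if "\<epsilon> > 0" for \<epsilon>
    using that C(1) by (intro Cauchy) simp
  obtain N where N: "\<forall>i\<ge>N. \<forall>j\<ge>N. energy (\<lambda>x. v i x - v j x) \<le> 1 / (C + 1)"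
    using CauchyC[OF zero_less_one] by (rule exE)
  note near1 = near[OF N _ zero_less_one]
  have "(\<lambda>x. w x - v N x) \<in> U" by (rule near1[THEN conjunct1]) simp
  from U_linear_combination[OF this vU[of N], of 1] have wU: "w \<in> U" by simp
  have "w \<in> U\<^sub>0"
  proof (rule U0_closed[OF wU])
    fix \<epsilon> :: real assume \<epsilon>: "\<epsilon> > 0"
    then have \<epsilon>2: "\<epsilon> / 2 > 0" by simp
    obtain N where N: "\<forall>i\<ge>N. \<forall>j\<ge>N. energy (\<lambda>x. v i x - v j x) \<le> \<epsilon> / 2 / (C + 1)"
      using CauchyC[OF \<epsilon>2] by (rule exE)
    have "sq_norm (\<lambda>x. w x - v N x) \<le> \<epsilon> / 2"
      by (rule near[OF N _ \<epsilon>2, THEN conjunct2, THEN conjunct1]) simp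
    then show "\<exists>u\<in>U\<^sub>0. sq_norm (\<lambda>x. w x - u x) < \<epsilon>" using \<epsilon> by (intro bexI[OF _ v[of N]]) linarith
  qed
  moreover have "strict_mono (\<lambda>n. r (n + N))" using r by (auto simp: strict_mono_def)
  moreover have "AE x in MD. (\<lambda>n. v (r (n + N)) x) \<longlonglongrightarrow> w x"
    using lim by eventually_elim (rule LIMSEQ_ignore_initial_segment)
  moreover have "energy (\<lambda>x. v (r (n + N)) x - w x) \<le> 1" for n
  proof -
    have "N \<le> r (n + N)" using r_ge[of "n + N"] by linarith
    then have "energy (\<lambda>x. w x - v (r (n + N)) x) \<le> 1"
      by (rule near1[THEN conjunct2, THEN conjunct2])
    then show ?thesis by (simp only: energy_diff_commute)
  qed
  ultimately show thesis by (rule that)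
qed

text \<open>
  The oscillation at scale \<open>r\<close> is at most a constant times \<open>r\<^sup>n r\<^sup>2\<^sup>s\<close>, which is a small multiple
  of the volume of the ball since \<open>s > 0\<close>. The limit has finite energy; that it is a limit of test
  functions is obtained later, from strong convergence.
\<close>

lemma Rellich:
  assumes v: "\<And>n. v n \<in> U\<^sub>0" and bound: "\<And>n. energy (v n) \<le> K"
  obtains w r where "w \<in> U" "strict_mono (r::nat\<Rightarrow>nat)" "AE x in MD. (\<lambda>n. v (r n) x) \<longlonglongrightarrow> w x"
proof -
  obtain C where C: "C > 0" "\<And>u. u \<in> U\<^sub>0 \<Longrightarrow> (LINT x|MD. (u x)\<^sup>2) \<le> C * energy u"
    using Poincare by blast
  have vU: "v n \<in> U" for n using v by (rule U0_subset_U)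
  have diffU: "(\<lambda>x. v i x - v j x) \<in> U" for i j using vU vU by (rule U_diff)
  have K: "0 \<le> K" using bound[of 0] energy_nonneg[of "v 0"] by linarith
  have "\<exists>h. h \<in> borel_measurable borel \<and> (AE x in MD. v n x = h x) \<and> (\<forall>x. x \<notin> \<Omega> \<longrightarrow> h x = 0)" for n
    using U0_borel_representative[OF v[of n]] by metis
  then obtain h where h: "\<And>n. h n \<in> borel_measurable borel" "\<And>n. AE x in MD. v n x = h n x" "\<And>n x. x \<notin> \<Omega> \<Longrightarrow> h n x = 0"
    by metis
  have diff_eq: "AE x in MD. v i x - v j x = h i x - h j x" for i j
    using h(2)[of i] h(2)[of j] by eventually_elim simp
  have rep: "(LINT x|MD. (v n x)\<^sup>2) = (LINT x|lborel. (h n x)\<^sup>2)" "integrable lborel (\<lambda>x. (h n x)\<^sup>2)" for n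
  proof -
    have *: "(\<lambda>x. (v n x)\<^sup>2) \<in> borel_measurable MD" "(\<lambda>x. (h n x)\<^sup>2) \<in> borel_measurable borel"
      "AE x in MD. (v n x)\<^sup>2 = (h n x)\<^sup>2"
      using U_L2[OF vU[of n]] h(1)[of n] h(2)[of n] by (auto elim!: eventually_mono)
    show "(LINT x|MD. (v n x)\<^sup>2) = (LINT x|lborel. (h n x)\<^sup>2)" "integrable lborel (\<lambda>x. (h n x)\<^sup>2)"
      using integral_MD_eq_borel_representative[OF *] h(3) U_L2[OF vU[of n]] by auto
  qed
  have rep_diff: "(LINT x|MD. (v i x - v j x)\<^sup>2) = (LINT x|lborel. (h i x - h j x)\<^sup>2)" for i j
  proof (rule integral_MD_eq_borel_representative(1))
    show "(\<lambda>x. (v i x - v j x)\<^sup>2) \<in> borel_measurable MD" using U_L2[OF diffU] by auto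
    show "(\<lambda>x. (h i x - h j x)\<^sup>2) \<in> borel_measurable borel" using h(1) by simp
    show "AE x in MD. (v i x - v j x)\<^sup>2 = (h i x - h j x)\<^sup>2" using diff_eq[of i j] by eventually_elim simp
  qed (simp add: h(3))
  have L2: "(LINT x|lborel. (h n x)\<^sup>2) \<le> C * K" for n
    using C(2)[OF v[of n]] mult_left_mono[OF bound[of n], of C] C(1) unfolding rep(1) by linarith
  have energy_diff: "energy (\<lambda>x. v i x - v j x) \<le> 4 * K" for i j
    using energy_sum_le[OF vU vU, of i "- 1" j] bound[of i] bound[of j] by simp
  have osc: "\<exists>r>0. \<forall>i j. local_oscillation r (\<lambda>x. h i x - h j x) \<le> ennreal (\<epsilon> * measure lborel (ball (0::real^'n) r))"
    if \<epsilon>: "\<epsilon> > 0" for \<epsilon>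
  proof -
    define \<beta> where "\<beta> = measure lborel (ball (0::real^'n) 1)"
    have \<beta>: "\<beta> > 0" using content_ball_pos[of 1 "0::real^'n"] by (simp add: \<beta>_def)
    define B where "B = 4 * K / c\<^sub>0 + 1"
    have B: "B > 0" "4 * K / c\<^sub>0 \<le> B" using K c0_pos by (auto simp: B_def add_nonneg_pos)
    \<comment> \<open>the exponent makes \<open>r powr (2 * s) * B\<close> at most \<open>\<epsilon> * \<beta>\<close>\<close>
    define r where "r = min (\<delta> / 2) ((\<epsilon> * \<beta> / B) powr (1 / (2 * s)))"
    have r: "0 < r" "r \<le> \<delta> / 2" using \<delta>_pos \<epsilon> \<beta> B by (auto simp: r_def)
    have "r powr (2 * s) \<le> ((\<epsilon> * \<beta> / B) powr (1 / (2 * s))) powr (2 * s)"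
      using r(1) s_pos by (intro powr_mono2) (auto simp: r_def)
    also have "\<dots> = \<epsilon> * \<beta> / B" using s_pos \<epsilon> \<beta> B by (simp add: powr_powr)
    finally have r_s: "r powr (2 * s) * B \<le> \<epsilon> * \<beta>" using B by (simp add: field_simps)
    have ball_r: "measure lborel (ball (0::real^'n) r) = r ^ CARD('n) * \<beta>"
      using content_ball_conv_unit_ball[of r "0::real^'n"] r(1) by (simp add: \<beta>_def)
    have "r powr (real CARD('n) + 2 * s) / c\<^sub>0 * e \<le> \<epsilon> * measure lborel (ball (0::real^'n) r)"
      if e: "0 \<le> e" "e \<le> 4 * K" for e
    proof -
      have "r powr (real CARD('n) + 2 * s) = r ^ CARD('n) * r powr (2 * s)"
        using r(1) by (simp add: powr_add powr_realpow)
      then have "r powr (real CARD('n) + 2 * s) / c\<^sub>0 * e = r ^ CARD('n) * (r powr (2 * s) * (e / c\<^sub>0))" by simp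
      also have "e / c\<^sub>0 \<le> B" using e(2) c0_pos B(2) by (meson divide_right_mono less_imp_le order_trans)
      then have "r ^ CARD('n) * (r powr (2 * s) * (e / c\<^sub>0)) \<le> r ^ CARD('n) * (r powr (2 * s) * B)"
        using r(1) by (intro mult_left_mono) auto
      also have "\<dots> \<le> r ^ CARD('n) * (\<epsilon> * \<beta>)" using r_s r(1) by (intro mult_left_mono) auto
      finally show ?thesis by (simp add: ball_r mult.left_commute)
    qed
    moreover have "local_oscillation r (\<lambda>x. h i x - h j x) \<le> ennreal (r powr (real CARD('n) + 2 * s) / c\<^sub>0 * energy (\<lambda>x. v i x - v j x))" for i j
      using h(1) diff_eq h(3) r by (intro local_oscillation_le_energy[OF diffU]) auto
    ultimately have "local_oscillation r (\<lambda>x. h i x - h j x) \<le> ennreal (\<epsilon> * measure lborel (ball (0::real^'n) r))" for i j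
      using energy_diff energy_nonneg by (meson ennreal_leI order_trans)
    then show ?thesis using r(1) by blast
  qed
  obtain r1 where r1: "strict_mono (r1::nat\<Rightarrow>nat)"
    "\<And>\<epsilon>. \<epsilon> > 0 \<Longrightarrow> \<exists>N. \<forall>i\<ge>N. \<forall>j\<ge>N. (LINT x|lborel. (h (r1 i) x - h (r1 j) x)\<^sup>2) \<le> \<epsilon>"
    by (rule L2_Cauchy_subseq_of_small_oscillation[where h = h, OF open_dom bounded_dom h(1) h(3) rep(2) L2 osc]) blast+
  obtain r2 w where r2: "strict_mono (r2::nat\<Rightarrow>nat)" and w: "w \<in> borel_measurable MD"
    and lim: "AE x in MD. (\<lambda>n. v (r1 (r2 n)) x) \<longlonglongrightarrow> w x"
    by (rule AE_convergent_subseq_of_L2_Cauchy[where u = "\<lambda>n. v (r1 n)" and M = MD])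
      (use U_measurable[OF vU] U_L2[OF diffU] r1(2)[folded rep_diff] in blast)+
  have "w \<in> U"
  proof (rule AE_limit_energy_bounded(1)[where v = "\<lambda>n. v (r1 (r2 n))", OF vU w lim])
    show "(LINT x|MD. (v (r1 (r2 n)) x)\<^sup>2) \<le> C * K" for n using L2 by (simp only: rep(1))
    show "energy (v (r1 (r2 n))) \<le> K" for n by (rule bound)
  qed
  moreover have "strict_mono (\<lambda>n. r1 (r2 n))" using r1(1) r2 by (auto simp: strict_mono_def)
  ultimately show thesis using lim by (rule that)
qed

end

section \<open>The state equation and its stability\<close>

locale design_problem = nonlocal_energy \<Omega> A \<delta> s c\<^sub>0
  for \<Omega> :: "(real^'n) set" and A \<delta> s c\<^sub>0 +
  fixes f :: "real^'n \<Rightarrow> real" and \<rho>min \<rho>max \<gamma> :: real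
  assumes load: "f \<in> L2_on \<Omega>" and \<rho>min_pos: "0 < \<rho>min" and \<rho>min_less: "\<rho>min < \<gamma>" and less_\<rho>max: "\<gamma> < \<rho>max"
begin

abbreviation designs\<^sub>\<delta> where "designs\<^sub>\<delta> \<equiv> designs \<Omega> \<delta> \<rho>min \<rho>max \<gamma>"

definition form where
  "form \<rho> u v = (LINT z|MDD. \<rho> (fst z) * \<rho> (snd z) * dens u v z)"

lemma \<rho>max_pos: "0 < \<rho>max"
  using \<rho>min_pos \<rho>min_less less_\<rho>max by linarith

lemma design_measurable: "\<rho> \<in> designs\<^sub>\<delta> \<Longrightarrow> \<rho> \<in> borel_measurable MD"
  by (simp add: designs_def Linf_on_def)

lemma design_range: "\<rho> \<in> designs\<^sub>\<delta> \<Longrightarrow> AE x in MD. \<rho>min \<le> \<rho> x \<and> \<rho> x \<le> \<rho>max"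
  by (simp add: designs_def)

lemma design_abs_le:
  assumes "\<rho> \<in> designs\<^sub>\<delta>"
  shows "AE x in MD. \<bar>\<rho> x\<bar> \<le> \<rho>max"
  using design_range[OF assms] by eventually_elim (use \<rho>min_pos in auto)

lemma weight_measurable:
  assumes "\<rho> \<in> designs\<^sub>\<delta>"
  shows "(\<lambda>z. \<rho> (fst z) * \<rho> (snd z)) \<in> borel_measurable MDD"
  using borel_measurable_lebesgue_on_Times_fst[OF borel_D design_measurable[OF assms]]
    borel_measurable_lebesgue_on_Times_snd[OF borel_D design_measurable[OF assms]]
  by (rule borel_measurable_times)

lemma weight_range:
  assumes "\<rho> \<in> designs\<^sub>\<delta>"
  shows "AE z in MDD. \<rho>min\<^sup>2 \<le> \<rho> (fst z) * \<rho> (snd z) \<and> \<rho> (fst z) * \<rho> (snd z) \<le> \<rho>max\<^sup>2"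
  using AE_lebesgue_on_Times_fst[OF borel_D borel_D design_range[OF assms]]
    AE_lebesgue_on_Times_snd[OF borel_D borel_D design_range[OF assms]]
proof eventually_elim
  case (elim z)
  then show ?case
    unfolding power2_eq_square using \<rho>min_pos by (intro conjI mult_mono) auto
qed

lemma weighted_integrable:
  assumes \<rho>: "\<rho> \<in> designs\<^sub>\<delta>" and g: "integrable MDD g"
  shows "integrable MDD (\<lambda>z. \<rho> (fst z) * \<rho> (snd z) * g z)"
    "\<bar>LINT z|MDD. \<rho> (fst z) * \<rho> (snd z) * g z\<bar> \<le> \<rho>max\<^sup>2 * (LINT z|MDD. \<bar>g z\<bar>)"
proof -
  have ae: "AE z in MDD. norm (\<rho> (fst z) * \<rho> (snd z) * g z) \<le> \<rho>max\<^sup>2 * \<bar>g z\<bar>"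
    using weight_range[OF \<rho>]
  proof eventually_elim
    case (elim z)
    have "0 \<le> \<rho>min\<^sup>2" by simp
    then have "\<bar>\<rho> (fst z) * \<rho> (snd z)\<bar> \<le> \<rho>max\<^sup>2" using elim by linarith
    then show ?case unfolding real_norm_def abs_mult[of _ "g z"] by (rule mult_right_mono) simp
  qed
  have bd: "integrable MDD (\<lambda>z. \<rho>max\<^sup>2 * \<bar>g z\<bar>)" using g by simp
  show int: "integrable MDD (\<lambda>z. \<rho> (fst z) * \<rho> (snd z) * g z)"
  proof (rule Bochner_Integration.integrable_bound[OF bd])
    show "(\<lambda>z. \<rho> (fst z) * \<rho> (snd z) * g z) \<in> borel_measurable MDD"
      using weight_measurable[OF \<rho>] borel_measurable_integrable[OF g] by (rule borel_measurable_times)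
    show "AE z in MDD. norm (\<rho> (fst z) * \<rho> (snd z) * g z) \<le> norm (\<rho>max\<^sup>2 * \<bar>g z\<bar>)"
      using ae by eventually_elim simp
  qed
  have "\<bar>LINT z|MDD. \<rho> (fst z) * \<rho> (snd z) * g z\<bar> \<le> (LINT z|MDD. norm (\<rho> (fst z) * \<rho> (snd z) * g z))"
    using integral_norm_bound[of MDD "\<lambda>z. \<rho> (fst z) * \<rho> (snd z) * g z"] by simp
  also have "\<dots> \<le> (LINT z|MDD. \<rho>max\<^sup>2 * \<bar>g z\<bar>)"
    using int bd ae by (intro integral_mono_AE integrable_norm)
  finally show "\<bar>LINT z|MDD. \<rho> (fst z) * \<rho> (snd z) * g z\<bar> \<le> \<rho>max\<^sup>2 * (LINT z|MDD. \<bar>g z\<bar>)" by simp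
qed

lemma form_integrable:
  "\<rho> \<in> designs\<^sub>\<delta> \<Longrightarrow> u \<in> U \<Longrightarrow> v \<in> U \<Longrightarrow> integrable MDD (\<lambda>z. \<rho> (fst z) * \<rho> (snd z) * dens u v z)"
  by (intro weighted_integrable dens_integrable)

lemma nl_form_eq_form:
  assumes \<rho>: "\<rho> \<in> designs\<^sub>\<delta>" and u: "u \<in> U" and v: "v \<in> U"
  shows "nl_form \<Omega> A \<delta> (\<lambda>x x'. \<rho> x powr (2/2) * \<rho> x' powr (2/2)) u v = form \<rho> u v"
proof -
  let ?l = "\<lambda>z. \<rho> (fst z) powr 1 * \<rho> (snd z) powr 1 * dens u v z"
  have eq: "nl_integrand A \<delta> (\<lambda>x x'. \<rho> x powr (2/2) * \<rho> x' powr (2/2)) u v z = ?l z" for z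
    by (cases z) (simp add: nl_integrand_def mult.assoc)
  have "integral\<^sup>L MDD ?l = form \<rho> u v"
    unfolding form_def
  proof (rule integral_cong_AE)
    show "?l \<in> borel_measurable MDD"
      using borel_measurable_lebesgue_on_Times_fst[OF borel_D design_measurable[OF \<rho>]]
        borel_measurable_lebesgue_on_Times_snd[OF borel_D design_measurable[OF \<rho>]]
        borel_measurable_integrable[OF dens_integrable[OF u v]]
      by (intro borel_measurable_times powr_real_measurable borel_measurable_const)
    show "(\<lambda>z. \<rho> (fst z) * \<rho> (snd z) * dens u v z) \<in> borel_measurable MDD"
      using form_integrable[OF \<rho> u v] by (rule borel_measurable_integrable)
    show "AE z in MDD. ?l z = \<rho> (fst z) * \<rho> (snd z) * dens u v z"
      using AE_lebesgue_on_Times_fst[OF borel_D borel_D design_range[OF \<rho>]]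
        AE_lebesgue_on_Times_snd[OF borel_D borel_D design_range[OF \<rho>]]
      by eventually_elim (use \<rho>min_pos in auto)
  qed
  then show ?thesis by (simp only: nl_form_def eq)
qed

lemma form_sym: "form \<rho> u v = form \<rho> v u"
  unfolding form_def by (subst dens_sym) (rule refl)

lemma form_linear:
  assumes "\<rho> \<in> designs\<^sub>\<delta>" "u \<in> U" "v \<in> U" "w \<in> U"
  shows "form \<rho> (\<lambda>x. u x + t * v x) w = form \<rho> u w + t * form \<rho> v w"
proof -
  have "\<rho> (fst z) * \<rho> (snd z) * dens (\<lambda>x. u x + t * v x) w z =
    \<rho> (fst z) * \<rho> (snd z) * dens u w z + t * (\<rho> (fst z) * \<rho> (snd z) * dens v w z)" for z
    unfolding dens_linear by (simp add: algebra_simps)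
  then show ?thesis
    unfolding form_def using form_integrable[OF assms(1)] assms by simp
qed

lemma form_coercive:
  assumes \<rho>: "\<rho> \<in> designs\<^sub>\<delta>" and u: "u \<in> U"
  shows "\<rho>min\<^sup>2 * energy u \<le> form \<rho> u u"
proof -
  have "(LINT z|MDD. \<rho>min\<^sup>2 * dens u u z) \<le> form \<rho> u u"
    unfolding form_def
  proof (rule integral_mono_AE)
    show "integrable MDD (\<lambda>z. \<rho>min\<^sup>2 * dens u u z)" using U_energy[OF u] by simp
    show "integrable MDD (\<lambda>z. \<rho> (fst z) * \<rho> (snd z) * dens u u z)" using \<rho> u u by (rule form_integrable)
    show "AE z in MDD. \<rho>min\<^sup>2 * dens u u z \<le> \<rho> (fst z) * \<rho> (snd z) * dens u u z"
      using weight_range[OF \<rho>] by eventually_elim (intro mult_right_mono dens_nonneg, simp)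
  qed
  then show ?thesis by (simp add: energy_eq)
qed

lemma form_diff_square:
  assumes \<rho>: "\<rho> \<in> designs\<^sub>\<delta>" and u: "u \<in> U" and v: "v \<in> U"
  shows "form \<rho> (\<lambda>x. u x - v x) (\<lambda>x. u x - v x) = form \<rho> u u - 2 * form \<rho> u v + form \<rho> v v"
proof -
  have d: "(\<lambda>x. u x - v x) \<in> U" using u v by (rule U_diff)
  have l: "form \<rho> (\<lambda>x. u x - v x) w = form \<rho> u w - form \<rho> v w" if "w \<in> U" for w
    using form_linear[OF \<rho> u v that, of "- 1"] by simp
  show ?thesis
    using l[OF d] l[OF u] l[OF v] form_sym[of \<rho> u "\<lambda>x. u x - v x"] form_sym[of \<rho> v "\<lambda>x. u x - v x"] form_sym[of \<rho> v u]
    by linarith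
qed

text \<open>
  The difference of \<open>form (R n) (v n) g\<close> and \<open>form (R n) w g\<close> tends to \<open>0\<close> since the weights are bounded and
  the integrands converge in \<open>L\<^sup>1\<close>; the second term converges by weak-star convergence of the weights.
\<close>

lemma form_limit:
  assumes R: "\<And>n. R n \<in> designs\<^sub>\<delta>" and \<rho>: "\<rho> \<in> designs\<^sub>\<delta>" and weak: "weak_star_Linf_tendsto D R \<rho>"
    and v: "\<And>n. v n \<in> U" and w: "w \<in> U" and g: "g \<in> U"
    and lim: "AE x in MD. (\<lambda>n. v n x) \<longlonglongrightarrow> w x"
    and bound: "\<And>n. energy (\<lambda>x. v n x - w x) \<le> K"
  shows "(\<lambda>n. form (R n) (v n) g) \<longlonglongrightarrow> form \<rho> w g"
proof -
  have 1: "(\<lambda>n. form (R n) w g) \<longlonglongrightarrow> form \<rho> w g"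
    unfolding form_def
  proof (rule weak_star_tendsto_tensor_square[OF borel_D _ _ _ _ weak])
    show "integrable MDD (dens w g)" using w g by (rule dens_integrable)
    show "0 \<le> \<rho>max" using \<rho>max_pos by simp
  qed (use R \<rho> in \<open>simp_all add: design_measurable design_abs_le\<close>)
  have "(\<lambda>n. form (R n) (v n) g - form (R n) w g) \<longlonglongrightarrow> 0"
  proof (rule Lim_null_comparison)
    have "(\<lambda>n. \<rho>max\<^sup>2 * (LINT z|MDD. \<bar>dens (v n) g z - dens w g z\<bar>)) \<longlonglongrightarrow> \<rho>max\<^sup>2 * 0"
      by (intro tendsto_mult_left dens_product_limit[OF v w g lim bound])
    then show "(\<lambda>n. \<rho>max\<^sup>2 * (LINT z|MDD. \<bar>dens (v n) g z - dens w g z\<bar>)) \<longlonglongrightarrow> 0" by simp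
    have "norm (form (R n) (v n) g - form (R n) w g) \<le> \<rho>max\<^sup>2 * (LINT z|MDD. \<bar>dens (v n) g z - dens w g z\<bar>)" for n
    proof -
      have "form (R n) (v n) g - form (R n) w g = (LINT z|MDD. R n (fst z) * R n (snd z) * (dens (v n) g z - dens w g z))"
        unfolding form_def right_diff_distrib
        by (rule Bochner_Integration.integral_diff[symmetric]) (intro form_integrable R v w g)+
      then show ?thesis
        using weighted_integrable(2)[OF R[of n], of "\<lambda>z. dens (v n) g z - dens w g z"]
          dens_integrable[OF v[of n] g] dens_integrable[OF w g] by simp
    qed
    then show "\<forall>\<^sub>F n in sequentially. norm (form (R n) (v n) g - form (R n) w g) \<le> \<rho>max\<^sup>2 * (LINT z|MDD. \<bar>dens (v n) g z - dens w g z\<bar>)"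
      by simp
  qed
  from tendsto_add[OF this 1] show ?thesis by simp
qed

abbreviation load_functional where "load_functional \<equiv> lin_fun \<Omega> f"

lemma AE_dom: "(AE x in MD. P x) \<Longrightarrow> (AE x in lebesgue_on \<Omega>. P x)"
  using open_dom subset_D lebesgue_D
  by (auto simp: AE_restrict_space_iff elim!: eventually_mono)

lemma integrable_dom:
  fixes g :: "real^'n \<Rightarrow> real"
  assumes "integrable MD g"
  shows "integrable (lebesgue_on \<Omega>) g"
    and integral_dom: "(LINT x|lebesgue_on \<Omega>. g x) = (LINT x|MD. indicat_real \<Omega> x * g x)"
proof -
  have dom: "\<Omega> \<inter> space lebesgue \<in> sets lebesgue" and DD: "D \<inter> space lebesgue \<in> sets lebesgue"
    using open_dom lebesgue_D by auto
  have "integrable lebesgue (\<lambda>x. indicat_real D x * g x)"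
    using assms by (simp add: integrable_restrict_space[OF DD])
  then have "integrable lebesgue (\<lambda>x. indicat_real \<Omega> x * (indicat_real D x * g x))"
    using dom by (intro integrable_indicat_mult[where f = "\<lambda>x. indicat_real D x * g x"]) auto
  moreover have "indicat_real \<Omega> x * (indicat_real D x * g x) = indicat_real \<Omega> x * g x" for x
    using subset_D by (auto split: split_indicator)
  ultimately show "integrable (lebesgue_on \<Omega>) g" by (simp add: integrable_restrict_space[OF dom])
  have "(\<lambda>x. indicat_real D x * (indicat_real \<Omega> x * g x)) = (\<lambda>x. indicat_real \<Omega> x * g x)"
    using subset_D by (auto simp: fun_eq_iff split: split_indicator)
  then show "(LINT x|lebesgue_on \<Omega>. g x) = (LINT x|MD. indicat_real \<Omega> x * g x)"
    by (simp only: integral_restrict_space[OF dom] integral_restrict_space[OF DD] real_scaleR_def)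
qed

lemma integral_square_dom_le:
  assumes "u \<in> U"
  shows "(LINT x|lebesgue_on \<Omega>. (u x)\<^sup>2) \<le> (LINT x|MD. (u x)\<^sup>2)"
proof -
  have "\<Omega> \<in> sets MD" using open_dom subset_D by (auto simp: sets_restrict_space)
  then show ?thesis
    unfolding integral_dom[OF U_L2[OF assms]]
    using U_L2[OF assms] by (intro integral_mono integrable_indicat_mult) (auto split: split_indicator)
qed

lemma load_measurable: "f \<in> borel_measurable (lebesgue_on \<Omega>)"
  and load_square: "integrable (lebesgue_on \<Omega>) (\<lambda>x. (f x)\<^sup>2)"
  using load by (auto simp: L2_on_def)

lemma measurable_dom: "u \<in> U \<Longrightarrow> u \<in> borel_measurable (lebesgue_on \<Omega>)"
  using U_measurable subset_D by (rule measurable_restrict_mono)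

lemma load_abs_le:
  assumes \<eta>: "\<eta> > 0"
  shows "\<bar>f x * u x\<bar> \<le> \<eta> * (u x)\<^sup>2 + (f x)\<^sup>2 / (4 * \<eta>)"
  using \<eta> by (intro abs_le_of_square_le_mult) (auto simp: power_mult_distrib mult.commute)

lemma load_integrable:
  assumes u: "u \<in> U"
  shows "integrable (lebesgue_on \<Omega>) (\<lambda>x. f x * u x)"
proof (rule Bochner_Integration.integrable_bound)
  show "integrable (lebesgue_on \<Omega>) (\<lambda>x. 1 * (u x)\<^sup>2 + (f x)\<^sup>2 / (4 * 1))"
    using integrable_dom[OF U_L2[OF u]] load_square by simp
  show "(\<lambda>x. f x * u x) \<in> borel_measurable (lebesgue_on \<Omega>)"
    using load_measurable measurable_dom[OF u] by (rule borel_measurable_times)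
  show "AE x in lebesgue_on \<Omega>. norm (f x * u x) \<le> norm (1 * (u x)\<^sup>2 + (f x)\<^sup>2 / (4 * 1))"
  proof (rule AE_I2)
    fix x
    show "norm (f x * u x) \<le> norm (1 * (u x)\<^sup>2 + (f x)\<^sup>2 / (4 * 1))"
      using load_abs_le[of 1 x u] by simp
  qed
qed

lemma load_functional_linear:
  assumes "u \<in> U" "v \<in> U"
  shows "load_functional (\<lambda>x. u x + t * v x) = load_functional u + t * load_functional v"
proof -
  have "f x * (u x + t * v x) = f x * u x + t * (f x * v x)" for x by (simp add: algebra_simps)
  then show ?thesis using load_integrable assms by (simp add: lin_fun_def)
qed

text \<open>
  Young's inequality with the parameter \<open>\<eta>\<close> such that the Poincare constant is absorbed into half
  of the coercivity constant.
\<close>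

lemma load_functional_bound:
  obtains K where "\<And>u. u \<in> U\<^sub>0 \<Longrightarrow> 2 * \<bar>load_functional u\<bar> \<le> \<rho>min\<^sup>2 * energy u + K"
proof -
  obtain C where C: "C > 0" "\<And>u. u \<in> U\<^sub>0 \<Longrightarrow> (LINT x|MD. (u x)\<^sup>2) \<le> C * energy u"
    using Poincare by blast
  define \<eta> where "\<eta> = \<rho>min\<^sup>2 / (2 * C)"
  have \<eta>: "\<eta> > 0" "2 * \<eta> * C = \<rho>min\<^sup>2" using C(1) \<rho>min_pos by (auto simp: \<eta>_def)
  define F where "F = (LINT x|lebesgue_on \<Omega>. (f x)\<^sup>2)"
  have "2 * \<bar>load_functional u\<bar> \<le> \<rho>min\<^sup>2 * energy u + F / (2 * \<eta>)" if u: "u \<in> U\<^sub>0" for u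
  proof -
    have uU: "u \<in> U" using u by (rule U0_subset_U)
    have i: "integrable (lebesgue_on \<Omega>) (\<lambda>x. \<eta> * (u x)\<^sup>2 + (f x)\<^sup>2 / (4 * \<eta>))"
      using integrable_dom[OF U_L2[OF uU]] load_square by simp
    have "\<bar>load_functional u\<bar> \<le> (LINT x|lebesgue_on \<Omega>. \<bar>f x * u x\<bar>)"
      unfolding lin_fun_def using integral_norm_bound[of "lebesgue_on \<Omega>" "\<lambda>x. f x * u x"] by simp
    also have "\<dots> \<le> (LINT x|lebesgue_on \<Omega>. \<eta> * (u x)\<^sup>2 + (f x)\<^sup>2 / (4 * \<eta>))"
      using load_integrable[OF uU] i load_abs_le[OF \<eta>(1)] by (intro integral_mono) auto
    also have "\<dots> = \<eta> * (LINT x|lebesgue_on \<Omega>. (u x)\<^sup>2) + F / (4 * \<eta>)"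
      using integrable_dom[OF U_L2[OF uU]] load_square by (simp add: F_def)
    also have "\<dots> \<le> \<eta> * (C * energy u) + F / (4 * \<eta>)"
      using integral_square_dom_le[OF uU] C(2)[OF u] \<eta>(1) by (intro add_right_mono mult_left_mono) auto
    finally have "2 * \<bar>load_functional u\<bar> \<le> 2 * \<eta> * C * energy u + F / (2 * \<eta>)"
      by (simp add: mult.assoc field_simps)
    then show ?thesis unfolding \<eta>(2) .
  qed
  then show thesis by (rule that)
qed

lemma load_functional_limit:
  assumes v: "\<And>n. v n \<in> U" and w: "w \<in> U" and lim: "AE x in MD. (\<lambda>n. v n x) \<longlonglongrightarrow> w x"
    and bound: "\<And>n. (LINT x|MD. (v n x - w x)\<^sup>2) \<le> K"
  shows "(\<lambda>n. load_functional (v n)) \<longlonglongrightarrow> load_functional w"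
proof -
  have d: "(\<lambda>x. v n x - w x) \<in> U" for n using v w by (rule U_diff)
  have 0: "(\<lambda>n. LINT x|lebesgue_on \<Omega>. \<bar>f x * (v n x - w x)\<bar>) \<longlonglongrightarrow> 0"
  proof (rule integral_abs_tendsto_0_of_square_le(2))
    show "(\<lambda>x. f x * (v n x - w x)) \<in> borel_measurable (lebesgue_on \<Omega>)" for n
      using load_measurable measurable_dom[OF d] by (rule borel_measurable_times)
    show "integrable (lebesgue_on \<Omega>) (\<lambda>x. (v n x - w x)\<^sup>2)" for n
      using U_L2[OF d] by (rule integrable_dom)
    show "(LINT x|lebesgue_on \<Omega>. (v n x - w x)\<^sup>2) \<le> K" for n
      using integral_square_dom_le[OF d] bound by (rule order_trans)
    show "AE x in lebesgue_on \<Omega>. (f x * (v n x - w x))\<^sup>2 \<le> (v n x - w x)\<^sup>2 * (f x)\<^sup>2" for n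
      by (simp add: power_mult_distrib)
    show "AE x in lebesgue_on \<Omega>. (\<lambda>n. (v n x - w x)\<^sup>2) \<longlonglongrightarrow> 0"
      using AE_dom[OF lim] by eventually_elim (intro tendsto_null_power LIM_zero, auto)
  qed (simp_all add: load_square)
  have "(\<lambda>n. load_functional (v n) - load_functional w) \<longlonglongrightarrow> 0"
  proof (rule Lim_null_comparison[OF always_eventually 0], rule allI)
    fix n
    have "load_functional (v n) - load_functional w = (LINT x|lebesgue_on \<Omega>. f x * (v n x - w x))"
      using load_functional_linear[OF v w, of n "- 1"] by (simp add: lin_fun_def)
    then show "norm (load_functional (v n) - load_functional w) \<le> (LINT x|lebesgue_on \<Omega>. \<bar>f x * (v n x - w x)\<bar>)"
      using integral_norm_bound[of "lebesgue_on \<Omega>" "\<lambda>x. f x * (v n x - w x)"] by simp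
  qed
  then show ?thesis by (simp only: LIM_zero_iff)
qed

abbreviation feasible_pair where "feasible_pair \<equiv> feasible \<Omega> A \<delta> \<rho>min \<rho>max \<gamma> 2 f"

lemma feasible_pair_iff:
  "feasible_pair \<rho> u \<longleftrightarrow> \<rho> \<in> designs\<^sub>\<delta> \<and> u \<in> U\<^sub>0 \<and> (\<forall>v\<in>U\<^sub>0. form \<rho> u v = load_functional v)"
  unfolding feasible_def using nl_form_eq_form U0_subset_U by metis

lemma const_design: "(\<lambda>x. \<rho>min) \<in> designs\<^sub>\<delta>"
proof -
  have "(LINT x|lebesgue_on \<Omega>. \<rho>min) = \<rho>min * measure lebesgue \<Omega>"
    using open_dom by (simp add: measure_restrict_space mult.commute)
  also have "\<dots> \<le> \<gamma> * measure lebesgue \<Omega>" using \<rho>min_less by (intro mult_right_mono) auto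
  finally show ?thesis
    using \<rho>min_less less_\<rho>max by (auto simp: designs_def Linf_on_def)
qed

text \<open>
  Coercivity makes a Cauchy sequence for the form a Cauchy sequence for the energy, so the space of states
  is complete for the form of any design, and the Riesz representation theorem applies.
\<close>

lemma ex_state:
  assumes \<rho>: "\<rho> \<in> designs\<^sub>\<delta>"
  shows "\<exists>u. feasible_pair \<rho> u"
proof -
  obtain K where K: "\<And>u. u \<in> U\<^sub>0 \<Longrightarrow> 2 * \<bar>load_functional u\<bar> \<le> \<rho>min\<^sup>2 * energy u + K"
    using load_functional_bound by blast
  have "\<exists>u\<in>U\<^sub>0. \<forall>v\<in>U\<^sub>0. form \<rho> u v = load_functional v"
  proof (rule Riesz_representation)
    show "U\<^sub>0 \<noteq> {}" using zero_in_U0 by blast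
    show "(\<lambda>x. u x + t * v x) \<in> U\<^sub>0" if "u \<in> U\<^sub>0" "v \<in> U\<^sub>0" for u v t
      using that by (rule U0_linear_combination)
    show "form \<rho> u v = form \<rho> v u" for u v by (rule form_sym)
    show "form \<rho> (\<lambda>x. u x + t * v x) w = form \<rho> u w + t * form \<rho> v w" if "u \<in> U\<^sub>0" "v \<in> U\<^sub>0" "w \<in> U\<^sub>0" for u v w t
      using \<rho> that[THEN U0_subset_U] by (rule form_linear)
    have coercive: "\<rho>min\<^sup>2 * energy u \<le> form \<rho> u u" if "u \<in> U\<^sub>0" for u
      using \<rho> U0_subset_U[OF that] by (rule form_coercive)
    have "0 \<le> \<rho>min\<^sup>2 * energy u" for u using energy_nonneg[of u] by simp
    then show "0 \<le> form \<rho> u u" if "u \<in> U\<^sub>0" for u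
      using coercive[OF that] by (rule order_trans)
    show "load_functional (\<lambda>x. u x + t * v x) = load_functional u + t * load_functional v" if "u \<in> U\<^sub>0" "v \<in> U\<^sub>0" for u v t
      using that[THEN U0_subset_U] by (rule load_functional_linear)
    show "2 * load_functional u \<le> form \<rho> u u + K" if "u \<in> U\<^sub>0" for u
      using K[OF that] coercive[OF that] by linarith
    fix v :: "nat \<Rightarrow> real^'n \<Rightarrow> real"
    assume v: "\<And>n. v n \<in> U\<^sub>0"
      and Cauchy: "\<And>\<epsilon>. \<epsilon> > 0 \<Longrightarrow> \<exists>N. \<forall>i\<ge>N. \<forall>j\<ge>N. form \<rho> (\<lambda>x. v i x + (- 1) * v j x) (\<lambda>x. v i x + (- 1) * v j x) \<le> \<epsilon>"
    have "\<exists>N. \<forall>i\<ge>N. \<forall>j\<ge>N. energy (\<lambda>x. v i x - v j x) \<le> \<epsilon>" if \<epsilon>: "\<epsilon> > 0" for \<epsilon>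
    proof -
      have "\<rho>min\<^sup>2 * \<epsilon> > 0" using \<epsilon> \<rho>min_pos by simp
      from Cauchy[OF this] obtain N where
        N: "\<And>i j. i \<ge> N \<Longrightarrow> j \<ge> N \<Longrightarrow> form \<rho> (\<lambda>x. v i x - v j x) (\<lambda>x. v i x - v j x) \<le> \<rho>min\<^sup>2 * \<epsilon>" by auto
      have "energy (\<lambda>x. v i x - v j x) \<le> \<epsilon>" if "i \<ge> N" "j \<ge> N" for i j
      proof -
        have "\<rho>min\<^sup>2 * energy (\<lambda>x. v i x - v j x) \<le> \<rho>min\<^sup>2 * \<epsilon>"
          using coercive[OF U0_diff[OF v v]] N[OF that] by (rule order_trans)
        then show ?thesis using \<rho>min_pos by simp
      qed
      then show ?thesis by blast
    qed
    from energy_Cauchy_has_limit[OF v this] obtain w r where w: "w \<in> U\<^sub>0" and r: "strict_mono (r::nat\<Rightarrow>nat)"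
      and lim: "AE x in MD. (\<lambda>n. v (r n) x) \<longlonglongrightarrow> w x" and bound: "\<And>n. energy (\<lambda>x. v (r n) x - w x) \<le> 1"
      by blast
    have "(\<lambda>n. form \<rho> (v (r n)) g) \<longlonglongrightarrow> form \<rho> w g" if g: "g \<in> U\<^sub>0" for g
      by (rule form_limit[where R = "\<lambda>_. \<rho>", OF \<rho> \<rho> _ U0_subset_U[OF v] U0_subset_U[OF w] U0_subset_U[OF g] lim bound])
        (simp add: weak_star_Linf_tendsto_def)
    then show "\<exists>w\<in>U\<^sub>0. \<exists>r::nat\<Rightarrow>nat. strict_mono r \<and> (\<forall>g\<in>U\<^sub>0. (\<lambda>n. form \<rho> (v (r n)) g) \<longlonglongrightarrow> form \<rho> w g)"
      using w r by blast
  qed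
  then show ?thesis using \<rho> by (auto simp: feasible_pair_iff)
qed

text \<open>
  Elements of the space are functions, not classes, so closure under changes on null sets has to be
  shown.
\<close>

lemma U0_cong_AE:
  assumes w: "w \<in> U\<^sub>0" and u: "u \<in> U" and eq: "AE x in MD. u x = w x"
  shows "u \<in> U\<^sub>0"
proof (rule U0_closed[OF u])
  fix \<epsilon> :: real assume "\<epsilon> > 0"
  have "(LINT x|MD. (u x - w x)\<^sup>2) = 0"
    by (rule integral_eq_zero_AE, use eq in eventually_elim) simp
  moreover have "energy (\<lambda>x. u x - w x) = 0"
    unfolding energy_eq
  proof (rule integral_eq_zero_AE)
    show "AE z in MDD. dens (\<lambda>x. u x - w x) (\<lambda>x. u x - w x) z = 0"
      using AE_lebesgue_on_Times_fst[OF borel_D borel_D eq] AE_lebesgue_on_Times_snd[OF borel_D borel_D eq]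
    proof eventually_elim
      case (elim z)
      then show ?case by (cases z) (simp add: dens_eq)
    qed
  qed
  ultimately show "\<exists>v\<in>U\<^sub>0. sq_norm (\<lambda>x. u x - v x) < \<epsilon>"
    using w \<open>\<epsilon> > 0\<close> by (intro bexI[of _ w]) (simp add: sq_norm_def)
qed

text \<open>
  The volume constraint is preserved because the indicator of \<open>\<Omega>\<close> is integrable.
\<close>

lemma design_limit:
  assumes R: "\<And>n. R n \<in> designs\<^sub>\<delta>" and \<rho>: "\<rho> \<in> borel_measurable MD"
    and range: "AE x in MD. \<rho>min \<le> \<rho> x \<and> \<rho> x \<le> \<rho>max" and weak: "weak_star_Linf_tendsto D R \<rho>"
  shows "\<rho> \<in> designs\<^sub>\<delta>"
proof -
  interpret finite_measure MD using lmeasurable_D by (rule finite_measure_lebesgue_on)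
  have dom: "\<Omega> \<in> sets MD" using open_dom subset_D by (auto simp: sets_restrict_space)
  have int: "integrable MD g" if "g \<in> borel_measurable MD" "AE x in MD. \<rho>min \<le> g x \<and> g x \<le> \<rho>max" for g
  proof (rule integrable_const_bound[where B = \<rho>max])
    show "AE x in MD. norm (g x) \<le> \<rho>max"
      using that(2) by eventually_elim (use \<rho>min_pos in auto)
  qed (rule that(1))
  have eq: "(LINT x|MD. g x * indicat_real \<Omega> x) = (LINT x|lebesgue_on \<Omega>. g x)"
    if "g \<in> borel_measurable MD" "AE x in MD. \<rho>min \<le> g x \<and> g x \<le> \<rho>max" for g
    using integral_dom[OF int[OF that]] by (simp only: mult.commute)
  have "integrable MD (\<lambda>x. indicat_real \<Omega> x * 1)" using dom by (rule integrable_indicat_mult) simp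
  then have "(\<lambda>n. LINT x|MD. R n x * indicat_real \<Omega> x) \<longlonglongrightarrow> (LINT x|MD. \<rho> x * indicat_real \<Omega> x)"
    using weak by (simp add: weak_star_Linf_tendsto_def)
  then have "(\<lambda>n. LINT x|lebesgue_on \<Omega>. R n x) \<longlonglongrightarrow> (LINT x|lebesgue_on \<Omega>. \<rho> x)"
    by (simp only: eq[OF \<rho> range] eq[OF design_measurable[OF R] design_range[OF R]])
  moreover have "(LINT x|lebesgue_on \<Omega>. R n x) \<le> \<gamma> * measure lebesgue \<Omega>" for n
    using R by (simp add: designs_def)
  ultimately have "(LINT x|lebesgue_on \<Omega>. \<rho> x) \<le> \<gamma> * measure lebesgue \<Omega>"
    by (intro LIMSEQ_le_const2) auto
  moreover have "AE x in MD. \<bar>\<rho> x\<bar> \<le> \<rho>max"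
    using range by eventually_elim (use \<rho>min_pos in auto)
  ultimately show ?thesis using \<rho> range by (auto simp: designs_def Linf_on_def)
qed

section \<open>Existence of an optimal design\<close>

lemma weak_star_subseq:
  "weak_star_Linf_tendsto S R \<rho> \<Longrightarrow> strict_mono r \<Longrightarrow> weak_star_Linf_tendsto S (\<lambda>n. R (r n)) \<rho>"
  unfolding weak_star_Linf_tendsto_def using LIMSEQ_subseq_LIMSEQ[unfolded o_def] by blast

text \<open>
  Weak-star compactness gives \<open>\<rho>\<close> and the Rellich theorem gives \<open>u\<close>, at first only as an almost everywhere
  limit of finite energy. The limit equation and the energy identity \<open>a(u, u) = L(u)\<close> then force strong
  convergence. Membership of \<open>u\<close> in the space of states comes last, from its completeness.
\<close>

theorem feasible_pairs_compact:
  assumes feas: "\<And>n. feasible_pair (R n) (V n)"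
  obtains \<rho> u r where "feasible_pair \<rho> u" "strict_mono (r::nat\<Rightarrow>nat)"
    "weak_star_Linf_tendsto D (\<lambda>n. R (r n)) \<rho>" "(\<lambda>n. energy (\<lambda>x. V (r n) x - u x)) \<longlonglongrightarrow> 0"
proof -
  have R: "R n \<in> designs\<^sub>\<delta>" and V: "V n \<in> U\<^sub>0" and state: "\<And>v. v \<in> U\<^sub>0 \<Longrightarrow> form (R n) (V n) v = load_functional v" for n
    using feas by (auto simp: feasible_pair_iff)
  obtain K where K: "\<And>u. u \<in> U\<^sub>0 \<Longrightarrow> 2 * \<bar>load_functional u\<bar> \<le> \<rho>min\<^sup>2 * energy u + K"
    using load_functional_bound by blast
  obtain C where C: "C > 0" "\<And>u. u \<in> U\<^sub>0 \<Longrightarrow> (LINT x|MD. (u x)\<^sup>2) \<le> C * energy u"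
    using Poincare by blast
  define E where "E = K / \<rho>min\<^sup>2"
  have E: "energy (V n) \<le> E" for n
  proof -
    have "\<rho>min\<^sup>2 * energy (V n) \<le> load_functional (V n)"
      using form_coercive[OF R U0_subset_U[OF V], of n n] state[OF V] by simp
    then have "\<rho>min\<^sup>2 * energy (V n) \<le> K" using K[OF V[of n]] by linarith
    then show ?thesis unfolding E_def using \<rho>min_pos by (simp add: pos_le_divide_eq mult.commute)
  qed
  obtain r1 \<rho> where r1: "strict_mono (r1::nat\<Rightarrow>nat)" and \<rho>_meas: "\<rho> \<in> borel_measurable MD"
    and \<rho>_range: "AE x in MD. \<rho>min \<le> \<rho> x \<and> \<rho> x \<le> \<rho>max" and weak1: "weak_star_Linf_tendsto D (\<lambda>n. R (r1 n)) \<rho>"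
    using weak_star_compactness[where f = R, OF lmeasurable_D design_measurable[OF R] design_range[OF R]] \<rho>min_pos by auto
  have \<rho>: "\<rho> \<in> designs\<^sub>\<delta>" using R \<rho>_meas \<rho>_range weak1 by (rule design_limit)
  obtain u r2 where u: "u \<in> U" and r2: "strict_mono (r2::nat\<Rightarrow>nat)" and lim: "AE x in MD. (\<lambda>n. V (r1 (r2 n)) x) \<longlonglongrightarrow> u x"
    using Rellich[where v = "\<lambda>n. V (r1 n)", OF V E] by blast
  define r where "r n = r1 (r2 n)" for n
  have r: "strict_mono r" using r1 r2 by (auto simp: strict_mono_def r_def)
  define v where "v n = V (r n)" for n
  define P where "P n = R (r n)" for n
  have P: "P n \<in> designs\<^sub>\<delta>" and v0: "v n \<in> U\<^sub>0" and st: "\<And>g. g \<in> U\<^sub>0 \<Longrightarrow> form (P n) (v n) g = load_functional g" for n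
    using R V state by (simp_all add: P_def v_def)
  have v: "v n \<in> U" for n using v0 by (rule U0_subset_U)
  have weak: "weak_star_Linf_tendsto D P \<rho>"
    using weak_star_subseq[OF weak1 r2] by (simp add: P_def[abs_def] r_def)
  have limv: "AE x in MD. (\<lambda>n. v n x) \<longlonglongrightarrow> u x" using lim by (simp add: v_def r_def)
  have E_diff: "energy (\<lambda>x. v n x - u x) \<le> 2 * E + 2 * energy u" for n
    using energy_sum_le[OF v u, of n "- 1"] E[of "r n"] by (simp add: v_def)
  have L2_diff: "(LINT x|MD. (v n x - u x)\<^sup>2) \<le> 2 * (C * E) + 2 * (LINT x|MD. (u x)\<^sup>2)" for n
  proof -
    have "(LINT x|MD. (v n x - u x)\<^sup>2) \<le> (LINT x|MD. 2 * (v n x)\<^sup>2 + 2 * (u x)\<^sup>2)"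
    proof (rule integral_mono)
      show "integrable MD (\<lambda>x. (v n x - u x)\<^sup>2)" using U_L2[OF U_diff[OF v u]] .
      show "integrable MD (\<lambda>x. 2 * (v n x)\<^sup>2 + 2 * (u x)\<^sup>2)" using U_L2[OF v] U_L2[OF u] by simp
      show "(v n x - u x)\<^sup>2 \<le> 2 * (v n x)\<^sup>2 + 2 * (u x)\<^sup>2" for x
        using square_sum_le[of "v n x" "- u x"] by simp
    qed
    also have "\<dots> = 2 * (LINT x|MD. (v n x)\<^sup>2) + 2 * (LINT x|MD. (u x)\<^sup>2)" using U_L2[OF v] U_L2[OF u] by simp
    also have "(LINT x|MD. (v n x)\<^sup>2) \<le> C * E"
      using C(2)[OF v0[of n]] mult_left_mono[OF E[of "r n"], of C] C(1) unfolding v_def by linarith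
    finally show ?thesis by simp
  qed
  note form_lim = form_limit[OF _ \<rho> _ v u _ limv E_diff]
  have const: "weak_star_Linf_tendsto D (\<lambda>_. \<rho>) \<rho>" by (simp add: weak_star_Linf_tendsto_def)
  have load_lim: "(\<lambda>n. load_functional (v n)) \<longlonglongrightarrow> load_functional u"
    using v u limv L2_diff by (rule load_functional_limit)
  have limit_state: "form \<rho> u g = load_functional g" if g: "g \<in> U\<^sub>0" for g
  proof -
    have "(\<lambda>n. form (P n) (v n) g) \<longlonglongrightarrow> form \<rho> u g" using P weak U0_subset_U[OF g] by (rule form_lim)
    then have "(\<lambda>n. load_functional g) \<longlonglongrightarrow> form \<rho> u g" by (simp only: st[OF g])
    then show ?thesis using tendsto_const by (rule LIMSEQ_unique)
  qed
  \<comment> \<open>the approximating states are admissible in the limit equation although \<open>u\<close> is not yet\<close>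
  have energy_identity: "form \<rho> u u = load_functional u"
  proof -
    have "(\<lambda>n. form \<rho> (v n) u) \<longlonglongrightarrow> form \<rho> u u" using \<rho> const u by (rule form_lim)
    moreover have "form \<rho> (v n) u = load_functional (v n)" for n
      using limit_state[OF v0] form_sym by simp
    ultimately have "(\<lambda>n. load_functional (v n)) \<longlonglongrightarrow> form \<rho> u u" by (simp only:)
    then show ?thesis using load_lim by (rule LIMSEQ_unique)
  qed
  have form_diff: "form (P n) (\<lambda>x. v n x - u x) (\<lambda>x. v n x - u x) = load_functional (v n) - 2 * form (P n) (v n) u + form (P n) u u" for n
    using form_diff_square[OF P v u] st[OF v0] by simp
  have cross: "(\<lambda>n. form (P n) (v n) u) \<longlonglongrightarrow> form \<rho> u u" using P weak u by (rule form_lim)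
  have diag: "(\<lambda>n. form (P n) u u) \<longlonglongrightarrow> form \<rho> u u"
    by (rule form_limit[where v = "\<lambda>_. u" and K = "energy (\<lambda>x. u x - u x)", OF P \<rho> weak u u u]) auto
  have "(\<lambda>n. load_functional (v n) - 2 * form (P n) (v n) u + form (P n) u u) \<longlonglongrightarrow> load_functional u - 2 * form \<rho> u u + form \<rho> u u"
    by (intro tendsto_add tendsto_diff tendsto_mult_left load_lim cross diag)
  then have form_0: "(\<lambda>n. form (P n) (\<lambda>x. v n x - u x) (\<lambda>x. v n x - u x)) \<longlonglongrightarrow> 0"
    by (simp add: form_diff energy_identity)
  have energy_0: "(\<lambda>n. energy (\<lambda>x. v n x - u x)) \<longlonglongrightarrow> 0"
  proof (rule Lim_null_comparison)
    show "(\<lambda>n. form (P n) (\<lambda>x. v n x - u x) (\<lambda>x. v n x - u x) / \<rho>min\<^sup>2) \<longlonglongrightarrow> 0"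
      using tendsto_divide[OF form_0 tendsto_const[of "\<rho>min\<^sup>2"]] \<rho>min_pos by simp
    have "norm (energy (\<lambda>x. v n x - u x)) \<le> form (P n) (\<lambda>x. v n x - u x) (\<lambda>x. v n x - u x) / \<rho>min\<^sup>2" for n
      using form_coercive[OF P U_diff[OF v u], of n n] energy_nonneg[of "\<lambda>x. v n x - u x"] \<rho>min_pos
      by (simp add: pos_le_divide_eq mult.commute)
    then show "\<forall>\<^sub>F n in sequentially. norm (energy (\<lambda>x. v n x - u x)) \<le> form (P n) (\<lambda>x. v n x - u x) (\<lambda>x. v n x - u x) / \<rho>min\<^sup>2"
      by simp
  qed
  have "\<exists>N. \<forall>i\<ge>N. \<forall>j\<ge>N. energy (\<lambda>x. v i x - v j x) \<le> \<epsilon>" if \<epsilon>: "\<epsilon> > 0" for \<epsilon>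
  proof -
    obtain N where N: "\<And>n. n \<ge> N \<Longrightarrow> \<bar>energy (\<lambda>x. v n x - u x)\<bar> < \<epsilon> / 4"
      using LIMSEQ_D[OF energy_0, of "\<epsilon> / 4"] \<epsilon> by auto
    have "energy (\<lambda>x. v i x - v j x) \<le> \<epsilon>" if "i \<ge> N" "j \<ge> N" for i j
    proof -
      have "(\<lambda>x. (v i x - u x) + (- 1) * (v j x - u x)) = (\<lambda>x. v i x - v j x)" by auto
      then have "energy (\<lambda>x. v i x - v j x) \<le> 2 * energy (\<lambda>x. v i x - u x) + 2 * energy (\<lambda>x. v j x - u x)"
        using energy_sum_le[OF U_diff[OF v u] U_diff[OF v u], of i "- 1" j] by simp
      then show ?thesis using N[OF that(1)] N[OF that(2)] by linarith
    qed
    then show ?thesis by blast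
  qed
  from energy_Cauchy_has_limit[OF v0 this] obtain w r3 where w: "w \<in> U\<^sub>0" and r3: "strict_mono (r3::nat\<Rightarrow>nat)"
    and lim_w: "AE x in MD. (\<lambda>n. v (r3 n) x) \<longlonglongrightarrow> w x" by blast
  have "AE x in MD. u x = w x"
    using limv lim_w
  proof eventually_elim
    case (elim x)
    have "(\<lambda>n. v (r3 n) x) \<longlonglongrightarrow> u x" using LIMSEQ_subseq_LIMSEQ[OF elim(1) r3] by (simp add: o_def)
    then show ?case using elim(2) by (rule LIMSEQ_unique)
  qed
  then have "u \<in> U\<^sub>0" by (rule U0_cong_AE[OF w u])
  then have "feasible_pair \<rho> u" using \<rho> limit_state by (simp add: feasible_pair_iff)
  moreover have "weak_star_Linf_tendsto D (\<lambda>n. R (r n)) \<rho>" using weak by (simp add: P_def[abs_def])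
  moreover have "(\<lambda>n. energy (\<lambda>x. V (r n) x - u x)) \<longlonglongrightarrow> 0" using energy_0 by (simp add: v_def)
  ultimately show thesis using r by (intro that)
qed

theorem ex_minimizer:
  assumes lsc: "seq_lsc \<Omega> A \<delta> \<rho>min \<rho>max \<gamma> J"
  shows "\<exists>\<rho>' u'. feasible_pair \<rho>' u' \<and> (\<forall>\<rho> u. feasible_pair \<rho> u \<longrightarrow> J \<rho>' u' \<le> J \<rho> u)"
proof -
  define S where "S = {ereal (J \<rho> u) |\<rho> u. feasible_pair \<rho> u}"
  have "S \<noteq> {}" using ex_state[OF const_design] by (auto simp: S_def)
  then obtain a where a: "decseq a" "range a \<subseteq> S" "Inf S = (INF n. a n)"
    using Inf_countable_INF by blast
  have "\<forall>n. \<exists>q. feasible_pair (fst q) (snd q) \<and> a n = ereal (J (fst q) (snd q))"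
  proof
    fix n
    have "a n \<in> S" using a(2) by auto
    then obtain \<rho> u where "a n = ereal (J \<rho> u)" "feasible_pair \<rho> u" unfolding S_def by blast
    then show "\<exists>q. feasible_pair (fst q) (snd q) \<and> a n = ereal (J (fst q) (snd q))"
      by (intro exI[of _ "(\<rho>, u)"]) simp
  qed
  from choice[OF this] obtain Q where
    Q: "\<forall>n. feasible_pair (fst (Q n)) (snd (Q n)) \<and> a n = ereal (J (fst (Q n)) (snd (Q n)))" ..
  define R where "R n = fst (Q n)" for n
  define V where "V n = snd (Q n)" for n
  have RV: "feasible_pair (R n) (V n)" "a n = ereal (J (R n) (V n))" for n
    using Q by (simp_all add: R_def V_def)
  obtain \<rho> u r where opt: "feasible_pair \<rho> u" and r: "strict_mono (r::nat\<Rightarrow>nat)"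
    and weak: "weak_star_Linf_tendsto D (\<lambda>n. R (r n)) \<rho>" and strong: "(\<lambda>n. energy (\<lambda>x. V (r n) x - u x)) \<longlonglongrightarrow> 0"
    by (rule feasible_pairs_compact[where R = R and V = V, OF RV(1)]) (rule that)
  have "(\<lambda>n. U0_norm \<Omega> A \<delta> (\<lambda>x. V (r n) x - u x)) \<longlonglongrightarrow> 0"
    using tendsto_real_sqrt[OF strong] by (simp add: U0_norm_def energy_def)
  then have "ereal (J \<rho> u) \<le> liminf (\<lambda>n. ereal (J (R (r n)) (V (r n))))"
    using lsc[unfolded seq_lsc_def, rule_format, of "\<lambda>n. R (r n)" \<rho> "\<lambda>n. V (r n)" u] RV(1) opt weak
    by (simp add: feasible_pair_iff)
  also have "\<dots> = Inf S"
  proof (rule lim_imp_Liminf)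
    have "a \<longlonglongrightarrow> Inf S" unfolding a(3) using a(1) by (rule LIMSEQ_INF)
    then show "(\<lambda>n. ereal (J (R (r n)) (V (r n)))) \<longlonglongrightarrow> Inf S"
      using LIMSEQ_subseq_LIMSEQ[OF _ r] by (simp add: o_def RV(2)[symmetric])
  qed simp
  finally have min: "ereal (J \<rho> u) \<le> Inf S" .
  have "J \<rho> u \<le> J \<rho>' u'" if "feasible_pair \<rho>' u'" for \<rho>' u'
  proof -
    have "ereal (J \<rho>' u') \<in> S" using that unfolding S_def by blast
    then have "Inf S \<le> ereal (J \<rho>' u')" by (rule Inf_lower)
    with min have "ereal (J \<rho> u) \<le> ereal (J \<rho>' u')" by (rule order_trans)
    then show ?thesis by simp
  qed
  then show ?thesis using opt by blast
qed

end

theorem proposition7: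
  fixes \<Omega> :: "(real^'n) set"
    and A :: "real \<Rightarrow> real \<Rightarrow> real"
    and s \<delta> \<rho>min \<rho>max \<gamma> p :: real
    and c :: "real \<Rightarrow> real"
    and f :: "real^'n \<Rightarrow> real"
    and J :: "(real^'n \<Rightarrow> real) \<Rightarrow> (real^'n \<Rightarrow> real) \<Rightarrow> real"
  assumes "CARD('n) \<ge> 2"
    and "open \<Omega>" "bounded \<Omega>" "connected \<Omega>"
    and A_nonneg: "\<And>d r. d > 0 \<Longrightarrow> r \<ge> 0 \<Longrightarrow> A d r \<ge> 0"
    and A_integrable: "\<And>d. d > 0 \<Longrightarrow> integrable lebesgue (\<lambda>x::real^'n. A d (norm x))"
    and A_normalized: "\<And>d. d > 0 \<Longrightarrow>
          1 / real CARD('n) * (LINT x::real^'n|lebesgue. A d (norm x)) = 1"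
    and A_support: "\<And>d. d > 0 \<Longrightarrow> closure {x::real^'n. A d (norm x) \<noteq> 0} \<subseteq> ball 0 d"
    and "0 < s" "s < 1"
    and "\<And>d. d > 0 \<Longrightarrow> c d > 0"
    and A_lower: "\<And>d x::real^'n. d > 0 \<Longrightarrow> x \<in> ball 0 (d / 2) - {0} \<Longrightarrow>
          A d (norm x) \<ge> c d * norm x powr (- (real CARD('n) + 2 * s - 2))"
    and "0 < \<rho>min" "\<rho>min < \<gamma>" "\<gamma> < \<rho>max"
    and "\<delta> > 0"
    and "f \<in> L2_on \<Omega>"
    and "p = 2"
    and "seq_lsc \<Omega> A \<delta> \<rho>min \<rho>max \<gamma> J"
  shows "\<exists>\<rho>' u'. feasible \<Omega> A \<delta> \<rho>min \<rho>max \<gamma> p f \<rho>' u' \<and>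
           (\<forall>\<rho> u. feasible \<Omega> A \<delta> \<rho>min \<rho>max \<gamma> p f \<rho> u \<longrightarrow> J \<rho>' u' \<le> J \<rho> u)"
proof -
  have lower: "c \<delta> * norm x powr (- (real CARD('n) + 2 * s - 2)) \<le> A \<delta> (norm x)"
    if "x \<in> ball 0 (\<delta> / 2) - {0}" for x :: "real^'n"
    using \<open>\<delta> > 0\<close> that by (rule A_lower)
  have "0 < c \<delta>" using \<open>\<delta> > 0\<close> by (rule assms)
  have nonneg: "0 \<le> A \<delta> r" if "0 \<le> r" for r
    using \<open>\<delta> > 0\<close> that by (rule A_nonneg)
  have "nonlocal_energy \<Omega> A \<delta> s (c \<delta>)"
    using \<open>open \<Omega>\<close> \<open>bounded \<Omega>\<close> \<open>\<delta> > 0\<close> \<open>0 < s\<close> \<open>0 < c \<delta>\<close> nonneg lower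
    by (rule nonlocal_energy.intro)
  moreover have "design_problem_axioms \<Omega> f \<rho>min \<rho>max \<gamma>"
    using \<open>f \<in> L2_on \<Omega>\<close> \<open>0 < \<rho>min\<close> \<open>\<rho>min < \<gamma>\<close> \<open>\<gamma> < \<rho>max\<close> by (rule design_problem_axioms.intro)
  ultimately interpret design_problem \<Omega> A \<delta> s "c \<delta>" f \<rho>min \<rho>max \<gamma>
    by (rule design_problem.intro)
  show ?thesis
    unfolding \<open>p = 2\<close> using \<open>seq_lsc \<Omega> A \<delta> \<rho>min \<rho>max \<gamma> J\<close> by (rule ex_minimizer)
qed

end
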